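(* Let $\vec\Gamma$ be a finite connected asymmetric arc-transitive digraph of out-valence $4$. Then $\vec\Gamma$ has a non-identity semiregular automorphism.
   Context: A digraph $\vec\Gamma$ consists of a finite non-empty vertex set $V$ and an arc set $A\subseteq V\times V$. It is asymmetric if $(u,v)\in A$ implies $(v,u)\notin A$. It has out-valence $4$ if every vertex has exactly $4$ out-neighbours (vertices $w$ with $(v,w)\in A$). An automorphism is a permutation of $V$ preserving $A$; $\vec\Gamma$ is arc-transitive if its automorphism group acts transitively on $A$. Connected means the underlying undirected graph is connected. A permutation is semiregular if the group it generates has no non-identity element fixing a point. *)

theory Defs
  imports "Graph_Theory.Graph_Theory" "HOL-Algebra.Bij" "HOL-Algebra.Generated_Groups"
begin

text \<open>
  A digraph with arc set \<open>A \<subseteq> V \<times> V\<close> is a \<open>pair_pre_digraph\<close>. Permutations of the vertex set are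
  elements of the library group \<open>BijGroup (pverts G)\<close>, i.e. bijections of \<open>pverts G\<close> that are
  \<open>undefined\<close> outside it; in particular the identity permutation is \<open>\<one>\<^bsub>BijGroup (pverts G)\<^esub>\<close>.
\<close>

definition digraph_automorphisms :: "'a pair_pre_digraph \<Rightarrow> ('a \<Rightarrow> 'a) set" where
  "digraph_automorphisms G =
     {p \<in> carrier (BijGroup (pverts G)).
        \<forall>u \<in> pverts G. \<forall>v \<in> pverts G. (p u, p v) \<in> parcs G \<longleftrightarrow> (u, v) \<in> parcs G}"

definition arc_transitive :: "'a pair_pre_digraph \<Rightarrow> bool" where
  "arc_transitive G \<longleftrightarrow>
     (\<forall>(u, v) \<in> parcs G. \<forall>(x, y) \<in> parcs G.
        \<exists>p \<in> digraph_automorphisms G. p u = x \<and> p v = y)"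

definition semiregular :: "'a set \<Rightarrow> ('a \<Rightarrow> 'a) \<Rightarrow> bool" where
  "semiregular V p \<longleftrightarrow>
     p \<in> carrier (BijGroup V) \<and>
     (\<forall>g \<in> generate (BijGroup V) {p}. g \<noteq> \<one>\<^bsub>BijGroup V\<^esub> \<longrightarrow> (\<forall>v \<in> V. g v \<noteq> v))"

end

theory Submission
  imports Defs "HOL-Algebra.Sylow" "HOL-Algebra.Multiplicative_Group"
    "HOL-Computational_Algebra.Fundamental_Theorem_Algebra"
begin

text \<open>
  Suppose that every automorphism of prime order fixes a vertex. An automorphism of prime order
  \<open>p \<ge> 5\<close> fixing a vertex fixes its four out-neighbours, hence everything, so the automorphism group
  \<open>H\<close> has order \<open>2\<^sup>a 3\<^sup>b\<close>. If no element of order 3 fixed a vertex, \<open>H\<close> would be a 2-group, and a central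
  involution fixing one vertex of a transitive group fixes all. So some element of order 3 acts as a
  3-cycle on the out-neighbours of a vertex \<open>v\<close>, which forces \<open>N\<^sub>v\<close> to be transitive on them for every
  nontrivial normal subgroup \<open>N\<close>. By Burnside's theorem we may take \<open>N\<close> elementary abelian, and then it
  is a 2-group. Now \<open>N \<langle>x\<rangle>\<close> is transitive on the vertices whenever \<open>x\<close> maps \<open>v\<close> to an
  out-neighbour. An element of \<open>N\<close> is semiregular as soon as none of its conjugates under powers of
  \<open>x\<close> fixes \<open>v\<close>. If \<open>x\<close> has 2-power order, a fixed point of \<open>x\<close> in \<open>N\<close> has this property. Otherwise some
  power \<open>y\<close> of \<open>x\<close> has order 3, we may assume that \<open>y\<close> fixes \<open>v\<close>, and on a suitable \<open>A \<le> N\<close> conjugation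
  by \<open>x\<close> satisfies \<open>x\<^bsup>2q\<^esup> + x\<^sup>q + 1 = 0\<close> with \<open>q\<close> a power of 3. This polynomial is irreducible over the
  field with two elements, because the order of 2 modulo \<open>3q\<close> is \<open>2q\<close>, so linear recurring sequences
  with arbitrary initial values occur and provide the required element of \<open>A\<close>.

  Burnside's theorem is needed for the orders \<open>2\<^sup>a q\<^sup>b\<close> only, where it has a proof without characters.
  Let \<open>z\<close> be a central involution of a Sylow 2-subgroup of a simple group \<open>G\<close>, so that its class \<open>C\<close> has
  \<open>q\<^sup>j\<close> elements. The class sum is a self-adjoint integral operator on the group algebra; let \<open>e\<close> be the
  idempotent projecting to its eigenvalue \<open>l\<close>. With \<open>d = |G| e(1)\<close> and \<open>t = |G| e(z)\<close>, the traces of the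
  projection and of \<open>z\<close> on the eigenspace, one has \<open>|C| t = l d\<close>, and the trace of \<open>f \<mapsto> z f z\<close> is
  \<open>t\<^sup>2 / d\<close>. So \<open>l\<close> is rational, hence an integer, and \<open>d\<close> divides \<open>t\<^sup>2\<close>. Therefore \<open>q\<close> divides \<open>t\<close> unless
  \<open>t = \<plusminus>d\<close>. As the numbers \<open>t\<close> add up to \<open>|G|\<close> times the coefficient of \<open>z\<close> in \<open>1\<close>, which is 0, and the
  trivial eigenspace contributes 1, there is an eigenspace with \<open>t = -d\<close>, on which \<open>z\<close> acts as \<open>-1\<close>;
  by simplicity \<open>G = {1, z}\<close>.
\<close>

section \<open>Groups and actions\<close>

text \<open>
  Groups are finite subgroups of a type of class \<open>group_add\<close>, the library class of possibly noncommutative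
  groups in additive notation.
\<close>

lemmas group_add_norm = diff_conv_add_uminus add.assoc minus_add

definition add_subgroup :: "'g::group_add set \<Rightarrow> bool" where
  "add_subgroup H \<longleftrightarrow> 0 \<in> H \<and> (\<forall>x\<in>H. \<forall>y\<in>H. x + y \<in> H) \<and> (\<forall>x\<in>H. - x \<in> H)"

definition normal_in :: "'g::group_add set \<Rightarrow> 'g set \<Rightarrow> bool" where
  "normal_in N H \<longleftrightarrow> add_subgroup N \<and> N \<subseteq> H \<and> (\<forall>g\<in>H. \<forall>x\<in>N. g + x - g \<in> N)"

definition nmul :: "nat \<Rightarrow> 'g::group_add \<Rightarrow> 'g" where
  "nmul n x = ((+) x ^^ n) 0"

lemma add_subgroupD:
  assumes "add_subgroup H"
  shows "0 \<in> H" "x \<in> H \<Longrightarrow> y \<in> H \<Longrightarrow> x + y \<in> H" "x \<in> H \<Longrightarrow> - x \<in> H"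
    "x \<in> H \<Longrightarrow> y \<in> H \<Longrightarrow> x - y \<in> H"
proof -
  show "0 \<in> H" and p: "x \<in> H \<Longrightarrow> y \<in> H \<Longrightarrow> x + y \<in> H" and m: "x \<in> H \<Longrightarrow> - x \<in> H" for x y
    using assms by (auto simp: add_subgroup_def)
  show "x \<in> H \<Longrightarrow> y \<in> H \<Longrightarrow> x - y \<in> H"
    using p[of x "- y"] m[of y] by simp
qed

lemma normal_inD:
  assumes "normal_in N H"
  shows "add_subgroup N" "N \<subseteq> H" "g \<in> H \<Longrightarrow> x \<in> N \<Longrightarrow> g + x - g \<in> N"
  using assms by (auto simp: normal_in_def)

lemma add_subgroup_cancel:
  assumes "add_subgroup H" "x \<in> H"
  shows "x + y \<in> H \<longleftrightarrow> y \<in> H" "y + x \<in> H \<longleftrightarrow> y \<in> H" "- y \<in> H \<longleftrightarrow> y \<in> H"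
proof -
  note S = add_subgroupD[OF assms(1)]
  show "x + y \<in> H \<longleftrightarrow> y \<in> H" using S(2)[of "- x" "x + y"] S(2)[of x y] S(3)[of x] assms by auto
  show "y + x \<in> H \<longleftrightarrow> y \<in> H" using S(4)[of "y + x" x] S(2)[of y x] assms by auto
  show "- y \<in> H \<longleftrightarrow> y \<in> H" using S(3)[of "- y"] S(3)[of y] by auto
qed

lemma nmul_simps [simp]: "nmul 0 x = 0" "nmul (Suc n) x = x + nmul n x"
  by (simp_all add: nmul_def)

lemma nmul_add: "nmul (m + n) x = nmul m x + nmul n x"
  by (induction m) (simp_all add: add.assoc)

lemma nmul_mult: "nmul (m * n) x = nmul m (nmul n x)"
  by (induction m) (simp_all add: nmul_add)

lemma nmul_zero [simp]: "nmul n 0 = 0"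
  by (induction n) simp_all

lemma nmul_closed: "add_subgroup H \<Longrightarrow> x \<in> H \<Longrightarrow> nmul n x \<in> H"
  by (induction n) (auto simp: add_subgroupD)

lemma nmul_commute: "nmul m x + nmul n x = nmul n x + nmul m x"
  by (metis nmul_add add.commute)

lemma nmul_conj: "nmul n (g + x - g) = g + nmul n x - g"
proof (induction n)
  case (Suc n)
  then show ?case by (simp add: group_add_norm del: add_uminus_conv_diff)
qed simp

section \<open>Lagrange, Sylow and Cauchy in additive notation\<close>

text \<open>The carrier-based view of an additive subgroup, through which the library theorems on
  finite groups are applied.\<close>

definition set_group :: "'g::group_add set \<Rightarrow> 'g monoid" where
  "set_group H = \<lparr>carrier = H, mult = (+), one = 0\<rparr>"

lemma set_group_simps [simp]:
  "carrier (set_group H) = H" "mult (set_group H) = (+)" "one (set_group H) = 0"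
  by (simp_all add: set_group_def)

lemma group_set_group: "add_subgroup H \<Longrightarrow> group (set_group H)"
  by (rule groupI) (auto simp: add.assoc add_subgroupD(1,2) intro: add_subgroupD(3) left_minus)

lemma m_inv_set_group:
  assumes "add_subgroup H" "x \<in> H"
  shows "m_inv (set_group H) x = - x"
proof -
  interpret group "set_group H" by (rule group_set_group) fact
  show ?thesis using assms add_subgroupD(3)[OF assms] by (intro inv_equality) auto
qed

lemma subgroup_set_group_iff:
  assumes "add_subgroup H"
  shows "subgroup K (set_group H) \<longleftrightarrow> add_subgroup K \<and> K \<subseteq> H"
proof
  assume K: "subgroup K (set_group H)"
  have sub: "K \<subseteq> H" using subgroup.subset[OF K] by simp
  have "- x \<in> K" if "x \<in> K" for x
    using subgroup.m_inv_closed[OF K that] m_inv_set_group[OF assms, of x] that sub by auto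
  then show "add_subgroup K \<and> K \<subseteq> H"
    using subgroup.m_closed[OF K] subgroup.one_closed[OF K] sub by (auto simp: add_subgroup_def)
next
  assume K: "add_subgroup K \<and> K \<subseteq> H"
  show "subgroup K (set_group H)"
    using K assms by (intro subgroup.intro) (auto simp: m_inv_set_group subset_eq add_subgroupD)
qed

lemma pow_set_group: "x [^]\<^bsub>set_group H\<^esub> (n::nat) = nmul n x"
proof (induction n)
  case (Suc n)
  then show ?case using nmul_commute[of 1 x n] by (simp add: nat_pow_def)
qed (simp add: nat_pow_def)

lemma card_subgroup_pos: "finite H \<Longrightarrow> add_subgroup H \<Longrightarrow> card H > 0"
  using add_subgroupD(1) card_gt_0_iff by blast

lemma lagrange_add:
  assumes "finite H" "add_subgroup H" "add_subgroup K" "K \<subseteq> H"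
  shows "card K dvd card H"
proof -
  interpret group "set_group H" by (rule group_set_group) fact
  have "subgroup K (set_group H)" using assms by (simp add: subgroup_set_group_iff)
  from lagrange[OF this] show ?thesis by (metis dvd_triv_right Coset.order_def set_group_simps(1))
qed

lemma nmul_card:
  assumes "finite H" "add_subgroup H" "x \<in> H"
  shows "nmul (card H) x = 0"
proof -
  interpret group "set_group H" by (rule group_set_group) fact
  show ?thesis using pow_order_eq_1[of x] assms by (simp add: pow_set_group Coset.order_def)
qed

lemma sylow_add:
  assumes "finite H" "add_subgroup H" "prime p" "card H = p ^ a * m"
  shows "\<exists>P. add_subgroup P \<and> P \<subseteq> H \<and> card P = p ^ a"
proof -
  have "\<exists>P. subgroup P (set_group H) \<and> card P = p ^ a"
    using assms by (intro sylow_thm[of p _ a m]) (auto simp: Coset.order_def group_set_group)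
  then show ?thesis using assms(2) subgroup_set_group_iff by blast
qed

lemma cauchy_add:
  assumes "finite H" "add_subgroup H" "prime p" "p dvd card H"
  shows "\<exists>x\<in>H. x \<noteq> 0 \<and> nmul p x = 0"
proof -
  \<comment> \<open>\<open>sylow_add\<close> lets \<open>p\<close> divide the cofactor, so exponent
    1 gives a subgroup of order exactly \<open>p\<close>.\<close>
  obtain m where "card H = p ^ 1 * m" using assms(4) by (auto elim: dvdE)
  from sylow_add[OF assms(1-3) this] obtain P where P: "add_subgroup P" "P \<subseteq> H" "card P = p" by auto
  have "P \<noteq> {0}" using P(3) assms(3) by auto
  then obtain x where "x \<in> P" "x \<noteq> 0" using add_subgroupD(1)[OF P(1)] by blast
  then show ?thesis using nmul_card[of P x] P assms(1) finite_subset by blast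
qed

text \<open>Descent along the Euclidean algorithm. For coprime \<open>m\<close> and \<open>n\<close>
  it forces \<open>x = 0\<close>.\<close>

lemma nmul_gcd:
  assumes "nmul m x = 0" "nmul n x = 0"
  shows "nmul (gcd m n) x = 0"
  using assms
proof (induction m n rule: gcd_nat_induct)
  case (step m n)
  have "nmul (m div n * n) x = 0" using step.prems by (simp add: nmul_mult)
  then have "nmul (m mod n) x = 0"
    using step.prems(1) nmul_add[of "m div n * n" "m mod n" x] by simp
  then show ?case using step by (subst gcd_red_nat) blast
qed simp

section \<open>Finite group actions\<close>

locale set_action =
  fixes P :: "'g::group_add set" and X :: "'x set" and act :: "'g \<Rightarrow> 'x \<Rightarrow> 'x"
  assumes sub: "add_subgroup P" and finP: "finite P"
    and act_closed: "g \<in> P \<Longrightarrow> x \<in> X \<Longrightarrow> act g x \<in> X"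
    and act_zero: "x \<in> X \<Longrightarrow> act 0 x = x"
    and act_add: "g \<in> P \<Longrightarrow> h \<in> P \<Longrightarrow> x \<in> X \<Longrightarrow> act (g + h) x = act g (act h x)"
begin

definition orb :: "'x \<Rightarrow> 'x set" where "orb x = (\<lambda>g. act g x) ` P"

definition stab :: "'x \<Rightarrow> 'g set" where "stab x = {g \<in> P. act g x = x}"

lemma act_minus: "g \<in> P \<Longrightarrow> x \<in> X \<Longrightarrow> act (- g) (act g x) = x" 
  using act_add[of "- g" g x] act_zero add_subgroupD[OF sub] by simp

lemma act_eq_iff: "g \<in> P \<Longrightarrow> h \<in> P \<Longrightarrow> x \<in> X \<Longrightarrow> act g x = act h x \<longleftrightarrow> act (- h + g) x = x"
  using act_add[of "- h" g x] act_add[of h "- h + g" x] act_minus[of h x]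
    add_subgroupD(2)[OF sub, of "- h" g] add_subgroupD(3)[OF sub, of h] by auto

lemma stab_subgroup: "x \<in> X \<Longrightarrow> add_subgroup (stab x)"
  unfolding add_subgroup_def stab_def
  using act_minus[of _ x] act_zero[of x] act_add[of _ _ x] add_subgroupD(1-3)[OF sub] by force

text \<open>The fibres of \<open>g \<mapsto> act g x\<close> over the orbit are left cosets of the
  stabiliser, hence of equal size.\<close>

lemma orbit_stabilizer:
  assumes "x \<in> X"
  shows "card P = card (orb x) * card (stab x)"
proof -
  have "card {g \<in> P. act g x = y} = card (stab x)" if "y \<in> orb x" for y
  proof -
    obtain h where h: "h \<in> P" "y = act h x" using \<open>y \<in> orb x\<close> by (auto simp: orb_def)
    have "{g \<in> P. act g x = y} = (+) h ` stab x"
    proof (intro Set.set_eqI iffI)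
      fix g assume g: "g \<in> {g \<in> P. act g x = y}"
      then have "- h + g \<in> stab x"
        using h assms add_subgroupD[OF sub] act_eq_iff[of g h x] by (auto simp: stab_def)
      then show "g \<in> (+) h ` stab x" by (intro image_eqI[of _ _ "- h + g"]) auto
    next
      fix g assume "g \<in> (+) h ` stab x"
      then show "g \<in> {g \<in> P. act g x = y}"
        using h assms add_subgroupD[OF sub] act_add by (auto simp: stab_def)
    qed
    then show ?thesis by (simp add: card_image)
  qed
  moreover have "card P = (\<Sum>y\<in>orb x. card {g \<in> P. act g x = y})"
    using sum.image_gen[OF finP, of "\<lambda>_. 1::nat" "\<lambda>g. act g x"] by (simp add: orb_def)
  ultimately show ?thesis by simp
qed

lemma dvd_card_if_dvd_orbits:
  assumes "finite X" "\<And>x. x \<in> X \<Longrightarrow> k dvd card (orb x)"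
  shows "k dvd card X"
proof -
  have sub': "orb x \<subseteq> X" if "x \<in> X" for x using that act_closed by (auto simp: orb_def)
  have self: "x \<in> orb x" if "x \<in> X" for x
    using that act_zero add_subgroupD(1)[OF sub] by (force simp: orb_def)
  have un: "X = \<Union> (orb ` X)" using sub' self by blast
  have eq: "orb y = orb x" if "x \<in> X" "y \<in> orb x" for x y
  proof -
    obtain h where h: "h \<in> P" "y = act h x" using \<open>y \<in> orb x\<close> by (auto simp: orb_def)
    have "act g y \<in> orb x" if "g \<in> P" for g
      using that h \<open>x \<in> X\<close> act_add[of g h x] add_subgroupD(2)[OF sub] by (metis imageI orb_def)
    moreover have "act g x \<in> orb y" if "g \<in> P" for g
    proof -
      have "act g x = act (g - h) y"
        using that h \<open>x \<in> X\<close> act_add[of "g - h" h x] add_subgroupD[OF sub] by simp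
      then show ?thesis using that h add_subgroupD(4)[OF sub] by (auto simp: orb_def)
    qed
    ultimately show ?thesis by (auto simp: orb_def)
  qed
  have "k dvd card (\<Union> (orb ` X))"
  proof (rule dvd_partition)
    show "finite (\<Union> (orb ` X))" using assms(1) un by simp
    show "\<forall>c\<in>orb ` X. k dvd card c" using assms(2) by blast
    show "\<forall>c1\<in>orb ` X. \<forall>c2\<in>orb ` X. c1 \<noteq> c2 \<longrightarrow> c1 \<inter> c2 = {}"
      using eq by (metis (no_types, lifting) disjoint_iff imageE)
  qed
  then show ?thesis using un by argo
qed

text \<open>Orbit sizes are powers of \<open>p\<close>. Without a fixed point all of them are
  divisible by \<open>p\<close>, and then so is \<open>card X\<close>.\<close>

lemma p_group_fixed_point:
  assumes "prime p" "card P = p ^ k" "finite X" "\<not> p dvd card X"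
  shows "\<exists>x\<in>X. \<forall>g\<in>P. act g x = x"
proof (rule ccontr)
  assume no: "\<not> ?thesis"
  have "p dvd card (orb x)" if x: "x \<in> X" for x
  proof -
    have "card (orb x) dvd p ^ k" using orbit_stabilizer[OF x] assms(2) by (metis dvd_triv_left)
    then obtain i where i: "card (orb x) = p ^ i" using divides_primepow_nat[OF assms(1)] by blast
    have "i \<noteq> 0"
    proof
      assume "i = 0"
      then obtain y where y: "orb x = {y}" using i card_1_singletonE by auto
      then have "act g x = x" if "g \<in> P" for g
        using that act_zero[OF x] add_subgroupD(1)[OF sub] unfolding orb_def by (metis imageI singletonD)
      then show False using no x by blast
    qed
    then show ?thesis using i by simp
  qed
  from dvd_card_if_dvd_orbits[OF assms(3) this] assms(4) show False by simp
qed

end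

section \<open>Involutions with a conjugacy class of prime power size\<close>

text \<open>\<open>P\<close> is the matrix of a projection and \<open>r\<close> its rank. Induction
  on the number of nonzero rows: a nonzero entry \<open>P a b\<close> gives a rank-one idempotent
  \<open>Q\<close> (column \<open>b\<close> times row \<open>a\<close>, scaled) of trace 1 with
  \<open>P Q = Q P = Q\<close>; then \<open>P - Q\<close> is idempotent and its row \<open>a\<close>
  vanishes.\<close>

lemma idempotent_kernel_trace:
  fixes P :: "'x \<Rightarrow> 'x \<Rightarrow> 'f::field_char_0"
  assumes "finite X" "\<And>x w. x \<in> X \<Longrightarrow> w \<in> X \<Longrightarrow> (\<Sum>y\<in>X. P x y * P y w) = P x w"
  shows "\<exists>r::nat. (\<Sum>x\<in>X. P x x) = of_nat r \<and> (r = 0 \<longrightarrow> (\<forall>x\<in>X. \<forall>y\<in>X. P x y = 0))"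
  using assms(2)
proof (induction "card {x \<in> X. \<exists>y\<in>X. P x y \<noteq> 0}" arbitrary: P rule: less_induct)
  case less
  note idem = less.prems
  show ?case
  proof (cases "\<exists>a\<in>X. \<exists>b\<in>X. P a b \<noteq> 0")
    case False
    then show ?thesis by (intro exI[of _ 0]) auto
  next
    case True
    then obtain a b where ab: "a \<in> X" "b \<in> X" "P a b \<noteq> 0" by blast
    define Q where "Q x y = P x b * P a y / P a b" for x y
    define P' where "P' x y = P x y - Q x y" for x y
    have PQ: "(\<Sum>y\<in>X. P x y * Q y w) = Q x w" if "x \<in> X" for x w
    proof -
      have "(\<Sum>y\<in>X. P x y * Q y w) = (\<Sum>y\<in>X. P x y * P y b) * (P a w / P a b)"
        by (simp add: Q_def sum_distrib_right sum_divide_distrib mult.assoc)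
      then show ?thesis using idem[OF that ab(2)] by (simp add: Q_def)
    qed
    have QP: "(\<Sum>y\<in>X. Q x y * P y w) = Q x w" if "w \<in> X" for x w
    proof -
      have "(\<Sum>y\<in>X. Q x y * P y w) = (P x b / P a b) * (\<Sum>y\<in>X. P a y * P y w)"
        by (simp add: Q_def sum_distrib_left mult_ac)
      then show ?thesis using idem[OF ab(1) that] by (simp add: Q_def)
    qed
    have QQ: "(\<Sum>y\<in>X. Q x y * Q y w) = Q x w" for x w
    proof -
      have "(\<Sum>y\<in>X. Q x y * Q y w) = (P x b / P a b) * (\<Sum>y\<in>X. P a y * Q y w)"
        by (simp add: Q_def sum_distrib_left mult_ac)
      then show ?thesis using PQ[OF ab(1), of w] ab(3) by (simp add: Q_def)
    qed
    have idem': "(\<Sum>y\<in>X. P' x y * P' y w) = P' x w" if "x \<in> X" "w \<in> X" for x w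
    proof -
      have "(\<Sum>y\<in>X. P' x y * P' y w) = (\<Sum>y\<in>X. P x y * P y w) - (\<Sum>y\<in>X. P x y * Q y w)
          - (\<Sum>y\<in>X. Q x y * P y w) + (\<Sum>y\<in>X. Q x y * Q y w)"
        unfolding P'_def by (simp add: algebra_simps sum.distrib sum_subtractf)
      then show ?thesis using idem PQ QP QQ that by (simp add: P'_def)
    qed
    have row: "P' a y = 0" for y using ab(3) by (simp add: P'_def Q_def)
    have "{x \<in> X. \<exists>y\<in>X. P' x y \<noteq> 0} \<subset> {x \<in> X. \<exists>y\<in>X. P x y \<noteq> 0}"
    proof
      show "{x \<in> X. \<exists>y\<in>X. P' x y \<noteq> 0} \<subseteq> {x \<in> X. \<exists>y\<in>X. P x y \<noteq> 0}"
        using ab(2) by (auto simp: P'_def Q_def) (metis div_0 mult_zero_left)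
      show "{x \<in> X. \<exists>y\<in>X. P' x y \<noteq> 0} \<noteq> {x \<in> X. \<exists>y\<in>X. P x y \<noteq> 0}"
        using row ab by blast
    qed
    then have "card {x \<in> X. \<exists>y\<in>X. P' x y \<noteq> 0} < card {x \<in> X. \<exists>y\<in>X. P x y \<noteq> 0}"
      using assms(1) by (intro psubset_card_mono) auto
    from less.hyps[OF this idem'] obtain r where r: "(\<Sum>x\<in>X. P' x x) = of_nat r" by blast
    have "(\<Sum>x\<in>X. Q x x) = (\<Sum>x\<in>X. P a x * P x b) / P a b"
      by (simp add: Q_def sum_divide_distrib mult.commute)
    then have "(\<Sum>x\<in>X. Q x x) = 1" using idem ab by simp
    then have "(\<Sum>x\<in>X. P x x) = of_nat (Suc r)"
      using r unfolding P'_def by (simp add: sum_subtractf algebra_simps)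
    then show ?thesis by (intro exI[of _ "Suc r"]) simp
  qed
qed

section \<open>Polynomial relations between iterates of an operator\<close>

text \<open>For \<open>a i = (T ^^ i) f x\<close> this is the value at \<open>x\<close> of
  \<open>p(T)\<close> applied to \<open>f\<close>.\<close>

definition lincomb :: "(nat \<Rightarrow> complex) \<Rightarrow> complex poly \<Rightarrow> complex" where
  "lincomb a p = (\<Sum>i\<le>degree p. coeff p i * a i)"

lemma lincomb_eq:
  assumes "degree p \<le> n"
  shows "lincomb a p = (\<Sum>i\<le>n. coeff p i * a i)"
  unfolding lincomb_def by (rule sum.mono_neutral_left) (use assms in \<open>auto simp: coeff_eq_0\<close>)

text \<open>For iterates of a linear operator \<open>T\<close> this is
  \<open>((X - r) q)(T) f = q(T) (T f - r f)\<close>.\<close>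

lemma lincomb_linear_factor:
  "lincomb a ([:- r, 1:] * q) = lincomb (\<lambda>i. a (Suc i) - r * a i) q"
proof -
  let ?n = "degree q"
  have deg: "degree ([:- r, 1:] * q) \<le> Suc ?n"
    using degree_mult_le[of "[:- r, 1:]" q] by simp
  have "lincomb a ([:- r, 1:] * q) = (\<Sum>i\<le>Suc ?n. coeff (pCons 0 q) i * a i) - r * (\<Sum>i\<le>Suc ?n. coeff q i * a i)"
    unfolding lincomb_eq[OF deg] by (simp add: mult_pCons_left algebra_simps sum_subtractf sum_distrib_left sum.distrib del: sum.atMost_Suc)
  also have "(\<Sum>i\<le>Suc ?n. coeff (pCons 0 q) i * a i) = (\<Sum>i\<le>?n. coeff q i * a (Suc i))"
    by (subst sum.atMost_Suc_shift) simp
  also have "(\<Sum>i\<le>Suc ?n. coeff q i * a i) = lincomb a q"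
    by (rule lincomb_eq[symmetric]) simp
  finally show ?thesis
    by (simp add: lincomb_def algebra_simps sum_subtractf sum_distrib_left)
qed

text \<open>Linear dependence of infinitely many vectors \<open>v i\<close> on a finite set, one
  coordinate at a time. Since the lower bound \<open>m\<close> on the exponents is arbitrary, two
  relations with disjoint supports are available, and a combination of them handles the new
  coordinate.\<close>

lemma lincomb_relation_exists:
  assumes "finite X"
  shows "\<exists>p. p \<noteq> 0 \<and> (\<forall>i<m. coeff p i = 0) \<and> (\<forall>x\<in>X. lincomb (\<lambda>i. v i x) p = 0)"
  using assms
proof (induction X arbitrary: m)
  case empty
  show ?case by (intro exI[of _ "monom 1 m"]) (auto simp: monom_eq_0_iff)
next
  case (insert x X)
  obtain p where p: "p \<noteq> 0" "\<forall>i<m. coeff p i = 0" "\<forall>x\<in>X. lincomb (\<lambda>i. v i x) p = 0"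
    using insert.IH by blast
  \<comment> \<open>All exponents in \<open>q\<close> exceed \<open>degree p\<close>, so the leading
    term of \<open>q\<close> survives in \<open>s\<close>.\<close>
  obtain q where q: "q \<noteq> 0" "\<forall>i<Suc (degree p + m). coeff q i = 0" "\<forall>x\<in>X. lincomb (\<lambda>i. v i x) q = 0"
    using insert.IH by blast
  show ?case
  proof (cases "lincomb (\<lambda>i. v i x) p = 0")
    case True
    then show ?thesis using p by blast
  next
    case False
    define c where "c = lincomb (\<lambda>i. v i x) q / lincomb (\<lambda>i. v i x) p"
    define s where "s = q - smult c p"
    have dpq: "degree p < degree q"
    proof (rule ccontr)
      assume "\<not> degree p < degree q"
      then have "coeff q (degree q) = 0" using q(2) by simp
      then show False using q(1) by simp
    qed
    have deg: "degree s \<le> degree q" "degree p \<le> degree q"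
      unfolding s_def using dpq by (auto intro!: degree_diff_le)
    have lin: "lincomb a s = lincomb a q - c * lincomb a p" for a
      unfolding lincomb_eq[OF deg(1)] lincomb_eq[OF deg(2)] lincomb_eq[OF order_refl[of "degree q"]]
      by (simp add: s_def algebra_simps sum_subtractf sum_distrib_left)
    have "coeff s (degree q) \<noteq> 0"
      using q(1) dpq by (simp add: s_def coeff_eq_0)
    then have "s \<noteq> 0" by auto
    moreover have "\<forall>i<m. coeff s i = 0" using p(2) q(2) by (simp add: s_def)
    moreover have "\<forall>y\<in>insert x X. lincomb (\<lambda>i. v i y) s = 0"
      using p(3) q(3) False by (auto simp: lin c_def)
    ultimately show ?thesis by blast
  qed
qed

section \<open>Integrality of rational numbers\<close>

text \<open>In lowest terms \<open>r = a / b\<close>, every power of \<open>b\<close> divides the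
  nonzero integer \<open>c\<close>, so \<open>b = 1\<close>.\<close>

lemma Ints_if_powers_bounded_denominator:
  fixes r c :: complex
  assumes "r \<in> \<rat>" "c \<noteq> 0" "\<And>k. c * r ^ k \<in> \<int>"
  shows "r \<in> \<int>"
proof -
  obtain a b :: int where ab: "b > 0" "coprime a b" "r = of_int a / of_int b"
    using assms(1) by (rule Rats_cases')
  obtain m where m: "c = of_int m" using assms(3)[of 0] by (auto elim: Ints_cases)
  have m0: "m \<noteq> 0" using m assms(2) by auto
  have dvd: "b ^ k dvd m" for k
  proof -
    obtain l where l: "c * r ^ k = of_int l" using assms(3)[of k] by (auto elim: Ints_cases)
    have "(of_int (m * a ^ k) :: complex) = of_int (l * b ^ k)"
      using l ab(1) unfolding m ab(3) by (simp add: power_divide field_simps)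
    then have "m * a ^ k = l * b ^ k" by (simp only: of_int_eq_iff)
    then have "b ^ k dvd m * a ^ k" by simp
    moreover have "coprime (b ^ k) (a ^ k)" using ab(2) by (simp add: coprime_commute)
    ultimately show ?thesis by (simp add: coprime_dvd_mult_left_iff)
  qed
  have "b = 1"
  proof (rule ccontr)
    assume "b \<noteq> 1"
    then have b2: "b \<ge> 2" using ab(1) by simp
    have "b ^ nat \<bar>m\<bar> \<le> \<bar>m\<bar>" using dvd[of "nat \<bar>m\<bar>"] m0 ab(1) by (metis dvd_imp_le_int abs_of_pos zero_less_power)
    moreover have "\<bar>m\<bar> < 2 ^ nat \<bar>m\<bar>" 
      using of_nat_less_two_power[of "nat \<bar>m\<bar>", where 'a = int] by simp
    moreover have "(2::int) ^ nat \<bar>m\<bar> \<le> b ^ nat \<bar>m\<bar>" using b2 by (intro power_mono) auto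
    ultimately show False by linarith
  qed
  then show ?thesis using ab(3) by simp
qed

lemma common_denominator:
  fixes f :: "'x \<Rightarrow> complex"
  assumes "finite X" "\<And>x. x \<in> X \<Longrightarrow> f x \<in> \<rat>"
  shows "\<exists>D::int. D \<noteq> 0 \<and> (\<forall>x\<in>X. of_int D * f x \<in> \<int>)"
  using assms
proof (induction X)
  case (insert x X)
  then obtain D :: int where D: "D \<noteq> 0" "\<forall>x\<in>X. of_int D * f x \<in> \<int>" by auto
  obtain a b :: int where ab: "b > 0" "coprime a b" "f x = of_int a / of_int b"
    using insert.prems[of x] by (auto elim: Rats_cases')
  have "of_int (b * D) * f y \<in> \<int>" if "y \<in> insert x X" for y
  proof (cases "y = x")
    case True
    then have "of_int (b * D) * f y = of_int (D * a)" using ab by (simp add: mult_ac)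
    then show ?thesis by (metis Ints_of_int)
  next
    case False
    then have "of_int D * f y \<in> \<int>" using that D(2) by blast
    then have "of_int b * (of_int D * f y) \<in> \<int>" by (rule Ints_mult[OF Ints_of_int])
    then show ?thesis by (simp add: mult.assoc)
  qed
  then show ?case using D(1) ab(1) by (intro exI[of _ "b * D"]) auto
qed (intro exI[of _ 1]; simp)

section \<open>The class sum as an operator on functions\<close>

text \<open>\<open>C\<close> is a conjugacy class whose elements are their own inverses; this makes
  the class sum self-adjoint.\<close>

locale involution_class =
  fixes G C :: "'g::group_add set"
  assumes finite_G: "finite G" and subgroup_G: "add_subgroup G" and C_sub: "C \<subseteq> G" and C_ne: "C \<noteq> {}"
    and C_conj: "g \<in> G \<Longrightarrow> c \<in> C \<Longrightarrow> g + c - g \<in> C"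
    and C_trans: "c \<in> C \<Longrightarrow> d \<in> C \<Longrightarrow> \<exists>g\<in>G. d = g + c - g"
    and C_invol: "c \<in> C \<Longrightarrow> c + c = 0"
begin

text \<open>Multiplication by the class sum of \<open>C\<close> in the algebra of functions on
  \<open>G\<close> with product \<open>conv\<close>.\<close>

definition T :: "('g \<Rightarrow> complex) \<Rightarrow> 'g \<Rightarrow> complex" where
  "T f x = (\<Sum>c\<in>C. f (c + x))"

definition class_fun :: "('g \<Rightarrow> complex) \<Rightarrow> bool" where
  "class_fun f \<longleftrightarrow> (\<forall>g\<in>G. \<forall>x\<in>G. f (g + x - g) = f x)"

definition conv :: "('g \<Rightarrow> complex) \<Rightarrow> ('g \<Rightarrow> complex) \<Rightarrow> 'g \<Rightarrow> complex" where
  "conv f g x = (\<Sum>h\<in>G. f h * g (- h + x))"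

definition inner :: "('g \<Rightarrow> complex) \<Rightarrow> ('g \<Rightarrow> complex) \<Rightarrow> complex" where
  "inner f g = (\<Sum>x\<in>G. f x * cnj (g x))"

lemmas G_closed [simp, intro] = add_subgroupD[OF subgroup_G]

lemma finite_C: "finite C" using finite_G C_sub finite_subset by blast

lemma C_in_G [simp, intro]: "c \<in> C \<Longrightarrow> c \<in> G" using C_sub by blast

lemma C_minus: "c \<in> C \<Longrightarrow> - c = c" using C_invol minus_unique by blast

lemma C_cancel: "c \<in> C \<Longrightarrow> c + (c + x) = x" using C_invol by (metis add.assoc add_0)

lemma class_funD: "class_fun f \<Longrightarrow> g \<in> G \<Longrightarrow> x \<in> G \<Longrightarrow> f (g + x - g) = f x"
  by (simp add: class_fun_def)

lemma class_fun_comm: "class_fun f \<Longrightarrow> a \<in> G \<Longrightarrow> b \<in> G \<Longrightarrow> f (a + b) = f (b + a)"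
  using class_funD[of f a "b + a"] by (simp add: group_add_norm del: add_uminus_conv_diff)

lemma class_fun_invol: "class_fun f \<Longrightarrow> z \<in> C \<Longrightarrow> x \<in> G \<Longrightarrow> f (z + (x + z)) = f x"
  using class_funD[of f z x] C_minus[of z] by (metis C_in_G add.assoc diff_conv_add_uminus)

lemma sum_G_left: "a \<in> G \<Longrightarrow> (\<Sum>h\<in>G. F (a + h)) = (\<Sum>h\<in>G. F h)"
  by (rule sum.reindex_bij_witness[of _ "\<lambda>h. - a + h" "\<lambda>h. a + h"]) auto

lemma sum_C_conj: "g \<in> G \<Longrightarrow> (\<Sum>c\<in>C. F (g + c - g)) = (\<Sum>c\<in>C. F c)"
  using C_conj[of g] C_conj[of "- g"]
  by (intro sum.reindex_bij_witness[of _ "\<lambda>c. - g + c + g" "\<lambda>c. g + c - g"])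
    (auto simp: group_add_norm simp del: add_uminus_conv_diff)

lemma T_class_fun: "class_fun f \<Longrightarrow> class_fun (T f)"
  unfolding class_fun_def[of "T f"]
proof (intro ballI)
  fix g x assume f: "class_fun f" and gx: "g \<in> G" "x \<in> G"
  have "T f (g + x - g) = (\<Sum>c\<in>C. f ((g + c - g) + (g + x - g)))"
    unfolding T_def by (rule sum_C_conj[OF gx(1), symmetric])
  also have "\<dots> = (\<Sum>c\<in>C. f (g + (c + x) - g))"
    by (simp add: group_add_norm del: add_uminus_conv_diff)
  also have "\<dots> = T f x" unfolding T_def using gx by (intro sum.cong) (auto intro!: class_funD[OF f])
  finally show "T f (g + x - g) = T f x" .
qed

lemma T_funpow_lin: "(T ^^ i) (\<lambda>x. f x - r * g x) = (\<lambda>x. (T ^^ i) f x - r * (T ^^ i) g x)"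
  by (induction i) (auto simp: T_def sum_subtractf sum_distrib_left)

text \<open>Translation by \<open>c\<close> is its own adjoint, as \<open>c\<close> is its own
  inverse.\<close>

lemma inner_T: "inner (T f) g = inner f (T g)"
proof -
  have "inner (T f) g = (\<Sum>c\<in>C. \<Sum>x\<in>G. f (c + x) * cnj (g x))"
    unfolding inner_def T_def by (simp add: sum_distrib_right sum.swap[of _ G C])
  also have "\<dots> = (\<Sum>c\<in>C. \<Sum>x\<in>G. f x * cnj (g (c + x)))"
  proof (rule sum.cong[OF refl])
    fix c assume c: "c \<in> C"
    then show "(\<Sum>x\<in>G. f (c + x) * cnj (g x)) = (\<Sum>x\<in>G. f x * cnj (g (c + x)))"
      using sum_G_left[of c "\<lambda>x. f x * cnj (g (c + x))"] c by (simp add: C_cancel)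
  qed
  also have "\<dots> = inner f (T g)"
    unfolding inner_def T_def by (simp add: sum_distrib_left sum.swap[of _ G C])
  finally show ?thesis .
qed

lemma inner_self_zero: "inner g g = 0 \<Longrightarrow> x \<in> G \<Longrightarrow> g x = 0"
proof -
  assume 0: "inner g g = 0" and x: "x \<in> G"
  have "inner g g = of_real (\<Sum>x\<in>G. (norm (g x))\<^sup>2)"
    unfolding inner_def by (simp flip: complex_norm_square)
  then have "(\<Sum>x\<in>G. (norm (g x))\<^sup>2) = 0" using 0 by (metis of_real_eq_0_iff)
  then show "g x = 0" using finite_G x by (simp add: sum_nonneg_eq_0_iff)
qed

text \<open>Self-adjoint operators have no proper generalised eigenvectors.\<close>

lemma generalised_eigenvector_zero:
  assumes "\<And>x. x \<in> G \<Longrightarrow> T f x - r * f x = g x" "\<And>x. x \<in> G \<Longrightarrow> T g x = r * g x" "x \<in> G"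
  shows "g x = 0"
proof (rule inner_self_zero[OF _ assms(3)], rule ccontr)
  assume g: "inner g g \<noteq> 0"
  have Tg: "inner (T g) h = r * inner g h" "inner h (T g) = cnj r * inner h g" for h
    unfolding inner_def by (simp_all add: assms(2) sum_distrib_left mult_ac)
  have "r * inner g g = cnj r * inner g g" using Tg(1)[of g] Tg(2)[of g] inner_T[of g g] by metis
  then have r: "cnj r = r" using g by simp
  have "inner g g = inner (T f) g - r * inner f g"
    unfolding inner_def by (simp add: assms(1)[symmetric] sum_distrib_left sum_subtractf sum.distrib algebra_simps)
  also have "\<dots> = 0" using inner_T[of f g] Tg(2)[of f] r by simp
  finally show False using g by simp
qed

text \<open>Induction on the degree of an annihilating polynomial \<open>p\<close>. For a root
  \<open>r\<close>, decompose \<open>f' = T f - r f\<close> and divide each component with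
  eigenvalue \<open>l \<noteq> r\<close> by \<open>l - r\<close>; what remains of \<open>f\<close>
  is an eigenvector for \<open>r\<close>.\<close>

lemma eigen_decomposition:
  assumes "p \<noteq> 0" "class_fun f" "\<And>x. x \<in> G \<Longrightarrow> lincomb (\<lambda>i. (T ^^ i) f x) p = 0"
  shows "\<exists>\<Lambda> e. finite \<Lambda> \<and> (\<forall>x\<in>G. f x = (\<Sum>l\<in>\<Lambda>. e l x)) \<and>
    (\<forall>l\<in>\<Lambda>. class_fun (e l) \<and> (\<forall>x\<in>G. T (e l) x = l * e l x))"
  using assms
proof (induction "degree p" arbitrary: p f)
  case 0
  then have "coeff p 0 \<noteq> 0" using leading_coeff_0_iff[of p] by simp
  moreover have "coeff p 0 * f x = 0" if "x \<in> G" for x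
    using 0(4)[OF that] 0(1) by (simp add: lincomb_def)
  ultimately show ?case by (intro exI[of _ "{}"]) auto
next
  case (Suc n)
  have "\<not> constant (poly p)" using Suc.hyps(2) by (simp add: constant_degree)
  then obtain r where "poly p r = 0" using fundamental_theorem_of_algebra by blast
  then obtain q where q: "p = [:- r, 1:] * q" by (auto simp: poly_eq_0_iff_dvd elim: dvdE)
  have q0: "q \<noteq> 0" using Suc.prems(1) q by auto
  have "degree p = Suc (degree q)" unfolding q by (subst degree_mult_eq) (use q0 in auto)
  then have dq: "n = degree q" using Suc.hyps(2) by simp
  define f' where "f' = (\<lambda>x. T f x - r * f x)"
  have cf': "class_fun f'" using T_class_fun[OF Suc.prems(2)] Suc.prems(2) by (simp add: class_fun_def f'_def)
  have "lincomb (\<lambda>i. (T ^^ i) f' x) q = 0" if "x \<in> G" for x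
  proof -
    have "(T ^^ i) f' x = (T ^^ Suc i) f x - r * (T ^^ i) f x" for i
      using T_funpow_lin[of i "T f" r f] by (simp add: f'_def funpow_swap1)
    then show ?thesis using Suc.prems(3)[OF that] unfolding q by (simp only: lincomb_linear_factor)
  qed
  from Suc.hyps(1)[OF dq q0 cf' this] obtain \<Lambda> e where L: "finite \<Lambda>"
    and sum: "\<And>x. x \<in> G \<Longrightarrow> f' x = (\<Sum>l\<in>\<Lambda>. e l x)"
    and cf: "\<And>l. l \<in> \<Lambda> \<Longrightarrow> class_fun (e l)"
    and eig: "\<And>l x. l \<in> \<Lambda> \<Longrightarrow> x \<in> G \<Longrightarrow> T (e l) x = l * e l x" by blast
  define f'' where "f'' x = f x - (\<Sum>l\<in>\<Lambda> - {r}. e l x / (l - r))" for x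
  \<comment> \<open>\<open>g\<close> is the component of \<open>f'\<close> at \<open>r\<close>, or 0
    if there is none. It equals \<open>T f'' - r f''\<close> and satisfies \<open>T g = r g\<close>,
    so it vanishes by self-adjointness.\<close>
  define g where "g x = (if r \<in> \<Lambda> then e r x else 0)" for x
  have cf'': "class_fun f''"
    unfolding class_fun_def f''_def using Suc.prems(2) cf by (auto simp: class_fun_def intro!: sum.cong)
  have f''g: "T f'' x - r * f'' x = g x" if x: "x \<in> G" for x
  proof -
    have "T f'' x = T f x - (\<Sum>l\<in>\<Lambda> - {r}. T (e l) x / (l - r))"
      unfolding T_def f''_def by (simp add: sum_subtractf sum_divide_distrib sum.swap[of _ C])
    also have "(\<Sum>l\<in>\<Lambda> - {r}. T (e l) x / (l - r)) = (\<Sum>l\<in>\<Lambda> - {r}. l * e l x / (l - r))"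
      using eig x by (intro sum.cong) auto
    finally have "T f'' x - r * f'' x = f' x - (\<Sum>l\<in>\<Lambda> - {r}. (l - r) * e l x / (l - r))"
      unfolding f'_def f''_def by (simp add: algebra_simps sum_subtractf sum_distrib_left diff_divide_distrib)
    also have "(\<Sum>l\<in>\<Lambda> - {r}. (l - r) * e l x / (l - r)) = (\<Sum>l\<in>\<Lambda> - {r}. e l x)"
      by (intro sum.cong) auto
    also have "f' x = g x + (\<Sum>l\<in>\<Lambda> - {r}. e l x)"
      unfolding sum[OF x] g_def using L by (auto simp: sum.remove)
    finally show ?thesis by simp
  qed
  have "T g x = r * g x" if "x \<in> G" for x
    using eig[of r x] that by (auto simp: g_def T_def)
  then have g0: "g x = 0" if "x \<in> G" for x
    using generalised_eigenvector_zero[of f'' r g x] f''g that by blast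
  define E where "E l x = (if l = r then f'' x else e l x / (l - r))" for l x
  have "f x = (\<Sum>l\<in>insert r (\<Lambda> - {r}). E l x)" for x
  proof -
    have "(\<Sum>l\<in>\<Lambda> - {r}. E l x) = (\<Sum>l\<in>\<Lambda> - {r}. e l x / (l - r))"
      by (intro sum.cong) (auto simp: E_def)
    moreover have "(\<Sum>l\<in>insert r (\<Lambda> - {r}). E l x) = f'' x + (\<Sum>l\<in>\<Lambda> - {r}. E l x)"
      using L by (subst sum.insert) (simp_all add: E_def)
    ultimately show ?thesis by (simp only: f''_def) simp
  qed
  moreover have "class_fun (E l) \<and> (\<forall>x\<in>G. T (E l) x = l * E l x)" if "l \<in> insert r (\<Lambda> - {r})" for l
  proof (cases "l = r")
    case True
    then show ?thesis using cf'' f''g g0 by (simp add: E_def class_fun_def T_def)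
  next
    case False
    then have "l \<in> \<Lambda>" using that by simp
    then have "T (E l) x = l * E l x" if "x \<in> G" for x
      using eig[OF _ that] False by (simp add: E_def T_def flip: sum_divide_distrib)
    then show ?thesis using False cf[OF \<open>l \<in> \<Lambda>\<close>] by (simp add: E_def class_fun_def)
  qed
  ultimately show ?case using L by (intro exI[of _ "insert r (\<Lambda> - {r})"] exI[of _ E]) simp
qed

lemma T_conv_left: 
  assumes "x \<in> G"
  shows "conv (T f) g x = T (conv f g) x"
proof -
  have "conv (T f) g x = (\<Sum>c\<in>C. \<Sum>h\<in>G. f (c + h) * g (- h + x))"
    unfolding conv_def T_def by (simp add: sum_distrib_right sum.swap[of _ G C])
  also have "\<dots> = (\<Sum>c\<in>C. \<Sum>h\<in>G. f h * g (- h + (c + x)))"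
  proof (rule sum.cong[OF refl])
    fix c assume "c \<in> C"
    then show "(\<Sum>h\<in>G. f (c + h) * g (- h + x)) = (\<Sum>h\<in>G. f h * g (- h + (c + x)))"
      using sum_G_left[of c "\<lambda>h. f h * g (- h + (c + x))"]
      by (simp add: group_add_norm del: add_uminus_conv_diff)
  qed
  finally show ?thesis by (simp add: conv_def T_def)
qed

text \<open>The class sum is central: conjugation by \<open>- h\<close> permutes
  \<open>C\<close>.\<close>

lemma T_conv_right: 
  assumes "x \<in> G"
  shows "conv f (T g) x = T (conv f g) x"
proof -
  have "conv f (T g) x = (\<Sum>h\<in>G. \<Sum>c\<in>C. f h * g (c + (- h + x)))"
    unfolding conv_def T_def by (simp add: sum_distrib_left)
  also have "\<dots> = (\<Sum>h\<in>G. \<Sum>c\<in>C. f h * g (- h + (c + x)))"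
  proof (rule sum.cong[OF refl])
    fix h assume "h \<in> G"
    then show "(\<Sum>c\<in>C. f h * g (c + (- h + x))) = (\<Sum>c\<in>C. f h * g (- h + (c + x)))"
      using sum_C_conj[of "- h" "\<lambda>c. f h * g (c + (- h + x))"]
      by (simp add: group_add_norm del: add_uminus_conv_diff)
  qed
  also have "\<dots> = T (conv f g) x" unfolding conv_def T_def by (rule sum.swap)
  finally show ?thesis .
qed

section \<open>Dimensions and traces on eigenspaces\<close>

text \<open>\<open>f (x - y)\<close> is the matrix of left multiplication by \<open>f\<close>; its
  diagonal is constant with value \<open>f 0\<close>.\<close>

lemma conv_idempotent_trace:
  assumes "\<And>x. x \<in> G \<Longrightarrow> conv f f x = f x"
  shows "\<exists>r::nat. of_nat (card G) * f 0 = of_nat r \<and> (r = 0 \<longrightarrow> (\<forall>x\<in>G. f x = 0))"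
proof -
  have "(\<Sum>y\<in>G. f (x - y) * f (y - w)) = f (x - w)" if "x \<in> G" "w \<in> G" for x w
  proof -
    have "(\<Sum>y\<in>G. f (x - y) * f (y - w)) = (\<Sum>h\<in>G. f h * f (- h + (x - w)))"
      using that by (intro sum.reindex_bij_witness[of _ "\<lambda>h. - h + x" "\<lambda>y. x - y"])
        (auto simp: group_add_norm simp del: add_uminus_conv_diff)
    then show ?thesis using assms[of "x - w"] that by (simp add: conv_def)
  qed
  from idempotent_kernel_trace[OF finite_G, of "\<lambda>x y. f (x - y)", OF this]
  obtain r :: nat where r: "of_nat (card G) * f 0 = of_nat r"
    "r = 0 \<Longrightarrow> \<forall>x\<in>G. \<forall>y\<in>G. f (x - y) = 0" by auto
  have "\<forall>x\<in>G. f x = 0" if "r = 0" using r(2)[OF that] by (metis G_closed(1) diff_0_right)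
  then show ?thesis using r(1) by blast
qed

lemma conv_translate_left:
  assumes "z \<in> C" "x \<in> G"
  shows "conv (\<lambda>y. f (z + y)) g x = conv f g (z + x)"
  using sum_G_left[of z "\<lambda>h. f h * g (- h + (z + x))"] assms C_minus[of z]
  by (simp add: conv_def group_add_norm C_cancel del: add_uminus_conv_diff)

lemma conv_translate_right:
  assumes "class_fun g" "z \<in> C" "x \<in> G"
  shows "conv f (\<lambda>y. g (z + y)) x = conv f g (x + z)"
proof -
  have "g (z + (- h + x)) = g (- h + (x + z))" if "h \<in> G" for h
    using class_fun_comm[OF assms(1), of z "- h + x"] assms that by (simp add: add.assoc)
  then show ?thesis unfolding conv_def by (intro sum.cong) auto
qed

text \<open>As \<open>s\<close> is 1 or -1, \<open>?k\<close> is the idempotent of the part of the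
  component of \<open>e\<close> on which translation by \<open>z\<close> acts as \<open>s\<close>,
  and \<open>r\<close> is the dimension of that part.\<close>

lemma eigen_idempotent_twist:
  assumes e: "class_fun e" and idem: "\<And>x. x \<in> G \<Longrightarrow> conv e e x = e x"
    and z: "z \<in> C" and s: "s * s = 1"
  shows "\<exists>r::nat. of_nat (card G) * (e 0 + s * e z) = 2 * of_nat r \<and> (r = 0 \<longrightarrow> (\<forall>x\<in>G. e x + s * e (z + x) = 0))"
proof -
  let ?k = "\<lambda>x. (e x + s * e (z + x)) / 2"
  have "conv ?k ?k x = ?k x" if x: "x \<in> G" for x
  proof -
    have "conv ?k ?k x = (conv e e x + s * conv e (\<lambda>y. e (z + y)) x + s * conv (\<lambda>y. e (z + y)) e x
        + s * s * conv (\<lambda>y. e (z + y)) (\<lambda>y. e (z + y)) x) / 4"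
      unfolding conv_def sum_distrib_left sum_divide_distrib sum.distrib[symmetric]
      by (intro sum.cong refl) (simp add: field_simps)
    also have "conv e (\<lambda>y. e (z + y)) x = e (z + x)"
      using x z idem[of "x + z"] class_fun_comm[OF e, of x z] by (simp add: conv_translate_right[OF e])
    also have "conv (\<lambda>y. e (z + y)) e x = e (z + x)"
      using x z idem[of "z + x"] by (simp add: conv_translate_left)
    also have "conv (\<lambda>y. e (z + y)) (\<lambda>y. e (z + y)) x = e x"
      using x z idem[of "z + x + z"] class_fun_invol[OF e, of z x]
      by (simp add: conv_translate_left conv_translate_right[OF e] add.assoc)
    also have "(conv e e x + s * e (z + x) + s * e (z + x) + s * s * e x) / 4 = ?k x"
      using idem[OF x] s by simp
    finally show ?thesis .
  qed
  from conv_idempotent_trace[of ?k, OF this] show ?thesis by (auto simp: field_simps)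
qed

text \<open>\<open>?Q\<close> is the matrix of the projection onto the functions in the component of
  \<open>e\<close> that are invariant under \<open>x \<mapsto> z + x + z\<close>; the left-hand side
  is twice its trace.\<close>

lemma eigen_idempotent_two_sided:
  assumes e: "class_fun e" and idem: "\<And>x. x \<in> G \<Longrightarrow> conv e e x = e x" and z: "z \<in> C"
  shows "\<exists>r::nat. of_nat (card G) * e 0 + (\<Sum>x\<in>G. e (z + (x + z - x))) = 2 * of_nat r"
proof -
  let ?Q = "\<lambda>x y. (e (x - y) + e (z + x + z - y)) / 2"
  have basic: "(\<Sum>y\<in>G. e (x - y) * e (y - w)) = e (x - w)" if "x \<in> G" "w \<in> G" for x w
  proof -
    have "(\<Sum>y\<in>G. e (x - y) * e (y - w)) = (\<Sum>h\<in>G. e h * e (- h + (x - w)))"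
      using that by (intro sum.reindex_bij_witness[of _ "\<lambda>h. - h + x" "\<lambda>y. x - y"])
        (auto simp: group_add_norm simp del: add_uminus_conv_diff)
    then show ?thesis using idem[of "x - w"] that by (simp add: conv_def)
  qed
  have zc: "z + (z + x) = x" "x + z + z = x" for x
    using C_cancel[OF z] C_invol[OF z] by (simp_all add: add.assoc)
  \<comment> \<open>Substituting \<open>z + y + z\<close> for \<open>y\<close> matches the four
    products below in pairs.\<close>
  have flip: "(\<Sum>y\<in>G. F y) = (\<Sum>y\<in>G. F (z + y + z))" for F :: "'g \<Rightarrow> complex"
    using z zc by (intro sum.reindex_bij_witness[of _ "\<lambda>y. z + y + z" "\<lambda>y. z + y + z"]) (auto simp: add.assoc)
  have conj: "e (x - (z + y + z)) = e (z + x + z - y)" if "x \<in> G" "y \<in> G" for x y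
    using class_funD[OF e, of z "x - (z + y + z)"] that z C_minus[OF z] zc
    by (simp add: group_add_norm del: add_uminus_conv_diff)
  have "(\<Sum>y\<in>G. ?Q x y * ?Q y w) = ?Q x w" if x: "x \<in> G" and w: "w \<in> G" for x w
  proof -
    have "(\<Sum>y\<in>G. ?Q x y * ?Q y w) = ((\<Sum>y\<in>G. e (x - y) * e (y - w)) + (\<Sum>y\<in>G. e (x - y) * e (z + y + z - w))
       + (\<Sum>y\<in>G. e (z + x + z - y) * e (y - w)) + (\<Sum>y\<in>G. e (z + x + z - y) * e (z + y + z - w))) / 4"
      unfolding sum_divide_distrib sum.distrib[symmetric]
      by (intro sum.cong refl) (simp add: field_simps)
    also have "(\<Sum>y\<in>G. e (x - y) * e (z + y + z - w)) = (\<Sum>y\<in>G. e (z + x + z - y) * e (y - w))"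
      unfolding flip[of "\<lambda>y. e (x - y) * e (z + y + z - w)"] using conj[OF x] z zc
      by (intro sum.cong) (auto simp: add.assoc)
    also have "(\<Sum>y\<in>G. e (z + x + z - y) * e (z + y + z - w)) = (\<Sum>y\<in>G. e (x - y) * e (y - w))"
      unfolding flip[of "\<lambda>y. e (z + x + z - y) * e (z + y + z - w)"] using conj[of "z + x + z"] x z zc
      by (intro sum.cong) (auto simp: add.assoc)
    also have "((\<Sum>y\<in>G. e (x - y) * e (y - w)) + (\<Sum>y\<in>G. e (z + x + z - y) * e (y - w))
       + (\<Sum>y\<in>G. e (z + x + z - y) * e (y - w)) + (\<Sum>y\<in>G. e (x - y) * e (y - w))) / 4 = ?Q x w"
      using basic[OF x w] basic[of "z + x + z" w] x w z by simp
    finally show ?thesis .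
  qed
  from idempotent_kernel_trace[OF finite_G, of ?Q, OF this]
  obtain r :: nat where "(\<Sum>x\<in>G. (e 0 + e (z + x + z - x)) / 2) = of_nat r" by auto
  then have "of_nat (card G) * e 0 + (\<Sum>x\<in>G. e (z + x + z - x)) = 2 * of_nat r"
    by (simp add: sum.distrib flip: sum_divide_distrib)
  then show ?thesis by (intro exI[of _ r]) (simp add: group_add_norm del: add_uminus_conv_diff)
qed

text \<open>\<open>rp\<close> and \<open>rm\<close> are the dimensions of the parts of the component
  where \<open>z\<close> acts as 1 and as -1; \<open>d\<close> and \<open>t\<close> are the traces
  of the identity and of \<open>z\<close>. With \<open>u\<close> the trace of
  \<open>f \<mapsto> z f z\<close>, the equations \<open>|C| u = l t\<close> and
  \<open>|C| t = l d\<close> give \<open>u d = t t\<close>.\<close>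

lemma eigen_idempotent_numbers:
  assumes e: "class_fun e" and idem: "\<And>x. x \<in> G \<Longrightarrow> conv e e x = e x"
    and eig: "\<And>x. x \<in> G \<Longrightarrow> T e x = l * e x" and ne: "\<exists>x\<in>G. e x \<noteq> 0" and z: "z \<in> C"
  shows "\<exists>(d::nat) (t::int). d > 0 \<and> of_nat (card G) * e 0 = of_nat d \<and> of_nat (card G) * e z = of_int t \<and>
     \<bar>t\<bar> \<le> int d \<and> int d dvd t * t \<and> of_nat (card C) * of_int t = l * of_nat d \<and>
     (t = int d \<longrightarrow> (\<forall>x\<in>G. e (z + x) = e x)) \<and> (t = - int d \<longrightarrow> (\<forall>x\<in>G. e (z + x) = - e x))"
proof -
  let ?n = "of_nat (card G) :: complex" and ?c = "of_nat (card C) :: complex"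
  obtain rp :: nat where rp: "?n * (e 0 + 1 * e z) = 2 * of_nat rp" "rp = 0 \<longrightarrow> (\<forall>x\<in>G. e x + 1 * e (z + x) = 0)"
    using eigen_idempotent_twist[OF e idem z, of 1] by auto
  obtain rm :: nat where rm: "?n * (e 0 + - 1 * e z) = 2 * of_nat rm" "rm = 0 \<longrightarrow> (\<forall>x\<in>G. e x + - 1 * e (z + x) = 0)"
    using eigen_idempotent_twist[OF e idem z, of "- 1"] by auto
  define d where "d = rp + rm"
  define t where "t = int rp - int rm"
  have "2 * (?n * e 0) = 2 * (of_nat rp + of_nat rm)" using rp(1) rm(1) by (simp add: algebra_simps)
  then have d: "?n * e 0 = of_nat d" unfolding d_def of_nat_add by (subst (asm) mult_left_cancel) simp_all
  have "2 * (?n * e z) = 2 * (of_nat rp - of_nat rm)" using rp(1) rm(1) by (simp add: algebra_simps)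
  then have t: "?n * e z = of_int t"
    unfolding t_def of_int_diff of_int_of_nat_eq by (subst (asm) mult_left_cancel) simp_all
  obtain r :: nat where r: "?n * e 0 = of_nat r" "r = 0 \<longrightarrow> (\<forall>x\<in>G. e x = 0)"
    using conv_idempotent_trace[of e, OF idem] by blast
  then have dpos: "d > 0" using d ne by (metis gr0I of_nat_eq_iff)
  have ec: "e c = e z" if "c \<in> C" for c
    using C_trans[OF z that] class_funD[OF e _ C_in_G[OF z]] by blast
  have "T e 0 = ?c * e z" unfolding T_def using ec by simp
  then have ct: "?c * of_int t = l * of_nat d"
    using eig[of 0] d t by (simp add: algebra_simps) (metis mult.assoc mult.commute)
  obtain s :: nat where s: "?n * e 0 + (\<Sum>x\<in>G. e (z + (x + z - x))) = 2 * of_nat s"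
    using eigen_idempotent_two_sided[OF e idem z] by blast
  define u where "u = 2 * int s - int d"
  have u: "(\<Sum>x\<in>G. e (z + (x + z - x))) = of_int u" using s d by (simp add: u_def algebra_simps)
  have "?c * of_int u = (\<Sum>c\<in>C. \<Sum>x\<in>G. e (z + (x + c - x)))"
  proof -
    have "(\<Sum>x\<in>G. e (z + (x + c - x))) = of_int u" if c: "c \<in> C" for c
    proof -
      obtain g where g: "g \<in> G" "c = g + z - g" using C_trans[OF z c] by blast
      have "(\<Sum>x\<in>G. e (z + (x + c - x))) = (\<Sum>x\<in>G. e (z + (x + z - x)))"
        using g by (intro sum.reindex_bij_witness[of _ "\<lambda>x. x - g" "\<lambda>x. x + g"])
          (auto simp: group_add_norm simp del: add_uminus_conv_diff)
      then show ?thesis using u by simp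
    qed
    then show ?thesis by simp
  qed
  also have "\<dots> = (\<Sum>x\<in>G. \<Sum>c\<in>C. e (z + (x + c - x)))" by (rule sum.swap)
  \<comment> \<open>For fixed \<open>x\<close>, conjugation by \<open>x\<close> only permutes
    \<open>C\<close>, so the sum over \<open>x\<close> contributes the factor
    \<open>card G\<close>.\<close>
  also have "\<dots> = (\<Sum>x\<in>G. \<Sum>c\<in>C. e (z + c))"
    by (rule sum.cong[OF refl], rule sum_C_conj[of _ "\<lambda>c. e (z + c)"])
  also have "\<dots> = ?n * T e z"
    unfolding T_def using class_fun_comm[OF e, of z] z by simp
  also have "\<dots> = l * of_int t" using eig[of z] z t by (simp add: algebra_simps)
  finally have "?c * of_int u * of_nat d = ?c * of_int t * of_int t"
    using ct by (simp add: algebra_simps)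
  moreover have "?c \<noteq> 0" using C_ne finite_C by simp
  ultimately have "(of_int (u * int d) :: complex) = of_int (t * t)" by simp
  then have "u * int d = t * t" by (simp only: of_int_eq_iff)
  then have "int d dvd t * t" by (metis dvd_triv_right)
  moreover have "\<forall>x\<in>G. e (z + x) = e x" if "t = int d"
    using that rm(2) by (simp add: t_def d_def)
  moreover have "\<forall>x\<in>G. e (z + x) = - e x" if "t = - int d"
    using that rp(2) by (simp add: t_def d_def add_eq_0_iff)
  moreover have "\<bar>t\<bar> \<le> int d" by (simp add: t_def d_def)
  ultimately show ?thesis using dpos d t ct by blast
qed

section \<open>Spectral idempotents and integral eigenvalues\<close>

definition delta :: "'g \<Rightarrow> complex" where "delta x = (if x = 0 then 1 else 0)"

lemma conv_delta: "x \<in> G \<Longrightarrow> conv f delta x = f x"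
proof -
  assume x: "x \<in> G"
  have "conv f delta x = (\<Sum>h\<in>G. if h = x then f h else 0)"
    unfolding conv_def delta_def by (intro sum.cong) (auto simp: neg_eq_iff_add_eq_0[symmetric])
  then show ?thesis using x finite_G by simp
qed

text \<open>Decompose the unit \<open>delta\<close> of the convolution algebra. Components for
  different eigenvalues multiply to 0 because \<open>T\<close> can be moved across a product, so the
  product of \<open>e l\<close> with \<open>delta\<close> collapses to the square of
  \<open>e l\<close>.\<close>

lemma spectral_idempotents:
  obtains \<Lambda> e where "finite \<Lambda>" "\<And>x. x \<in> G \<Longrightarrow> delta x = (\<Sum>l\<in>\<Lambda>. e l x)"
    "\<And>l. l \<in> \<Lambda> \<Longrightarrow> class_fun (e l)" "\<And>l x. l \<in> \<Lambda> \<Longrightarrow> x \<in> G \<Longrightarrow> T (e l) x = l * e l x"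
    "\<And>l. l \<in> \<Lambda> \<Longrightarrow> \<exists>x\<in>G. e l x \<noteq> 0" "\<And>l x. l \<in> \<Lambda> \<Longrightarrow> x \<in> G \<Longrightarrow> conv (e l) (e l) x = e l x"
proof -
  obtain p where p: "p \<noteq> 0" "\<forall>x\<in>G. lincomb (\<lambda>i. (T ^^ i) delta x) p = 0"
    using lincomb_relation_exists[OF finite_G, of 0 "\<lambda>i. (T ^^ i) delta"] by blast
  have "class_fun delta"
    unfolding class_fun_def delta_def by (metis add_0_right add_left_cancel right_minus_eq)
  from eigen_decomposition[OF p(1) this] p(2) obtain \<Lambda>' e where L': "finite \<Lambda>'"
    and sum': "\<And>x. x \<in> G \<Longrightarrow> delta x = (\<Sum>l\<in>\<Lambda>'. e l x)"
    and cf': "\<And>l. l \<in> \<Lambda>' \<Longrightarrow> class_fun (e l)"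
    and eig': "\<And>l x. l \<in> \<Lambda>' \<Longrightarrow> x \<in> G \<Longrightarrow> T (e l) x = l * e l x" by blast
  \<comment> \<open>Components that vanish on \<open>G\<close> are dropped, so that every remaining
    \<open>l\<close> is an eigenvalue.\<close>
  define \<Lambda> where "\<Lambda> = {l \<in> \<Lambda>'. \<exists>x\<in>G. e l x \<noteq> 0}"
  have L: "finite \<Lambda>" "\<Lambda> \<subseteq> \<Lambda>'" using L' by (auto simp: \<Lambda>_def)
  have sum: "delta x = (\<Sum>l\<in>\<Lambda>. e l x)" if "x \<in> G" for x
    unfolding sum'[OF that] by (rule sum.mono_neutral_right) (use L' that in \<open>auto simp: \<Lambda>_def\<close>)
  have orth: "conv (e l) (e m) x = 0" if "l \<in> \<Lambda>" "m \<in> \<Lambda>" "l \<noteq> m" "x \<in> G" for l m x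
  proof -
    have "l * conv (e l) (e m) x = conv (T (e l)) (e m) x"
      unfolding conv_def using that L eig'[of l] by (auto simp: sum_distrib_left mult.assoc intro!: sum.cong)
    also have "\<dots> = conv (e l) (T (e m)) x"
      using that by (simp add: T_conv_left T_conv_right)
    also have "\<dots> = m * conv (e l) (e m) x"
      unfolding conv_def using that L eig'[of m] by (auto simp: sum_distrib_left mult_ac intro!: sum.cong)
    finally show ?thesis using that(3) by simp
  qed
  have idem: "conv (e l) (e l) x = e l x" if "l \<in> \<Lambda>" "x \<in> G" for l x
  proof -
    have "e l x = conv (e l) delta x" using conv_delta[OF that(2)] by simp
    also have "\<dots> = (\<Sum>m\<in>\<Lambda>. conv (e l) (e m) x)"
      unfolding conv_def using that by (subst sum.swap) (auto simp: sum sum_distrib_left intro!: sum.cong)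
    also have "\<dots> = (\<Sum>m\<in>\<Lambda>. if m = l then conv (e l) (e l) x else 0)"
      using orth that by (intro sum.cong) auto
    finally show ?thesis using that L by simp
  qed
  show thesis
    by (rule that[of \<Lambda> e]) (use L sum cf' eig' idem in \<open>auto simp: \<Lambda>_def\<close>)
qed

text \<open>Lagrange interpolation in \<open>T\<close>: the product of all \<open>T - m\<close> with
  \<open>m \<noteq> k\<close> maps \<open>f\<close> to a nonzero rational multiple of
  \<open>e k\<close> and preserves rationality of the values.\<close>

lemma eigen_component_rational:
  assumes "finite \<Lambda>" "\<Lambda> \<subseteq> \<rat>" "\<And>x. x \<in> G \<Longrightarrow> f x = (\<Sum>l\<in>\<Lambda>. e l x)" "\<And>x. x \<in> G \<Longrightarrow> f x \<in> \<rat>"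
    and eig: "\<And>l x. l \<in> \<Lambda> \<Longrightarrow> x \<in> G \<Longrightarrow> T (e l) x = l * e l x" and "k \<in> \<Lambda>" "x \<in> G"
  shows "e k x \<in> \<rat>"
proof -
  have "(\<Sum>l\<in>\<Lambda>. (\<Prod>m\<in>M. l - m) * e l x) \<in> \<rat>" if "finite M" "M \<subseteq> \<rat>" "x \<in> G" for M x
    using that
  proof (induction M arbitrary: x)
    case empty
    then show ?case using assms(3,4)[of x] by simp
  next
    case (insert m M)
    let ?F = "\<lambda>x. \<Sum>l\<in>\<Lambda>. (\<Prod>m\<in>M. l - m) * e l x"
    have "T ?F x = (\<Sum>l\<in>\<Lambda>. (\<Prod>m\<in>M. l - m) * T (e l) x)"
      unfolding T_def by (simp add: sum_distrib_left sum.swap[of _ C])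
    then have "T ?F x - m * ?F x = (\<Sum>l\<in>\<Lambda>. (\<Prod>m\<in>insert m M. l - m) * e l x)"
      using insert eig by (simp add: sum_distrib_left algebra_simps flip: sum_subtractf)
    moreover have "T ?F x \<in> \<rat>"
      unfolding T_def by (intro Rats_sum insert.IH) (use insert in auto)
    moreover have "?F x \<in> \<rat>" by (rule insert.IH) (use insert in auto)
    moreover have "m \<in> \<rat>" using insert by simp
    ultimately show ?case using Rats_diff[of "T ?F x" "m * ?F x"] Rats_mult[of m "?F x"] by simp
  qed
  from this[of "\<Lambda> - {k}" x] have "(\<Sum>l\<in>\<Lambda>. (\<Prod>m\<in>\<Lambda> - {k}. l - m) * e l x) \<in> \<rat>" using assms by auto
  also have "(\<Sum>l\<in>\<Lambda>. (\<Prod>m\<in>\<Lambda> - {k}. l - m) * e l x) = (\<Sum>l\<in>\<Lambda>. if l = k then (\<Prod>m\<in>\<Lambda> - {k}. k - m) * e k x else 0)"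
    using assms(1) by (intro sum.cong) (auto simp: prod_zero_iff)
  also have "\<dots> = (\<Prod>m\<in>\<Lambda> - {k}. k - m) * e k x" using assms(1,6) by simp
  finally have "(\<Prod>m\<in>\<Lambda> - {k}. k - m) * e k x / (\<Prod>m\<in>\<Lambda> - {k}. k - m) \<in> \<rat>"
    using assms(2,6) by (intro Rats_divide Rats_prod Rats_diff) auto
  moreover have "(\<Prod>m\<in>\<Lambda> - {k}. k - m) \<noteq> 0" using assms(1) by (auto simp: prod_zero_iff)
  ultimately show ?thesis by simp
qed

text \<open>If \<open>D\<close> is a common denominator of the values of \<open>e\<close>, applying
  \<open>T\<close> repeatedly keeps the values of \<open>D * l ^ k * e\<close> integral, so the
  powers of \<open>l\<close> have bounded denominators.\<close>

lemma rational_eigenvalue_integer: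
  assumes "l \<in> \<rat>" "\<And>x. x \<in> G \<Longrightarrow> e x \<in> \<rat>" "\<And>x. x \<in> G \<Longrightarrow> T e x = l * e x" "\<exists>x\<in>G. e x \<noteq> 0"
  shows "l \<in> \<int>"
proof -
  obtain D :: int where D: "D \<noteq> 0" "\<forall>x\<in>G. of_int D * e x \<in> \<int>"
    using common_denominator[OF finite_G, of e] assms(2) by blast
  have pow: "of_int D * e x * l ^ k \<in> \<int>" if "x \<in> G" for x k
    using that
  proof (induction k arbitrary: x)
    case (Suc k)
    have "of_int D * e x * l ^ Suc k = (\<Sum>c\<in>C. of_int D * e (c + x) * l ^ k)"
      using assms(3)[OF Suc.prems]
      by (simp add: T_def mult_ac sum_distrib_right[symmetric] sum_distrib_left[symmetric])
    also have "\<dots> \<in> \<int>" using Suc by (intro Ints_sum) auto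
    finally show ?case .
  qed (use D in simp)
  obtain x where "x \<in> G" "e x \<noteq> 0" using assms(4) by blast
  then show ?thesis using Ints_if_powers_bounded_denominator[OF assms(1), of "of_int D * e x"] pow D(1) by auto
qed

text \<open>The elements whose translations act trivially on the component generated by
  \<open>e\<close>: the kernel of a representation.\<close>

lemma idempotent_stabiliser_normal:
  assumes "class_fun e"
  shows "normal_in {h \<in> G. \<forall>x\<in>G. e (h + x) = e x} G"
proof -
  let ?K = "{h \<in> G. \<forall>x\<in>G. e (h + x) = e x}"
  have "- h \<in> ?K" if "h \<in> ?K" for h
  proof -
    have h: "h \<in> G" "\<And>x. x \<in> G \<Longrightarrow> e (h + x) = e x" using that by auto
    have "e (- h + x) = e x" if "x \<in> G" for x
      using h(2)[of "- h + x"] h(1) that by simp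
    then show ?thesis using h(1) by simp
  qed
  then have sub: "add_subgroup ?K" by (auto simp: add_subgroup_def add.assoc)
  have "e (g + h - g + x) = e x" if "h \<in> ?K" "g \<in> G" "x \<in> G" for g h x
  proof -
    have "e (g + h - g + x) = e (g + (h + (- g + x + g)) - g)"
      by (simp add: group_add_norm del: add_uminus_conv_diff)
    also have "\<dots> = e (h + (- g + x + g))" using that by (intro class_funD[OF assms]) auto
    also have "\<dots> = e (- g + x - (- g))" using that by simp
    also have "\<dots> = e x" using that by (intro class_funD[OF assms]) auto
    finally show ?thesis .
  qed
  then show ?thesis using sub by (auto simp: normal_in_def)
qed

theorem simple_with_prime_power_involution_class:
  assumes p: "prime p" "card C = p ^ j" and z: "z \<in> C" "z \<noteq> 0"
    and simple: "\<And>N. normal_in N G \<Longrightarrow> N = {0} \<or> N = G"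
  shows "G = {0, z}"
proof (rule ccontr)
  assume not: "G \<noteq> {0, z}"
  let ?n = "of_nat (card G) :: complex" and ?c = "of_nat (card C) :: complex"
  have n0: "?n \<noteq> 0" using card_subgroup_pos[OF finite_G subgroup_G] by simp
  have c0: "?c \<noteq> 0" using C_ne finite_C by simp
  \<comment> \<open>If \<open>z\<close> acts as -1, so do its conjugates \<open>c\<close>. Then
    \<open>c + z\<close> acts trivially, so \<open>c = z\<close> by simplicity; hence
    \<open>z\<close> is central and \<open>{0, z}\<close> is normal.\<close>
  have no_sign: "\<exists>x\<in>G. e (z + x) \<noteq> - e x" if e: "class_fun e" and ne: "\<exists>x\<in>G. e x \<noteq> 0" for e
  proof (rule ccontr)
    assume "\<not> ?thesis"
    then have ez: "e (z + x) = - e x" if "x \<in> G" for x using that by blast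
    let ?K = "{h \<in> G. \<forall>x\<in>G. e (h + x) = e x}"
    have "z \<notin> ?K" using ez ne by auto
    then have K: "?K = {0}" using simple[OF idempotent_stabiliser_normal[OF e]] z by blast
    have ec: "e (c + x) = - e x" if c: "c \<in> C" and x: "x \<in> G" for c x
    proof -
      obtain g where g: "g \<in> G" "c = g + z - g" using C_trans[OF z(1) c] by blast
      have "e (c + x) = e (g + (z + (- g + x + g)) - g)"
        by (simp add: g group_add_norm del: add_uminus_conv_diff)
      also have "\<dots> = e (z + (- g + x + g))" using g z x by (intro class_funD[OF e]) auto
      also have "\<dots> = - e (- g + x - (- g))" using ez g x by simp
      also have "\<dots> = - e x" using g x class_funD[OF e, of "- g" x] by simp
      finally show ?thesis .
    qed
    have "c = z" if "c \<in> C" for c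
    proof -
      have "c + z \<in> ?K" using that z ez ec by (auto simp: add.assoc)
      then have "c + z = 0" using K by blast
      then show ?thesis using C_minus[OF z(1)] by (metis minus_unique add.inverse_inverse eq_neg_iff_add_eq_0)
    qed
    then have comm: "g + z - g = z" if "g \<in> G" for g using C_conj[OF that z(1)] by blast
    have "normal_in {0, z} G"
      using comm z(1) C_invol[OF z(1)] C_minus[OF z(1)] by (auto simp: normal_in_def add_subgroup_def)
    then show False using simple z(2) not by blast
  qed
  obtain \<Lambda> e where L: "finite \<Lambda>" and sum: "\<And>x. x \<in> G \<Longrightarrow> delta x = (\<Sum>l\<in>\<Lambda>. e l x)"
    and cf: "\<And>l. l \<in> \<Lambda> \<Longrightarrow> class_fun (e l)" and eig: "\<And>l x. l \<in> \<Lambda> \<Longrightarrow> x \<in> G \<Longrightarrow> T (e l) x = l * e l x"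
    and ne: "\<And>l. l \<in> \<Lambda> \<Longrightarrow> \<exists>x\<in>G. e l x \<noteq> 0"
    and idem: "\<And>l x. l \<in> \<Lambda> \<Longrightarrow> x \<in> G \<Longrightarrow> conv (e l) (e l) x = e l x"
    using spectral_idempotents by blast
  let ?num = "\<lambda>l (d::nat) (t::int). d > 0 \<and> ?n * e l 0 = of_nat d \<and> ?n * e l z = of_int t \<and>
     \<bar>t\<bar> \<le> int d \<and> int d dvd t * t \<and> ?c * of_int t = l * of_nat d \<and>
     (t = int d \<longrightarrow> (\<forall>x\<in>G. e l (z + x) = e l x)) \<and> (t = - int d \<longrightarrow> (\<forall>x\<in>G. e l (z + x) = - e l x))"
  have "\<forall>l\<in>\<Lambda>. \<exists>d t. ?num l d t"
    using eigen_idempotent_numbers[OF cf idem eig ne z(1)] by blast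
  then obtain d where "\<forall>l\<in>\<Lambda>. \<exists>t. ?num l (d l) t" by (rule bchoice[THEN exE])
  then obtain t where num: "\<forall>l\<in>\<Lambda>. ?num l (d l) (t l)" by (rule bchoice[THEN exE])
  have dt: "\<And>l. l \<in> \<Lambda> \<Longrightarrow> d l > (0::nat)" "\<And>l. l \<in> \<Lambda> \<Longrightarrow> ?n * e l 0 = of_nat (d l)"
    "\<And>l. l \<in> \<Lambda> \<Longrightarrow> ?n * e l z = of_int (t l)" "\<And>l. l \<in> \<Lambda> \<Longrightarrow> \<bar>t l\<bar> \<le> int (d l)"
    "\<And>l. l \<in> \<Lambda> \<Longrightarrow> int (d l) dvd t l * t l" "\<And>l. l \<in> \<Lambda> \<Longrightarrow> ?c * of_int (t l) = l * of_nat (d l)"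
    "\<And>l. l \<in> \<Lambda> \<Longrightarrow> t l = int (d l) \<Longrightarrow> \<forall>x\<in>G. e l (z + x) = e l x"
    "\<And>l. l \<in> \<Lambda> \<Longrightarrow> t l = - int (d l) \<Longrightarrow> \<forall>x\<in>G. e l (z + x) = - e l x"
    using num by blast+
  have rat: "\<Lambda> \<subseteq> \<rat>"
  proof
    fix l assume l: "l \<in> \<Lambda>"
    have "l = ?c * of_int (t l) / of_nat (d l)" using dt(1,6)[OF l] by (simp add: field_simps)
    also have "\<dots> \<in> \<rat>" by simp
    finally show "l \<in> \<rat>" .
  qed
  have int: "l \<in> \<int>" if l: "l \<in> \<Lambda>" for l
  proof (rule rational_eigenvalue_integer[of l "e l"])
    show "e l x \<in> \<rat>" if "x \<in> G" for x
      by (rule eigen_component_rational[OF L rat sum _ eig l that]) (auto simp: delta_def)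
  qed (use rat l eig ne in auto)
  have not_minus: "t l \<noteq> - int (d l)" if "l \<in> \<Lambda>" for l
    using no_sign[OF cf ne] dt(8) that by blast
  \<comment> \<open>If \<open>p\<close> does not divide \<open>d l\<close>, then
    \<open>card C * t l = l * d l\<close> makes \<open>d l\<close> a divisor of \<open>t l\<close>.
    As \<open>t l = d l\<close> would mean \<open>l = card C\<close> and \<open>t l = - d l\<close>
    is excluded, \<open>t l = 0\<close>.\<close>
  have p_dvd: "int p dvd t l" if l: "l \<in> \<Lambda>" and lc: "l \<noteq> ?c" for l
  proof (cases "p dvd d l")
    case True
    then have "int p dvd t l * t l" using dt(5)[OF l] by (metis dvd_trans int_dvd_int_iff)
    then show ?thesis using p(1) by (simp add: prime_dvd_mult_iff)
  next
    case False
    obtain k where k: "l = of_int k" using int[OF l] by (auto elim: Ints_cases)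
    have "(of_int (int (p ^ j) * t l) :: complex) = of_int (k * int (d l))"
      using dt(6)[OF l] p(2) k by simp
    then have "int (p ^ j) * t l = k * int (d l)" by (simp only: of_int_eq_iff)
    then have "int (d l) dvd int (p ^ j) * t l" by simp
    moreover have "coprime (int (d l)) (int (p ^ j))"
      using False p(1) by (simp add: prime_imp_coprime coprime_commute flip: of_nat_power)
    ultimately have "int (d l) dvd t l" by (simp add: coprime_dvd_mult_right_iff)
    moreover have "t l \<noteq> int (d l)" using dt(1,6)[OF l] lc by auto
    ultimately have "t l = 0"
      using not_minus[OF l] dt(4)[OF l] by (metis abs_of_nat abs_eq_iff dvd_imp_le_int order_antisym abs_ge_zero)
    then show ?thesis by simp
  qed
  \<comment> \<open>Summation over \<open>G\<close> turns \<open>T\<close> into multiplication by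
    \<open>card C\<close>, so only the component for that eigenvalue contributes to the sum 1 of
    \<open>delta\<close>.\<close>
  have total: "(\<Sum>x\<in>G. e l x) = 0" if l: "l \<in> \<Lambda>" and lc: "l \<noteq> ?c" for l
  proof -
    have "l * (\<Sum>x\<in>G. e l x) = (\<Sum>x\<in>G. T (e l) x)" using eig[OF l] by (simp add: sum_distrib_left)
    also have "\<dots> = (\<Sum>c\<in>C. \<Sum>x\<in>G. e l (c + x))" unfolding T_def by (rule sum.swap)
    also have "\<dots> = (\<Sum>c\<in>C. \<Sum>x\<in>G. e l x)" by (rule sum.cong[OF refl], rule sum_G_left) auto
    also have "\<dots> = ?c * (\<Sum>x\<in>G. e l x)" by simp
    finally show ?thesis using lc by simp
  qed
  have "(\<Sum>x\<in>G. delta x) = 1" using finite_G by (simp add: delta_def)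
  also have "(\<Sum>x\<in>G. delta x) = (\<Sum>l\<in>\<Lambda>. \<Sum>x\<in>G. e l x)" by (subst sum.swap) (simp add: sum)
  also have "\<dots> = (\<Sum>l\<in>\<Lambda>. if l = ?c then (\<Sum>x\<in>G. e ?c x) else 0)"
    using total by (intro sum.cong) auto
  finally have trivial: "?c \<in> \<Lambda>" "(\<Sum>x\<in>G. e ?c x) = 1" using L by (auto split: if_splits)
  \<comment> \<open>On the component for \<open>card C\<close> the element \<open>z\<close> acts
    trivially, so by simplicity all of \<open>G\<close> does; the component is constant, which gives
    \<open>t = d = 1\<close>.\<close>
  have "(of_int (t ?c) :: complex) = of_int (int (d ?c))" using dt(6)[OF trivial(1)] c0 by simp
  then have td: "t ?c = int (d ?c)" by (simp only: of_int_eq_iff)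
  have "z \<in> {h \<in> G. \<forall>x\<in>G. e ?c (h + x) = e ?c x}" using dt(7)[OF trivial(1) td] z by simp
  then have "{h \<in> G. \<forall>x\<in>G. e ?c (h + x) = e ?c x} = G"
    using simple[OF idempotent_stabiliser_normal[OF cf[OF trivial(1)]]] z(2) by blast
  then have const: "e ?c x = e ?c 0" if "x \<in> G" for x
    using that by (metis (mono_tags, lifting) G_closed(1) add_0_right mem_Collect_eq)
  have "(\<Sum>x\<in>G. e ?c x) = (\<Sum>x\<in>G. e ?c 0)" by (rule sum.cong[OF refl]) (rule const)
  then have "?n * e ?c 0 = 1" using trivial(2) by simp
  then have t1: "t ?c = 1" using td dt(2)[OF trivial(1)] by simp
  \<comment> \<open>Modulo \<open>p\<close> the sum of all \<open>t l\<close> is 1, but it equals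
    \<open>card G * delta z = 0\<close>.\<close>
  have "(\<Sum>l\<in>\<Lambda>. of_int (t l)) = ?n * delta z"
    using sum[of z] z dt(3) by (simp add: sum_distrib_left)
  also have "\<dots> = of_int 0" using z(2) by (simp add: delta_def)
  finally have "(\<Sum>l\<in>\<Lambda>. t l) = 0" by (simp only: of_int_sum[symmetric] of_int_eq_iff)
  then have "1 + (\<Sum>l\<in>\<Lambda> - {?c}. t l) = 0" using L trivial(1) t1 by (simp add: sum.remove)
  moreover have "int p dvd (\<Sum>l\<in>\<Lambda> - {?c}. t l)" using p_dvd by (intro dvd_sum) auto
  ultimately have "int p dvd 1" by (metis add.commute dvd_add_right_iff dvd_0_right)
  then show False using p(1) by simp
qed

end

section \<open>Groups whose order is divisible by at most one odd prime\<close>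

lemma conj_action: "add_subgroup P \<Longrightarrow> finite P \<Longrightarrow> (\<And>g x. g \<in> P \<Longrightarrow> x \<in> X \<Longrightarrow> g + x - g \<in> X) \<Longrightarrow>
    set_action P X (\<lambda>g x. g + x - g)"
  by unfold_locales (auto simp: group_add_norm simp del: add_uminus_conv_diff)

lemma conj_eq_iff: "g + x - g = x \<longleftrightarrow> g + x = x + (g::'g::group_add)"
  by (simp add: diff_eq_eq)

lemma commute_add:
  fixes g :: "'g::group_add"
  assumes "g + x = x + g" "g + y = y + g"
  shows "g + (x + y) = x + y + g"
proof -
  have "g + (x + y) = x + (g + y)" unfolding add.assoc[symmetric] assms(1) ..
  then show ?thesis by (simp add: assms(2) add.assoc)
qed

lemma commute_minus:
  fixes g :: "'g::group_add"
  assumes "g + x = x + g"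
  shows "g + - x = - x + g"
proof -
  have "- x + (g + x) + - x = - x + (x + g) + - x" by (simp add: assms)
  then show ?thesis by (simp add: group_add_norm del: add_uminus_conv_diff)
qed

lemma add_eq_self_iff: "g + x = g \<longleftrightarrow> x = (0::'g::group_add)"
  by (metis add_0_right add_left_cancel)

lemma conj_image_subgroup:
  assumes "add_subgroup S"
  shows "add_subgroup ((\<lambda>x. g + x - g) ` S)"
  unfolding add_subgroup_def ball_simps
proof (intro conjI ballI)
  note SD = add_subgroupD[OF assms]
  show "0 \<in> (\<lambda>x. g + x - g) ` S" using SD(1) by (intro image_eqI[of _ _ 0]) auto
  show "g + x - g + (g + y - g) \<in> (\<lambda>x. g + x - g) ` S" if "x \<in> S" "y \<in> S" for x y
    using SD(2) that by (intro image_eqI[of _ _ "x + y"]) (auto simp: group_add_norm simp del: add_uminus_conv_diff)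
  show "- (g + x - g) \<in> (\<lambda>x. g + x - g) ` S" if "x \<in> S" for x
    using SD(3) that by (intro image_eqI[of _ _ "- x"]) (auto simp: group_add_norm simp del: add_uminus_conv_diff)
qed

text \<open>\<open>P\<close> acts by conjugation on its nonzero elements, whose number is prime to
  \<open>p\<close>. A fixed point shows that the centre is nontrivial, and Cauchy's theorem in the
  centre gives order \<open>p\<close>.\<close>

lemma prime_power_central_element:
  assumes "add_subgroup P" "finite P" "prime p" "card P = p ^ k" "P \<noteq> {0}"
  shows "\<exists>z\<in>P. z \<noteq> 0 \<and> nmul p z = 0 \<and> (\<forall>g\<in>P. g + z = z + g)"
proof -
  note S = add_subgroupD[OF assms(1)]
  interpret set_action P "P - {0}" "\<lambda>g x. g + x - g"
    using S by (intro conj_action assms) (auto simp: add_eq_self_iff)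
  have "k \<noteq> 0"
  proof
    assume "k = 0"
    then obtain y where "P = {y}" using assms(4) card_1_singletonE by auto
    then show False using S(1) assms(5) by auto
  qed
  then have pP: "p dvd card P" using assms(4) by simp
  have "card P = Suc (card (P - {0}))" using S(1) assms(2) by (metis card_Suc_Diff1)
  then have "\<not> p dvd card (P - {0})" using pP assms(3)
    by (metis Suc_eq_plus1 dvd_add_right_iff nat_dvd_1_iff_1 not_prime_1)
  from p_group_fixed_point[OF assms(3,4) _ this] assms(2)
  obtain x where x: "x \<in> P" "x \<noteq> 0" "\<forall>g\<in>P. g + x = x + g" by (auto simp: conj_eq_iff)
  define Z where "Z = {z \<in> P. \<forall>g\<in>P. g + z = z + g}"
  have "- z \<in> Z" if "z \<in> Z" for z
  proof -
    have "g + - z = - z + g" if "g \<in> P" for g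
      using that \<open>z \<in> Z\<close> by (intro commute_minus) (simp add: Z_def)
    then show ?thesis using that S by (simp add: Z_def)
  qed
  moreover have "x + y \<in> Z" if "x \<in> Z" "y \<in> Z" for x y
  proof -
    have "g + (x + y) = x + y + g" if "g \<in> P" for g
      using that \<open>x \<in> Z\<close> \<open>y \<in> Z\<close> by (intro commute_add) (simp_all add: Z_def)
    moreover have "x + y \<in> P" using that S(2) unfolding Z_def by blast
    ultimately show ?thesis unfolding Z_def by blast
  qed
  moreover have "0 \<in> Z" using S(1) by (simp add: Z_def)
  ultimately have Z: "add_subgroup Z" by (simp add: add_subgroup_def)
  have ZP: "Z \<subseteq> P" by (auto simp: Z_def)
  have "card Z dvd p ^ k" using lagrange_add[OF assms(2,1) Z ZP] assms(4) by simp
  then obtain i where i: "card Z = p ^ i" using divides_primepow_nat[OF assms(3)] by blast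
  have "i \<noteq> 0"
  proof
    assume "i = 0"
    then obtain y where "Z = {y}" using i card_1_singletonE by auto
    then show False using x add_subgroupD(1)[OF Z] by (auto simp: Z_def)
  qed
  then have "p dvd card Z" using i by simp
  from cauchy_add[OF finite_subset[OF ZP assms(2)] Z assms(3) this] show ?thesis
    unfolding Z_def by blast
qed

lemma translate_action:
  assumes "add_subgroup P" "finite P" "\<And>g A. g \<in> P \<Longrightarrow> A \<in> X \<Longrightarrow> (+) g ` A \<in> X"
  shows "set_action P X (\<lambda>g A. (+) g ` A)"
  using assms by unfold_locales (auto simp: image_image add.assoc)

text \<open>\<open>R\<close> acts on the \<open>m\<close> left cosets of \<open>S\<close> and fixes
  one, say \<open>g + S\<close>. So a conjugate of \<open>R\<close> lies in \<open>S\<close>, and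
  \<open>R\<close> is normal.\<close>

lemma normal_prime_power_subgroup_le_sylow:
  assumes G: "finite G" "add_subgroup G" and p: "prime p" "card G = p ^ a * m" "\<not> p dvd m"
    and S: "add_subgroup S" "S \<subseteq> G" "card S = p ^ a" and R: "normal_in R G" "card R = p ^ i"
  shows "R \<subseteq> S"
proof -
  note GD = add_subgroupD[OF G(2)] and RD = normal_inD[OF R(1)] and SD = add_subgroupD[OF S(1)]
  interpret A: set_action G "Pow G" "\<lambda>g A. (+) g ` A"
    by (rule translate_action) (use G GD in auto)
  \<comment> \<open>With \<open>S\<close> as its own stabiliser, the orbit of \<open>S\<close>,
    which is the set of left cosets, has \<open>m\<close> elements.\<close>
  have "A.stab S = S"
  proof -
    have "g \<in> S" if "(+) g ` S = S" for g
      using that SD(1) by (metis add_0_right imageI)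
    moreover have "(+) g ` S = S" if "g \<in> S" for g
    proof
      show "(+) g ` S \<subseteq> S" using that SD by auto
      show "S \<subseteq> (+) g ` S"
      proof
        fix x assume "x \<in> S"
        then have "- g + x \<in> S" using that SD by simp
        then show "x \<in> (+) g ` S" by (intro image_eqI[of _ _ "- g + x"]) auto
      qed
    qed
    ultimately show ?thesis using S(2) unfolding A.stab_def by blast
  qed
  then have "card G = card (A.orb S) * card S" using A.orbit_stabilizer[of S] S(2) by simp
  then have "card (A.orb S) = m" using p(1,2) S(3) by (simp add: prime_gt_0_nat)
  then have ndvd: "\<not> p dvd card (A.orb S)" using p(3) by simp
  have finR: "finite R" using RD(2) G(1) finite_subset by blast
  interpret B: set_action R "A.orb S" "\<lambda>g A. (+) g ` A"
  proof (rule translate_action)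
    fix r A assume "r \<in> R" "A \<in> A.orb S"
    then obtain g where g: "g \<in> G" "A = (+) g ` S" by (auto simp: A.orb_def)
    then have "(+) r ` A = (+) (r + g) ` S" by (simp add: image_image add.assoc)
    then show "(+) r ` A \<in> A.orb S" using g \<open>r \<in> R\<close> RD(2) GD(2) by (auto simp: A.orb_def)
  qed (use RD finR in auto)
  have "finite (A.orb S)" using G(1) by (simp add: A.orb_def)
  from B.p_group_fixed_point[OF p(1) R(2) this ndvd]
  obtain g where g: "g \<in> G" and fix_coset: "\<And>r. r \<in> R \<Longrightarrow> (+) r ` (+) g ` S = (+) g ` S"
    by (auto simp: A.orb_def)
  show "R \<subseteq> S"
  proof
    fix r assume "r \<in> R"
    then have "g + r - g \<in> R" using RD(3) g by blast
    moreover have "g + 0 \<in> (+) g ` S" using SD(1) by blast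
    ultimately have "(g + r - g) + (g + 0) \<in> (+) g ` S" using fix_coset by blast
    then show "r \<in> S" by (auto simp: group_add_norm simp del: add_uminus_conv_diff)
  qed
qed

text \<open>The witness is the intersection of all Sylow \<open>p\<close>-subgroups of \<open>M\<close>, which is characteristic in \<open>M\<close>.\<close>

lemma normal_prime_power_subgroup_transfer:
  assumes G: "finite G" "add_subgroup G" and M: "normal_in M G" and p: "prime p"
    and R: "normal_in R M" "R \<noteq> {0}" "card R = p ^ i"
  shows "\<exists>Q k. normal_in Q G \<and> Q \<noteq> {0} \<and> card Q = p ^ k"
proof -
  note MD = normal_inD[OF M] and GD = add_subgroupD[OF G(2)]
  have finM: "finite M" using MD(2) G(1) finite_subset by blast
  have "card M \<noteq> 0" using card_subgroup_pos[OF finM MD(1)] by simp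
  then obtain m where m: "card M = p ^ multiplicity p (card M) * m" "\<not> p dvd m"
    using p by (metis multiplicity_decompose' not_prime_unit mult.commute)
  define a where "a = multiplicity p (card M)"
  define Syl where "Syl = {S. add_subgroup S \<and> S \<subseteq> M \<and> card S = p ^ a}"
  define Q where "Q = \<Inter> Syl"
  obtain S0 where S0: "S0 \<in> Syl" using sylow_add[OF finM MD(1) p m(1)] by (auto simp: Syl_def a_def)
  have conj: "(\<lambda>x. g + x - g) ` S \<in> Syl" if g: "g \<in> G" and S: "S \<in> Syl" for g S
  proof -
    have SS: "add_subgroup S" "S \<subseteq> M" "card S = p ^ a" using S by (auto simp: Syl_def)
    have "add_subgroup ((\<lambda>x. g + x - g) ` S)" by (rule conj_image_subgroup) fact
    moreover have "card ((\<lambda>x. g + x - g) ` S) = card S"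
      by (rule card_image) (simp add: inj_on_def diff_conv_add_uminus del: add_uminus_conv_diff)
    moreover have "(\<lambda>x. g + x - g) ` S \<subseteq> M" using SS(2) MD(3) g by blast
    ultimately show ?thesis using SS(3) by (simp add: Syl_def)
  qed
  have QS: "add_subgroup Q" unfolding Q_def add_subgroup_def by (auto simp: Syl_def add_subgroup_def)
  have "g + x - g \<in> Q" if g: "g \<in> G" and x: "x \<in> Q" for g x
    unfolding Q_def
  proof
    fix S assume "S \<in> Syl"
    then have "x \<in> (\<lambda>y. - g + y - - g) ` S" using conj[of "- g" S] x g GD(3) by (auto simp: Q_def)
    then show "g + x - g \<in> S" by (auto simp: group_add_norm simp del: add_uminus_conv_diff)
  qed
  moreover have QS0: "Q \<subseteq> S0" "S0 \<subseteq> M" using S0 by (auto simp: Q_def Syl_def)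
  ultimately have nQ: "normal_in Q G" using QS MD(2) by (auto simp: normal_in_def)
  have "R \<subseteq> Q" unfolding Q_def
    using normal_prime_power_subgroup_le_sylow[OF finM MD(1) p _ m(2) _ _ _ R(1,3)] m(1)
    by (auto simp: Syl_def a_def)
  then have "Q \<noteq> {0}" using R(2) normal_inD(1)[OF R(1)] by (auto simp: add_subgroup_def)
  moreover have "card Q dvd p ^ a"
    using lagrange_add[of S0 Q] S0 QS QS0 finM finite_subset by (auto simp: Syl_def)
  then obtain k where "card Q = p ^ k" using p divides_primepow_nat by blast
  ultimately show ?thesis using nQ by blast
qed

text \<open>Burnside's theorem, stated through normal subgroups. Induction on \<open>card G\<close>
  passes to a proper nontrivial normal subgroup if there is one and leaves the case of a simple
  group.\<close>

theorem normal_prime_power_subgroup_exists: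
  assumes "finite G" "add_subgroup G" "G \<noteq> {0}" "prime q" "card G = 2 ^ a * q ^ b"
  shows "\<exists>p N k. (p = 2 \<or> p = q) \<and> normal_in N G \<and> N \<noteq> {0} \<and> card N = p ^ k"
  using assms
proof (induction "card G" arbitrary: G a b rule: less_induct)
  case less
  note G = less.prems(1,2) and GD = add_subgroupD[OF less.prems(2)]
  have nG: "normal_in G G" using G GD by (auto simp: normal_in_def)
  show ?case
  proof (cases "\<exists>M. normal_in M G \<and> M \<noteq> {0} \<and> M \<noteq> G")
    case True
    then obtain M where M: "normal_in M G" "M \<noteq> {0}" "M \<noteq> G" by blast
    note MD = normal_inD[OF M(1)]
    have finM: "finite M" using MD(2) G(1) finite_subset by blast
    have lt: "card M < card G" using M MD(2) G(1) by (intro psubset_card_mono) auto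
    have "card M dvd 2 ^ a * q ^ b" using lagrange_add[OF G MD(1,2)] less.prems(5) by simp
    then obtain u v where uv: "card M = u * v" "u dvd 2 ^ a" "v dvd q ^ b"
      using division_decomp by blast
    obtain i j where "u = 2 ^ i" "v = q ^ j"
      using uv(2,3) less.prems(4) divides_primepow_nat[of 2] divides_primepow_nat[of q] by auto
    then obtain p N k where N: "p = 2 \<or> p = q" "normal_in N M" "N \<noteq> {0}" "card N = p ^ k"
      using less.hyps[OF lt finM MD(1) M(2) less.prems(4)] uv(1) by blast
    have "prime p" using N(1) less.prems(4) by auto
    from normal_prime_power_subgroup_transfer[OF G M(1) this N(2-4)] show ?thesis using N(1) by blast
  next
    case False
    then have simple: "N = {0} \<or> N = G" if "normal_in N G" for N using that by blast
    show ?thesis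
    proof (cases "a = 0")
      case True
      then have "card G = q ^ b" using less.prems(5) by simp
      then show ?thesis using nG less.prems(3) by blast
    next
      case a: False
      have two: "prime (2::nat)" by simp
      obtain S where S: "add_subgroup S" "S \<subseteq> G" "card S = 2 ^ a"
        using sylow_add[OF G two less.prems(5)] by blast
      have "S \<noteq> {0}" using S(3) a by (metis card_1_singleton_iff nat_power_eq_Suc_0_iff numeral_eq_one_iff One_nat_def semiring_norm(85))
      from prime_power_central_element[OF S(1) finite_subset[OF S(2) G(1)] two S(3) this]
      obtain z where z: "z \<in> S" "z \<noteq> 0" "nmul 2 z = 0" "\<And>g. g \<in> S \<Longrightarrow> g + z = z + g" by blast
      have zG: "z \<in> G" using z(1) S(2) by blast
      have zz: "z + z = 0" using z(3) by (simp add: numeral_2_eq_2)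
      interpret A: set_action G G "\<lambda>g x. g + x - g"
        using G GD by (intro conj_action) auto
      define C where "C = A.orb z"
      \<comment> \<open>The stabiliser of \<open>z\<close> contains the Sylow subgroup
        \<open>S\<close>, so the class size divides \<open>q ^ b\<close>.\<close>
      have "S \<subseteq> A.stab z" using S(2) z(4) by (auto simp: A.stab_def conj_eq_iff)
      then have "card S dvd card (A.stab z)"
        using lagrange_add[of "A.stab z" S] A.stab_subgroup[OF zG] S(1) G(1) by (auto simp: A.stab_def)
      then obtain l where "card (A.stab z) = 2 ^ a * l" using S(3) by (auto elim: dvdE)
      then have "2 ^ a * q ^ b = 2 ^ a * (card C * l)"
        using A.orbit_stabilizer[OF zG] less.prems(5) by (simp add: C_def mult_ac)
      then have "card C dvd q ^ b" by simp
      then obtain j where j: "card C = q ^ j" using less.prems(4) divides_primepow_nat by blast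
      have zC: "z \<in> C" unfolding C_def A.orb_def using GD(1) by (intro image_eqI[of _ _ 0]) auto
      interpret involution_class G C
      proof
        show "g + c - g \<in> C" if "g \<in> G" "c \<in> C" for g c
        proof -
          obtain h where h: "h \<in> G" "c = h + z - h" using \<open>c \<in> C\<close> by (auto simp: C_def A.orb_def)
          then have "g + c - g = (g + h) + z - (g + h)"
            by (simp add: group_add_norm del: add_uminus_conv_diff)
          then show ?thesis using h \<open>g \<in> G\<close> GD(2) by (auto simp: C_def A.orb_def)
        qed
        show "\<exists>g\<in>G. d = g + c - g" if "c \<in> C" "d \<in> C" for c d
        proof -
          obtain h where h: "h \<in> G" "c = h + z - h" using \<open>c \<in> C\<close> by (auto simp: C_def A.orb_def)
          obtain k where k: "k \<in> G" "d = k + z - k" using \<open>d \<in> C\<close> by (auto simp: C_def A.orb_def)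
          have "d = (k - h) + c - (k - h)"
            by (simp add: h k group_add_norm del: add_uminus_conv_diff)
          then show ?thesis using h k GD(4) by blast
        qed
        show "c + c = 0" if "c \<in> C" for c
        proof -
          obtain h where "c = h + z - h" using \<open>c \<in> C\<close> by (auto simp: C_def A.orb_def)
          then have "c + c = h + (z + z) - h"
            by (simp add: group_add_norm del: add_uminus_conv_diff)
          then show ?thesis using zz by simp
        qed
        show "C \<subseteq> G" using zG GD by (auto simp: C_def A.orb_def)
      qed (use G zC in auto)
      have "G = {0, z}"
        by (rule simple_with_prime_power_involution_class[OF less.prems(4) j zC z(2) simple])
      then have "card G = 2 ^ 1" using z(2) by simp
      then show ?thesis using nG less.prems(3) by blast
    qed
  qed
qed

text \<open>\<open>E\<close> consists of the elements of order dividing \<open>p\<close> in the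
  centre of \<open>N\<close>; it is characteristic in \<open>N\<close> and therefore normal in
  \<open>G\<close>.\<close>

lemma normal_elementary_abelian_exists:
  assumes "finite G" "add_subgroup G" "G \<noteq> {0}" "prime q" "card G = 2 ^ a * q ^ b"
  obtains p E where "p = 2 \<or> p = q" "normal_in E G" "E \<noteq> {0}"
    "\<And>x y. x \<in> E \<Longrightarrow> y \<in> E \<Longrightarrow> x + y = y + x" "\<And>x. x \<in> E \<Longrightarrow> nmul p x = 0"
proof -
  obtain p N k where N: "p = 2 \<or> p = q" "normal_in N G" "N \<noteq> {0}" "card N = p ^ k"
    using normal_prime_power_subgroup_exists[OF assms] by blast
  note ND = normal_inD[OF N(2)]
  note SD = add_subgroupD[OF ND(1)] and GD = add_subgroupD[OF assms(2)]
  have p: "prime p" using N(1) assms(4) by auto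
  define E where "E = {z \<in> N. (\<forall>g\<in>N. g + z = z + g) \<and> nmul p z = 0}"
  obtain z where z: "z \<in> E" "z \<noteq> 0"
    using prime_power_central_element[OF ND(1) finite_subset[OF ND(2) assms(1)] p N(4,3)]
    by (auto simp: E_def)
  have nadd: "nmul n (x + y) = nmul n x + nmul n y" if "x + y = y + x" for n and x y :: 'a
  proof (induction n)
    case (Suc n)
    have "y + nmul n x = nmul n x + y"
    proof (induction n)
      case (Suc n)
      then show ?case using that by (metis add.assoc nmul_simps(2))
    qed simp
    then show ?case using Suc by (simp add: add.assoc) (simp add: add.assoc[symmetric])
  qed simp
  have "x + y \<in> E" if "x \<in> E" "y \<in> E" for x y
  proof -
    have "g + (x + y) = x + y + g" if "g \<in> N" for g
      using that \<open>x \<in> E\<close> \<open>y \<in> E\<close> by (intro commute_add) (simp_all add: E_def)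
    moreover have "x + y = y + x" "nmul p x = 0" "nmul p y = 0" using that unfolding E_def by blast+
    then have "nmul p (x + y) = 0" using nadd by simp
    moreover have "x + y \<in> N" using that SD(2) unfolding E_def by blast
    ultimately show ?thesis unfolding E_def by blast
  qed
  moreover have "- x \<in> E" if x: "x \<in> E" for x
  proof -
    have "g + - x = - x + g" if "g \<in> N" for g
      using that x by (intro commute_minus) (simp add: E_def)
    moreover have "nmul p x = 0" using x unfolding E_def by blast
    then have "nmul p (- x) = 0" using nadd[of x "- x" p] by simp
    moreover have "- x \<in> N" using x SD(3) unfolding E_def by blast
    ultimately show ?thesis unfolding E_def by blast
  qed
  moreover have "0 \<in> E" using SD(1) by (simp add: E_def)
  ultimately have sub: "add_subgroup E" by (simp add: add_subgroup_def)
  have "h + x - h \<in> E" if h: "h \<in> G" and x: "x \<in> E" for h x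
  proof -
    have "g + (h + x - h) = h + x - h + g" if g: "g \<in> N" for g
    proof -
      have "- h + g - - h \<in> N" using ND(3) GD(3) h g by blast
      then have "(- h + g - - h) + x = x + (- h + g - - h)" using x by (simp add: E_def)
      then have "h + ((- h + g - - h) + x) + - h = h + (x + (- h + g - - h)) + - h" by simp
      then show ?thesis by (simp add: group_add_norm del: add_uminus_conv_diff)
    qed
    moreover have "nmul p x = 0" using x unfolding E_def by blast
    then have "nmul p (h + x - h) = 0" by (simp add: nmul_conj)
    moreover have "h + x - h \<in> N" using x h ND(3) unfolding E_def by blast
    ultimately show ?thesis unfolding E_def by blast
  qed
  moreover have "E \<subseteq> G" using ND(2) unfolding E_def by blast
  ultimately have nE: "normal_in E G" using sub by (simp add: normal_in_def)
  show thesis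
  proof (rule that[OF N(1) nE])
    show "E \<noteq> {0}" using z by blast
    show "x + y = y + x" if "x \<in> E" "y \<in> E" for x y using that unfolding E_def by blast
    show "nmul p x = 0" if "x \<in> E" for x using that unfolding E_def by blast
  qed
qed

section \<open>Linear recurrences in elementary abelian groups\<close>

text \<open>\<open>f\<close> permutes \<open>X\<close> in cycles whose lengths divide
  \<open>p ^ b\<close> but not \<open>p ^ c\<close>; such powers of \<open>p\<close> are multiples
  of \<open>p ^ Suc c\<close>.\<close>

lemma prime_power_period:
  assumes "finite X" "\<And>x. x \<in> X \<Longrightarrow> f x \<in> X" "prime p"
    and period: "\<And>x. x \<in> X \<Longrightarrow> (f ^^ (p ^ b)) x = x"
    and moved: "\<And>x. x \<in> X \<Longrightarrow> (f ^^ (p ^ c)) x \<noteq> x"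
  shows "p ^ Suc c dvd card X"
proof -
  define R where "R x = range (\<lambda>i. (f ^^ i) x)" for x
  have self: "x \<in> R x" for x unfolding R_def by (metis funpow_0 rangeI)
  have closed: "(f ^^ i) x \<in> X" if "x \<in> X" for i x
    using that assms(2) by (induction i) auto
  have sub: "R x \<subseteq> X" if "x \<in> X" for x using closed that by (auto simp: R_def)
  have le: "R ((f ^^ i) x) \<subseteq> R x" for i x
    by (auto simp: R_def simp flip: funpow_add[unfolded o_def, THEN fun_cong])
  \<comment> \<open>Completing a whole number of periods inverts \<open>f ^^ i\<close>, so the
    forward orbits partition \<open>X\<close>.\<close>
  have return: "x = (f ^^ (p ^ b * i - i)) ((f ^^ i) x)" if "x \<in> X" for x i
  proof -
    have "i \<le> p ^ b * i" using prime_gt_0_nat[OF assms(3)] by (simp add: Suc_le_eq)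
    then have "(f ^^ (p ^ b * i - i)) ((f ^^ i) x) = (f ^^ (p ^ b * i)) x"
      by (metis funpow_add comp_apply le_add_diff_inverse2)
    also have "\<dots> = x"
      using funpow_mod_eq[OF period[OF that], of "p ^ b * i"] by simp
    finally show ?thesis by simp
  qed
  have eq: "R y = R x" if x: "x \<in> X" and "y \<in> R x" for x y
  proof -
    obtain i where i: "y = (f ^^ i) x" using \<open>y \<in> R x\<close> by (auto simp: R_def)
    show ?thesis using le[of i x] le[of "p ^ b * i - i" y] return[OF x, of i] i by auto
  qed
  have card: "p ^ Suc c dvd card (R x)" if x: "x \<in> X" for x
  proof -
    define d where "d = (LEAST d. d > 0 \<and> (f ^^ d) x = x)"
    have "p ^ b > 0 \<and> (f ^^ (p ^ b)) x = x" using period[OF x] assms(3) prime_gt_0_nat by simp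
    then have d: "d > 0" "(f ^^ d) x = x" unfolding d_def by (metis (mono_tags, lifting) LeastI)+
    have min: "k = 0" if "k < d" "(f ^^ k) x = x" for k
      using that not_less_Least[of k "\<lambda>d. d > 0 \<and> (f ^^ d) x = x"] unfolding d_def by auto
    have dvd: "d dvd k" if "(f ^^ k) x = x" for k
      using min[of "k mod d"] funpow_mod_eq[OF d(2), of k] that d(1) by (simp add: dvd_eq_mod_eq_0)
    have "inj_on (\<lambda>i. (f ^^ i) x) {..<d}"
    proof (rule linorder_inj_onI')
      fix i j assume ij: "i \<in> {..<d}" "j \<in> {..<d}" "i < j"
      show "(f ^^ i) x \<noteq> (f ^^ j) x"
      proof
        assume "(f ^^ i) x = (f ^^ j) x"
        then have "(f ^^ (d - j + i)) x = (f ^^ (d - j + j)) x" by (simp add: funpow_add)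
        then have "(f ^^ (d - j + i)) x = x" using ij d(2) by simp
        then have "d dvd d - j + i" by (rule dvd)
        then show False using ij by (auto dest: dvd_imp_le)
      qed
    qed
    moreover have "R x = (\<lambda>i. (f ^^ i) x) ` {..<d}"
    proof -
      have "(f ^^ i) x \<in> (\<lambda>i. (f ^^ i) x) ` {..<d}" for i
        using funpow_mod_eq[OF d(2), of i] d(1) by (intro image_eqI[of _ _ "i mod d"]) auto
      then show ?thesis by (auto simp: R_def)
    qed
    ultimately have "card (R x) = d" by (simp add: card_image)
    moreover obtain e where e: "d = p ^ e" using dvd[OF period[OF x]] divides_primepow_nat[OF assms(3)] by blast
    have "\<not> e \<le> c"
    proof
      assume "e \<le> c"
      then have "p ^ c = d * p ^ (c - e)" by (simp add: e flip: power_add)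
      then have "(f ^^ (p ^ c)) x = x" using funpow_mod_eq[OF d(2), of "p ^ c"] by simp
      then show False using moved[OF x] by blast
    qed
    then have "p ^ Suc c dvd d" unfolding e by (intro le_imp_power_dvd) simp
    ultimately show ?thesis by simp
  qed
  have un: "X = \<Union> (R ` X)" using self sub by blast
  have "p ^ Suc c dvd card (\<Union> (R ` X))"
  proof (rule dvd_partition)
    show "finite (\<Union> (R ` X))" using assms(1) un by argo
    show "\<forall>c1\<in>R ` X. \<forall>c2\<in>R ` X. c1 \<noteq> c2 \<longrightarrow> c1 \<inter> c2 = {}"
      using eq by (metis (no_types, lifting) disjoint_iff imageE)
  qed (use card in auto)
  then show ?thesis using un by argo
qed

section \<open>The order of 2 modulo powers of 3\<close>

text \<open>Since 64 is 1 modulo 9, only the exponents below 6 have to be checked.\<close>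

lemma six_dvd_if_nine_dvd:
  assumes "9 dvd (2::nat) ^ r - 1"
  shows "6 dvd r"
proof -
  have "(2::nat) ^ r mod 9 = 2 ^ (6 * (r div 6) + r mod 6) mod 9" by simp
  also have "\<dots> = (64 ^ (r div 6) mod 9) * 2 ^ (r mod 6) mod 9"
    by (simp only: power_add power_mult mod_mult_left_eq) simp
  also have "(64::nat) ^ (r div 6) mod 9 = 1"
    using power_mod[of "64::nat" 9 "r div 6"] by simp
  finally have "(2::nat) ^ r mod 9 = 2 ^ (r mod 6) mod 9" by simp
  moreover obtain m where "(2::nat) ^ r - 1 = 9 * m" using assms by (auto elim: dvdE)
  then have "(2::nat) ^ r = 9 * m + 1" using one_le_power[of "2::nat" r] by linarith
  then have "(2::nat) ^ r mod 9 = 1" by simp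
  ultimately have "(2::nat) ^ (r mod 6) mod 9 = 1" by simp
  moreover have "r mod 6 \<in> {0,1,2,3,4,5}" by auto
  ultimately have "r mod 6 = 0" by auto
  then show ?thesis by auto
qed

text \<open>In the induction step \<open>r = 3 * s\<close> with \<open>2 ^ s\<close> equal to 1
  modulo 3, and \<open>2 ^ r - 1 = 3 * ((2 ^ s - 1) * Z)\<close> with \<open>Z\<close> prime to 3,
  so exactly one factor 3 is lost.\<close>

lemma order_of_two_mod_power_of_three:
  assumes "3 ^ Suc j dvd (2::nat) ^ r - 1"
  shows "2 * 3 ^ j dvd r"
  using assms
proof (induction j arbitrary: r)
  case 0
  obtain m where "(2::nat) ^ r - 1 = 3 * m" using 0 by (auto elim: dvdE)
  then have m: "(2::nat) ^ r = 3 * m + 1" using one_le_power[of "2::nat" r] by linarith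
  show ?case
  proof (rule ccontr)
    assume "\<not> 2 * 3 ^ 0 dvd r"
    then obtain k where "r = 2 * k + 1" by (auto elim: oddE)
    moreover have "(2::nat) ^ (2 * k) = 4 ^ k" by (simp add: power_mult)
    ultimately have "(2::nat) ^ r mod 3 = (4 ^ k mod 3) * 2 mod 3"
      by (simp add: power_add mod_mult_right_eq mult.commute)
    also have "(4::nat) ^ k mod 3 = 1" using power_mod[of "4::nat" 3 k] by simp
    finally show False using m by simp
  qed
next
  case (Suc j)
  have "(9::nat) dvd 3 ^ Suc (Suc j)" by simp
  then have "6 dvd r" using Suc.prems dvd_trans six_dvd_if_nine_dvd by blast
  then obtain k where k: "r = 6 * k" by (auto elim: dvdE)
  define s where "s = 2 * k"
  have r: "r = 3 * s" using k by (simp add: s_def)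
  have "(2::nat) ^ s mod 3 = 1"
    using power_mod[of "4::nat" 3 k] by (simp add: s_def power_mult)
  then obtain u where u: "(2::nat) ^ s = 3 * u + 1" by (metis mult_div_mod_eq)
  define Z where "Z = 3 * u * u + 3 * u + 1"
  have "(2::nat) ^ r = (3 * u + 1) ^ 3" by (simp add: r u power_mult mult.commute[of 3 s])
  then have "(2::nat) ^ r - 1 = 3 * ((2 ^ s - 1) * Z)"
    by (simp add: u Z_def power3_eq_cube algebra_simps)
  then have "3 * 3 ^ Suc j dvd 3 * ((2 ^ s - 1) * Z)" using Suc.prems by simp
  then have "3 ^ Suc j dvd (2 ^ s - 1) * Z" by (subst (asm) nat_mult_dvd_cancel1) simp_all
  moreover have "coprime (3 ^ Suc j) Z"
  proof -
    have "\<not> 3 dvd Z"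
    proof
      assume "3 dvd Z"
      then have "3 dvd 3 * (u * u + u) + 1" by (simp add: Z_def algebra_simps)
      then have "3 dvd (1::nat)" using dvd_add_right_iff[of 3 "3 * (u * u + u)" 1] by simp
      then show False by simp
    qed
    moreover have "prime (3::nat)" by simp
    ultimately have "coprime 3 Z" by (simp add: prime_imp_coprime)
    then show ?thesis by simp
  qed
  ultimately have "3 ^ Suc j dvd (2::nat) ^ s - 1" by (simp add: coprime_dvd_mult_left_iff)
  from Suc.IH[OF this] show ?case by (simp add: r)
qed

lemma two_prime_factors:
  fixes n q :: nat
  assumes "n > 0" "\<And>p. prime p \<Longrightarrow> p dvd n \<Longrightarrow> p = 2 \<or> p = q"
  shows "\<exists>a b. n = 2 ^ a * q ^ b"
  using assms
proof (induction n rule: less_induct)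
  case (less n)
  show ?case
  proof (cases "n = 1")
    case True
    then show ?thesis by (intro exI[of _ 0]) simp
  next
    case False
    then obtain p where p: "prime p" "p dvd n" using prime_factor_nat by blast
    then obtain m where m: "n = p * m" by (auto elim: dvdE)
    have "m < n" "m > 0" using m p(1) less.prems(1) prime_gt_1_nat by auto
    then obtain a b where "m = 2 ^ a * q ^ b" using less.IH[of m] less.prems(2) m by auto
    then have "n = 2 ^ Suc a * q ^ b \<or> n = 2 ^ a * q ^ Suc b"
      using less.prems(2)[OF p] m by auto
    then show ?thesis by blast
  qed
qed

section \<open>Elementary abelian 2-groups\<close>

lemma card_elementary_abelian_two:
  assumes "finite A" "add_subgroup A" "\<And>x. x \<in> A \<Longrightarrow> x + x = 0"
  shows "\<exists>k. card A = 2 ^ k"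
proof -
  \<comment> \<open>Both primes of \<open>two_prime_factors\<close> are taken to be 2.\<close>
  have "p = 2 \<or> p = 2" if p: "prime p" "p dvd card A" for p
  proof (rule ccontr)
    assume "\<not> (p = 2 \<or> p = 2)"
    then have "gcd p 2 = 1"
      using p(1) primes_coprime[of p 2] by (simp add: coprime_iff_gcd_eq_1)
    moreover obtain x where x: "x \<in> A" "x \<noteq> 0" "nmul p x = 0" using cauchy_add[OF assms(1,2) p] by blast
    moreover have "nmul 2 x = 0" using assms(3) x(1) by (simp add: numeral_2_eq_2)
    ultimately show False using nmul_gcd[of p x 2] by simp
  qed
  from two_prime_factors[OF card_subgroup_pos[OF assms(1,2)] this]
  obtain a b where "card A = 2 ^ a * 2 ^ b" by blast
  then have "card A = 2 ^ (a + b)" by (simp add: power_add)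
  then show ?thesis by blast
qed

text \<open>Otherwise \<open>f\<close> moves the nonzero elements of \<open>A\<close> in cycles of
  even length and \<open>card A\<close> is odd, but it is a power of 2 other than 1.\<close>

lemma involution_fixed_by_two_element:
  assumes A: "finite A" "add_subgroup A" "A \<noteq> {0}" "\<And>x. x \<in> A \<Longrightarrow> x + x = 0"
    and f: "\<And>x. x \<in> A \<Longrightarrow> f x \<in> A" "f 0 = 0" "\<And>x. x \<in> A \<Longrightarrow> (f ^^ (2 ^ k)) x = x"
  shows "\<exists>x\<in>A. x \<noteq> 0 \<and> f x = x"
proof (rule ccontr)
  assume no: "\<not> ?thesis"
  define X where "X = A - {0}"
  have "f x \<in> X" if x: "x \<in> X" for x
  proof -
    have "f x \<noteq> 0"
    proof
      assume "f x = 0"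
      moreover have "(f ^^ n) 0 = 0" for n using f(2) by (induction n) auto
      moreover have "(2::nat) ^ k = Suc (2 ^ k - 1)" by simp
      ultimately have "(f ^^ (2 ^ k)) x = 0" by (metis comp_apply funpow_Suc_right)
      then show False using f(3) x by (simp add: X_def)
    qed
    then show ?thesis using f(1) x by (simp add: X_def)
  qed
  then have "2 ^ Suc 0 dvd card X"
    using no f(3) A(1) by (intro prime_power_period[where f = f and b = k]) (auto simp: X_def)
  moreover have "Suc (card X) = card A"
    unfolding X_def using A(1) add_subgroupD(1)[OF A(2)] by (intro card_Suc_Diff1)
  moreover obtain j where j: "card A = 2 ^ j" using card_elementary_abelian_two[OF A(1,2,4)] by blast
  have "j \<noteq> 0"
  proof
    assume "j = 0"
    then obtain y where "A = {y}" using j card_1_singletonE by auto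
    then show False using A(3) add_subgroupD(1)[OF A(2)] by auto
  qed
  then have "even (card A)" using j by simp
  ultimately show False by (metis even_Suc power_Suc0_right power_one_right One_nat_def)
qed

text \<open>\<open>M\<close> is a maximal proper subgroup above \<open>B\<close>: for
  \<open>x\<close> outside \<open>M\<close> the union of \<open>M\<close> and \<open>x + M\<close>
  is a larger subgroup, hence \<open>A\<close>. The last clause says that the indicator of the
  complement of \<open>M\<close> is an additive functional on \<open>A\<close> into the field with
  two elements.\<close>

lemma index_two_subgroup_exists:
  assumes A: "finite A" "add_subgroup A" "\<And>x y. x \<in> A \<Longrightarrow> y \<in> A \<Longrightarrow> x + y = y + x" "\<And>x. x \<in> A \<Longrightarrow> x + x = 0"
    and B: "add_subgroup B" "B \<subset> A"
  shows "\<exists>M. add_subgroup M \<and> B \<subseteq> M \<and> M \<subset> A \<and> (\<forall>x\<in>A. \<forall>y\<in>A. x + y \<in> M \<longleftrightarrow> (x \<in> M \<longleftrightarrow> y \<in> M))"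
proof -
  note AD = add_subgroupD[OF A(2)]
  let ?Q = "\<lambda>M. add_subgroup M \<and> B \<subseteq> M \<and> M \<subset> A"
  have "\<forall>M. ?Q M \<longrightarrow> card M < Suc (card A)"
    using A(1) by (auto intro!: card_mono le_imp_less_Suc)
  then obtain M where M: "?Q M" and max: "\<And>M'. ?Q M' \<Longrightarrow> card M' \<le> card M"
    using ex_has_greatest_nat[of ?Q B card "Suc (card A)"] B by (auto simp: less_Suc_eq_le)
  note MD = add_subgroupD[OF conjunct1[OF M]]
  have both: "x + y \<in> M" if x: "x \<in> A" "x \<notin> M" and y: "y \<in> A" "y \<notin> M" for x y
  proof -
    define M' where "M' = M \<union> (+) x ` M"
    have MA: "M \<subseteq> A" using M by blast
    have sum1: "a + (x + b) = x + (a + b)" if "a \<in> M" "b \<in> M" for a b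
      using A(3)[of a x] MA that x by (metis add.assoc subsetD)
    have sum2: "(x + a) + (x + b) = a + b" if "a \<in> M" "b \<in> M" for a b
      using sum1[OF that] A(4)[OF x(1)] by (metis add.assoc add_0)
    have "a + b \<in> M'" if "a \<in> M'" "b \<in> M'" for a b
      using that sum1 sum2 MD(2) unfolding M'_def by (auto simp: add.assoc) 
    moreover have "- a = a" if "a \<in> M'" for a
    proof -
      have "a \<in> A" using that MA AD(2) x(1) by (auto simp: M'_def)
      then show ?thesis using A(4) minus_unique by blast
    qed
    ultimately have "add_subgroup M'" using MD(1) by (auto simp: add_subgroup_def M'_def)
    moreover have "M' \<subseteq> A" using MA AD(2) x(1) by (auto simp: M'_def)
    moreover have "x \<in> M'" using MD(1) unfolding M'_def by (metis UnI2 add_0_right imageI)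
    then have "M \<subset> M'" using x(2) by (auto simp: M'_def)
    then have "card M < card M'"
      using \<open>M' \<subseteq> A\<close> A(1) finite_subset by (intro psubset_card_mono) auto
    ultimately have "M' = A" using max[of M'] M \<open>M \<subset> M'\<close> by (metis leD psubsetI subset_trans psubset_imp_subset)
    then obtain m where m: "m \<in> M" "y = x + m" using y by (auto simp: M'_def)
    then have "x + y = m" using A(4)[OF x(1)] by (metis add.assoc add_0)
    then show ?thesis using m by simp
  qed
  have "x + y \<in> M \<longleftrightarrow> (x \<in> M \<longleftrightarrow> y \<in> M)" if "x \<in> A" "y \<in> A" for x y
    using both[of x y] that add_subgroup_cancel[OF conjunct1[OF M]] by blast
  then show ?thesis using M by blast
qed

text \<open>
  Read as a sequence over the field with two elements, the coordinates of \<open>\<tau>\<^sup>i n\<close> with respect to a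
  functional vanishing on \<open>B\<close> satisfy \<open>s (i + 2 q) = s (i + q) + s i\<close>. The number of nonzero sequences
  obtained is one less than a power of 2 and divisible by \<open>3 q\<close>, so all initial values occur.
\<close>

lemma avoid_proper_subgroup:
  fixes A :: "'g::group_add set"
  assumes A: "finite A" "add_subgroup A" "\<And>x y. x \<in> A \<Longrightarrow> y \<in> A \<Longrightarrow> x + y = y + x" "\<And>x. x \<in> A \<Longrightarrow> x + x = 0"
    and \<tau>: "\<And>x. x \<in> A \<Longrightarrow> \<tau> x \<in> A" "\<And>x y. x \<in> A \<Longrightarrow> y \<in> A \<Longrightarrow> \<tau> (x + y) = \<tau> x + \<tau> y"
    and q: "q = 3 ^ b" and rel: "\<And>x. x \<in> A \<Longrightarrow> (\<tau> ^^ (2 * q)) x = (\<tau> ^^ q) x + x"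
    and B: "add_subgroup B" "B \<subset> A" "\<And>x. x \<in> B \<Longrightarrow> (\<tau> ^^ q) x \<in> B"
  shows "\<exists>n\<in>A. \<forall>i. (\<tau> ^^ i) n \<notin> B"
proof -
  note AD = add_subgroupD[OF A(2)]
  have q0: "q > 0" by (simp add: q)
  obtain M where M: "add_subgroup M" "B \<subseteq> M" "M \<subset> A"
    and M2: "\<And>x y. x \<in> A \<Longrightarrow> y \<in> A \<Longrightarrow> x + y \<in> M \<longleftrightarrow> (x \<in> M \<longleftrightarrow> y \<in> M)"
    using index_two_subgroup_exists[OF A B(1,2)] by blast
  have closed: "(\<tau> ^^ i) x \<in> A" if "x \<in> A" for i x
    using that \<tau>(1) by (induction i) auto
  have additive: "(\<tau> ^^ i) (x + y) = (\<tau> ^^ i) x + (\<tau> ^^ i) y" if "x \<in> A" "y \<in> A" for i x y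
    using that closed \<tau>(2) by (induction i) auto
  \<comment> \<open>\<open>\<Psi> n\<close> is the set of indices at which the sequence of
    \<open>n\<close> is 1; sums become symmetric differences.\<close>
  define \<Psi> where "\<Psi> n = {i. (\<tau> ^^ i) n \<notin> M}" for n
  have Psi_add: "\<Psi> (n + m) = {i. (i \<in> \<Psi> n) \<noteq> (i \<in> \<Psi> m)}" if "n \<in> A" "m \<in> A" for n m
    using that M2[OF closed closed] by (auto simp: \<Psi>_def additive)
  have rec: "i + q + q \<in> \<Psi> n \<longleftrightarrow> (i + q \<in> \<Psi> n) \<noteq> (i \<in> \<Psi> n)" if n: "n \<in> A" for i n
  proof -
    have "(\<tau> ^^ (i + q + q)) n = (\<tau> ^^ (i + q)) n + (\<tau> ^^ i) n"
      using rel[OF n] additive[OF closed[OF n, of q] n, of i] by (simp add: funpow_add mult_2)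
    then show ?thesis using M2[OF closed[OF n] closed[OF n]] by (simp add: \<Psi>_def)
  qed
  have zero: "\<Psi> 0 = {}"
    using Psi_add[OF AD(1) AD(1)] by auto
  \<comment> \<open>\<open>A\<close> acts transitively on the sequences by addition, so their number
    divides \<open>card A\<close>, a power of 2.\<close>
  interpret W: set_action A "\<Psi> ` A" "\<lambda>n S. {i. (i \<in> \<Psi> n) \<noteq> (i \<in> S)}"
  proof
    show "{i. (i \<in> \<Psi> g) \<noteq> (i \<in> S)} \<in> \<Psi> ` A" if "g \<in> A" "S \<in> \<Psi> ` A" for g S
    proof -
      obtain m where "m \<in> A" "S = \<Psi> m" using \<open>S \<in> \<Psi> ` A\<close> by blast
      then show ?thesis using Psi_add[OF \<open>g \<in> A\<close>, of m] AD(2)[OF \<open>g \<in> A\<close>, of m] by auto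
    qed
  qed (use A(1,2) zero Psi_add in auto)
  have "{} \<in> \<Psi> ` A" using zero AD(1) by force
  from W.orbit_stabilizer[OF this] have "card (W.orb {}) dvd card A" by (rule dvdI)
  then have "card (\<Psi> ` A) dvd card A" unfolding W.orb_def by simp
  moreover obtain k where "card A = 2 ^ k" using card_elementary_abelian_two[OF A(1,2,4)] by blast
  ultimately obtain r where r: "card (\<Psi> ` A) = 2 ^ r" using divides_primepow_nat[of 2] by auto
  define f where "f S = {i. Suc i \<in> S}" for S
  have fpow: "(f ^^ k) S = {i. i + k \<in> S}" for k S
    by (induction k arbitrary: S) (auto simp: f_def funpow_swap1)
  have f_Psi: "f (\<Psi> n) = \<Psi> (\<tau> n)" for n
    by (auto simp: f_def \<Psi>_def funpow_swap1)
  have per: "i + 3 * q \<in> \<Psi> n \<longleftrightarrow> i \<in> \<Psi> n" if "n \<in> A" for i n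
  proof -
    have "(i + 3 * q \<in> \<Psi> n) = (i + q + q + q \<in> \<Psi> n)" by (simp add: numeral_3_eq_3 add.assoc)
    then show ?thesis using rec[OF that, of i] rec[OF that, of "i + q"] by argo
  qed
  have "3 ^ Suc b dvd card (\<Psi> ` A - {{}})"
  proof (rule prime_power_period[where f = f and b = "Suc b"])
    show "f S \<in> \<Psi> ` A - {{}}" if "S \<in> \<Psi> ` A - {{}}" for S
    proof -
      obtain n i where n: "n \<in> A" "S = \<Psi> n" "i \<in> \<Psi> n" using \<open>S \<in> \<Psi> ` A - {{}}\<close> by auto
      have "i + 3 * q \<in> S" using per[OF n(1)] n by simp
      then have "i + (3 * q - 1) \<in> f S" using q0 by (simp add: f_def)
      then show ?thesis using f_Psi[of n] \<tau>(1)[OF n(1)] n(2) by auto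
    qed
    show "(f ^^ (3 ^ Suc b)) S = S" if "S \<in> \<Psi> ` A - {{}}" for S
    proof -
      obtain n where "n \<in> A" "S = \<Psi> n" using \<open>S \<in> \<Psi> ` A - {{}}\<close> by auto
      then show ?thesis using per unfolding fpow by (simp add: q)
    qed
    \<comment> \<open>A sequence with period \<open>q\<close> satisfies
      \<open>s i = s i + s i\<close>, hence is 0.\<close>
    show "(f ^^ (3 ^ b)) S \<noteq> S" if "S \<in> \<Psi> ` A - {{}}" for S
    proof
      assume "(f ^^ (3 ^ b)) S = S"
      then have shift: "i + q \<in> S \<longleftrightarrow> i \<in> S" for i unfolding fpow q by auto
      obtain n where n: "n \<in> A" "S = \<Psi> n" using \<open>S \<in> \<Psi> ` A - {{}}\<close> by auto
      have "i \<notin> S" for i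
        using rec[OF n(1), of i] shift[of i] shift[of "i + q"] n(2) by auto
      then show False using \<open>S \<in> \<Psi> ` A - {{}}\<close> by auto
    qed
  qed (use A(1) in auto)
  moreover have "card (\<Psi> ` A - {{}}) = 2 ^ r - 1"
    using r \<open>{} \<in> \<Psi> ` A\<close> by simp
  ultimately have "2 * q dvd r" using order_of_two_mod_power_of_three q by simp
  moreover have "r \<noteq> 0"
  proof
    assume "r = 0"
    then have "card (\<Psi> ` A) = 1" using r by simp
    then obtain S where S: "\<Psi> ` A = {S}" by (rule card_1_singletonE)
    obtain n where n: "n \<in> A" "n \<notin> M" using M(3) by blast
    have "0 \<in> \<Psi> n" using n(2) by (simp add: \<Psi>_def)
    moreover have "\<Psi> n \<in> {S}" "{} \<in> {S}" using \<open>{} \<in> \<Psi> ` A\<close> imageI[OF n(1), of \<Psi>] unfolding S by simp_all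
    ultimately show False by simp
  qed
  ultimately have "2 * q \<le> r" by (simp add: dvd_imp_le)
  then have large: "2 ^ (2 * q) \<le> card (\<Psi> ` A)" using r by simp
  \<comment> \<open>The recurrence determines a sequence from its first \<open>2 * q\<close> terms;
    by \<open>large\<close> every initial segment occurs.\<close>
  define \<rho> where "\<rho> S = S \<inter> {..<2 * q}" for S
  have "inj_on \<rho> (\<Psi> ` A)"
  proof (rule inj_onI)
    fix S S' assume S: "S \<in> \<Psi> ` A" "S' \<in> \<Psi> ` A" and eq: "\<rho> S = \<rho> S'"
    then obtain n n' where n: "n \<in> A" "S = \<Psi> n" and n': "n' \<in> A" "S' = \<Psi> n'" by auto
    have "i \<in> S \<longleftrightarrow> i \<in> S'" for i
    proof (induction i rule: less_induct)
      case (less i)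
      show ?case
      proof (cases "i < 2 * q")
        case True
        then show ?thesis using eq by (auto simp: \<rho>_def)
      next
        case False
        then have "i = i - 2 * q + q + q" by simp
        then obtain j where j: "i = j + q + q" by blast
        then show ?thesis
          using rec[OF n(1), of j] rec[OF n'(1), of j] less[of j] less[of "j + q"] q0 n n' by simp
      qed
    qed
    then show "S = S'" by auto
  qed
  then have "card (Pow {..<2 * q}) \<le> card (\<rho> ` \<Psi> ` A)"
    using large by (simp add: card_image card_Pow)
  moreover have "\<rho> ` \<Psi> ` A \<subseteq> Pow {..<2 * q}" by (auto simp: \<rho>_def)
  ultimately have "\<rho> ` \<Psi> ` A = Pow {..<2 * q}" by (intro card_seteq) auto
  \<comment> \<open>Take the initial values 1 on the first \<open>q\<close> indices and 0 on the
    next \<open>q\<close>. By the recurrence the terms at \<open>i\<close> and \<open>i + q\<close>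
    are then never both 0.\<close>
  moreover have "{..<q} \<in> Pow {..<2 * q}" by auto
  ultimately obtain n where n: "n \<in> A" "\<rho> (\<Psi> n) = {..<q}" by (metis (no_types, lifting) imageE)
  have hit: "i \<in> \<Psi> n \<or> i + q \<in> \<Psi> n" for i
  proof (induction i rule: less_induct)
    case (less i)
    show ?case
    proof (cases "i < q")
      case True
      then have "i \<in> \<rho> (\<Psi> n)" using n(2) by simp
      then show ?thesis by (simp add: \<rho>_def)
    next
      case False
      then obtain j where "i = j + q" by (metis add.commute le_add_diff_inverse not_less)
      then show ?thesis using less[of j] rec[OF n(1), of j] q0 by auto
    qed
  qed
  \<comment> \<open>\<open>B\<close> is invariant under \<open>\<tau> ^^ q\<close>, so an iterate in
    \<open>B\<close> would make the terms at \<open>i\<close> and \<open>i + q\<close> both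
    0.\<close>
  have "(\<tau> ^^ i) n \<notin> B" for i
  proof
    assume i: "(\<tau> ^^ i) n \<in> B"
    then have "(\<tau> ^^ (i + q)) n \<in> B" using B(3)[OF i] by (simp add: add.commute[of i] funpow_add)
    then show False using hit[of i] i M(2) by (auto simp: \<Psi>_def)
  qed
  then show ?thesis using n(1) by blast
qed

section \<open>An abelian normal subgroup extended by a cyclic group\<close>

lemma conj_funpow: "((\<lambda>n. x + n - x) ^^ i) n = nmul i x + n - nmul i (x::'g::group_add)"
  by (induction i) (simp_all add: group_add_norm del: add_uminus_conv_diff)

lemma conj_add: "x + (a + b) - x = (x + a - x) + (x + b - (x::'g::group_add))"
  by (simp add: group_add_norm del: add_uminus_conv_diff)

context set_action
begin

lemma act_fixed_minus: "g \<in> P \<Longrightarrow> x \<in> X \<Longrightarrow> act g x = x \<Longrightarrow> act (- g) x = x"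
  using act_minus[of g x] by simp

text \<open>\<open>cover\<close> says that \<open>N\<close> and the powers of \<open>x\<close>
  together are transitive on \<open>X\<close>; \<open>card\<close> restricts the order of
  \<open>x\<close> to the primes 2 and 3.\<close>

lemma semiregular_element_of_cyclic_extension:
  assumes faithful: "\<And>g. g \<in> P \<Longrightarrow> (\<And>v. v \<in> X \<Longrightarrow> act g v = v) \<Longrightarrow> g = 0"
    and N: "normal_in N P" "N \<noteq> {0}" and comm: "\<And>m n. m \<in> N \<Longrightarrow> n \<in> N \<Longrightarrow> m + n = n + m"
    and invol: "\<And>n. n \<in> N \<Longrightarrow> n + n = 0"
    and x: "x \<in> P" and u0: "u0 \<in> X"
    and cover: "\<And>v. v \<in> X \<Longrightarrow> \<exists>j. \<exists>n\<in>N. v = act (- nmul j x + n) u0"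
    and card: "card P = 2 ^ a * 3 ^ b"
  shows "\<exists>p. \<exists>g\<in>P. prime p \<and> g \<noteq> 0 \<and> nmul p g = 0 \<and> (\<forall>v\<in>X. act g v \<noteq> v)"
proof (rule ccontr)
  assume "\<not> ?thesis"
  then have fp: "\<exists>v\<in>X. act g v = v" if "prime p" "g \<in> P" "g \<noteq> 0" "nmul p g = 0" for p g
    using that by blast
  note PD = add_subgroupD[OF sub] and ND = normal_inD[OF N(1)]
  note NS = add_subgroupD[OF ND(1)]
  have finN: "finite N" using ND(2) finP finite_subset by blast
  have NP: "n \<in> P" if "n \<in> N" for n using ND(2) that by blast
  have xP: "nmul j x \<in> P" "- nmul j x \<in> P" for j using nmul_closed[OF sub x] PD(3) by auto
  define \<tau> where "\<tau> n = x + n - x" for n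
  have tau_pow: "(\<tau> ^^ j) n = nmul j x + n - nmul j x" for j n
    unfolding \<tau>_def by (rule conj_funpow)
  have tauN: "(\<tau> ^^ j) n \<in> N" if "n \<in> N" for j n
    unfolding tau_pow using ND(3) xP that by blast
  have tau_add: "(\<tau> ^^ j) (m + n) = (\<tau> ^^ j) m + (\<tau> ^^ j) n" for j m n
    unfolding tau_pow by (rule conj_add)
  \<comment> \<open>As \<open>N\<close> is abelian, conjugating \<open>n\<close> back by
    \<open>- nmul j x + m\<close> gives \<open>(\<tau> ^^ j) n\<close>. So \<open>n\<close> fixes
    the image of \<open>u\<close> under that element iff \<open>(\<tau> ^^ j) n\<close> fixes
    \<open>u\<close>.\<close>
  have shift: "n + (- nmul j x + m) = (- nmul j x + m) + (\<tau> ^^ j) n" if "n \<in> N" "m \<in> N" for j m n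
  proof -
    have "(- nmul j x + m) + (\<tau> ^^ j) n = - nmul j x + ((\<tau> ^^ j) n + m)"
      using comm[OF that(2) tauN[OF that(1)]] by (simp add: add.assoc)
    then show ?thesis unfolding tau_pow by (simp add: group_add_norm del: add_uminus_conv_diff)
  qed
  \<comment> \<open>\<open>u\<close> can serve as a base point for the transitivity expressed by
    \<open>cover\<close>.\<close>
  define cov where "cov u \<longleftrightarrow> u \<in> X \<and> (\<forall>v\<in>X. \<exists>j. \<exists>n\<in>N. v = act (- nmul j x + n) u)" for u
  have cov0: "cov u0" using cover u0 by (simp add: cov_def)
  have fixI: "n = 0" if u: "cov u" and n: "n \<in> N" and f: "\<And>j. act ((\<tau> ^^ j) n) u = u" for u n
  proof (rule faithful[OF NP[OF n]])
    fix v assume "v \<in> X"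
    then obtain j m where m: "m \<in> N" "v = act (- nmul j x + m) u" using u by (auto simp: cov_def)
    have uX: "u \<in> X" using u by (simp add: cov_def)
    have k: "- nmul j x + m \<in> P" using PD(2)[OF xP(2) NP[OF m(1)]] .
    have "act n v = act (n + (- nmul j x + m)) u" using act_add[OF NP[OF n] k uX] m(2) by simp
    also have "\<dots> = act (- nmul j x + m) (act ((\<tau> ^^ j) n) u)"
      unfolding shift[OF n m(1)] by (rule act_add[OF k NP[OF tauN[OF n]] uX])
    finally show "act n v = v" using f m(2) by simp
  qed
  have fixD: "\<exists>j. act ((\<tau> ^^ j) n) u = u" if u: "cov u" and n: "n \<in> N" "n \<noteq> 0" for u n
  proof -
    have "nmul 2 n = 0" using invol[OF n(1)] by (simp add: numeral_2_eq_2)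
    then obtain v where v: "v \<in> X" "act n v = v" using fp[OF two_is_prime_nat NP[OF n(1)] n(2)] by blast
    then obtain j m where m: "m \<in> N" "v = act (- nmul j x + m) u" using u by (auto simp: cov_def)
    have uX: "u \<in> X" using u by (simp add: cov_def)
    have k: "- nmul j x + m \<in> P" using PD(2)[OF xP(2) NP[OF m(1)]] .
    have "act (- nmul j x + m) (act ((\<tau> ^^ j) n) u) = act (n + (- nmul j x + m)) u"
      unfolding shift[OF n(1) m(1)] by (rule act_add[OF k NP[OF tauN[OF n(1)]] uX, symmetric])
    also have "\<dots> = act (- nmul j x + m) u"
      using act_add[OF NP[OF n(1)] k uX] m(2) v(2) by simp
    finally have "act ((\<tau> ^^ j) n) u = u"
      using act_minus[OF k] act_closed[OF NP[OF tauN[OF n(1)]] uX] uX by metis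
    then show ?thesis by blast
  qed
  define K where "K = (4::nat) ^ a"
  have K2: "K = 2 ^ (2 * a)" by (simp add: K_def power_mult)
  have K3: "K mod 3 = 1" unfolding K_def using power_mod[of "4::nat" 3 a] by simp
  have "K * 3 ^ b = 2 ^ a * card P" unfolding K_def card by (simp flip: power_mult_distrib)
  then have Kb: "nmul (K * 3 ^ b) x = 0" using nmul_card[OF finP sub x] by (simp add: nmul_mult)
  \<comment> \<open>\<open>3 ^ c\<close> is the 3-part of the order of \<open>x\<close>.\<close>
  define c where "c = (LEAST c. nmul (K * 3 ^ c) x = 0)"
  have c: "nmul (K * 3 ^ c) x = 0" unfolding c_def by (rule LeastI[of _ b]) (rule Kb)
  have min: "nmul (K * 3 ^ d) x \<noteq> 0" if "d < c" for d
    using not_less_Least that unfolding c_def by blast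
  show False
  proof (cases c)
    case 0
    \<comment> \<open>Here \<open>x\<close> has 2-power order, so some nonzero \<open>n\<close>
      commutes with \<open>x\<close>. All its conjugates under \<open>x\<close> agree, and if one
      fixes the base point then \<open>n = 0\<close>.\<close>
    have "(\<tau> ^^ (2 ^ (2 * a))) n = n" for n using c 0 unfolding tau_pow K2 by simp
    then obtain n where n: "n \<in> N" "n \<noteq> 0" "\<tau> n = n"
      using involution_fixed_by_two_element[OF finN ND(1) N(2) invol, of \<tau> "2 * a"] tauN[of _ 1]
      by (auto simp: \<tau>_def)
    have const: "(\<tau> ^^ j) n = n" for j using n(3) by (induction j) auto
    then show False using fixD[OF cov0 n(1,2)] fixI[OF cov0 n(1)] n(2) by simp
  next
    case (Suc d)
    define q where "q = (3::nat) ^ d"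
    define y where "y = nmul (K * q) x"
    have y0: "y \<noteq> 0" using min[of d] Suc by (simp add: y_def q_def)
    have yP: "y \<in> P" "- y \<in> P" using xP PD(3) by (auto simp: y_def)
    have K3q: "3 * (K * q) = K * 3 ^ c" "3 * q * K = K * 3 ^ c" by (simp_all add: Suc q_def)
    have "nmul 3 y = 0" using c by (simp add: y_def K3q flip: nmul_mult)
    moreover have "prime (3::nat)" by simp
    ultimately obtain v where v: "v \<in> X" "act y v = v" using fp[of 3 y] yP(1) y0 by blast
    \<comment> \<open>The base point is moved within its \<open>N\<close>-orbit: \<open>y\<close>
      commutes with \<open>x\<close>, so along with \<open>v\<close> it fixes
      \<open>u = act m u0\<close>.\<close>
    obtain j m where m: "m \<in> N" "v = act (- nmul j x + m) u0" using cover[OF v(1)] by blast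
    define u where "u = act m u0"
    have uX: "u \<in> X" unfolding u_def by (rule act_closed[OF NP[OF m(1)] u0])
    have yx: "y + - nmul i x = - nmul i x + y" for i
      unfolding y_def by (rule commute_minus) (rule nmul_commute)
    have vu: "v = act (- nmul j x) u" unfolding m(2) u_def by (rule act_add[OF xP(2) NP[OF m(1)] u0])
    have "act (- nmul j x) (act y u) = act y (act (- nmul j x) u)"
      using act_add[OF xP(2) yP(1) uX, of j] act_add[OF yP(1) xP(2) uX, of j] yx[of j] by simp
    then have "act (- nmul j x) (act y u) = act (- nmul j x) u" using v(2) vu by simp
    then have yu: "act y u = u" using act_minus[OF xP(2)] act_closed[OF yP(1) uX] uX by metis
    have covu: "cov u"
      unfolding cov_def
    proof (intro conjI ballI uX)
      fix w assume "w \<in> X"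
      then obtain i n where n: "n \<in> N" "w = act (- nmul i x + n) u0" using cover by blast
      have "act (n - m) u = act n u0"
        unfolding u_def using act_add[of "n - m" m u0] NP NS(4) n(1) m(1) u0 by simp
      then have "w = act (- nmul i x + (n - m)) u"
        unfolding n(2) using act_add[OF xP(2) NP[OF n(1)] u0] act_add[OF xP(2) NP[OF NS(4)[OF n(1) m(1)]] uX]
        by simp
      then show "\<exists>i. \<exists>n\<in>N. w = act (- nmul i x + n) u" using NS(4)[OF n(1) m(1)] by blast
    qed
    define Y where "Y = \<tau> ^^ (K * q)"
    have Y: "Y n = y + n - y" for n unfolding Y_def tau_pow y_def ..
    have YN: "Y n \<in> N" if "n \<in> N" for n unfolding Y_def by (rule tauN[OF that])
    have Yadd: "Y (m + n) = Y m + Y n" for m n unfolding Y_def by (rule tau_add)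
    have Y3: "Y (Y (Y n)) = n" for n
    proof -
      have "Y (Y (Y n)) = (\<tau> ^^ (K * q + (K * q + K * q))) n" by (simp add: Y_def funpow_add)
      also have "K * q + (K * q + K * q) = K * 3 ^ c" using K3q(1) by linarith
      finally show ?thesis using c by (simp add: tau_pow)
    qed
    have tY: "\<tau> (Y n) = Y (\<tau> n)" for n unfolding Y_def by (simp add: funpow_swap1)
    have minus: "- n = n" if "n \<in> N" for n using invol[OF that] minus_unique by blast
    have swap: "(a + b) + (c + d) = (a + c) + (b + d)" if "a \<in> N" "b \<in> N" "c \<in> N" "d \<in> N" for a b c d
      using comm[OF that(2,3)] by (metis add.assoc)
    \<comment> \<open>The kernel of \<open>Y^2 + Y + 1\<close> on \<open>N\<close>; signs disappear
      because \<open>- n = n\<close>.\<close>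
    define A1 where "A1 = {n \<in> N. Y (Y n) = Y n + n}"
    have A1N: "A1 \<subseteq> N" by (auto simp: A1_def)
    have A1: "add_subgroup A1"
    proof -
      have "m + n \<in> A1" if "m \<in> A1" "n \<in> A1" for m n
        using that NS(2) swap[of "Y m" m "Y n" n] YN by (simp add: A1_def Yadd)
      moreover have "- n \<in> A1" if "n \<in> A1" for n
        using that minus[of n] by (simp add: A1_def)
      ultimately show ?thesis using NS(1) by (simp add: add_subgroup_def A1_def Y)
    qed
    have tauA1: "(\<tau> ^^ i) n \<in> A1" if "n \<in> A1" for i n
    proof -
      have "\<tau> n \<in> A1" if "n \<in> A1" for n
      proof -
        have "\<tau> (Y n + n) = \<tau> (Y n) + \<tau> n" using tau_add[of 1] by simp
        then show ?thesis using that tauN[of n 1] by (simp add: A1_def flip: tY)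
      qed
      then show ?thesis using that by (induction i) auto
    qed
    have "A1 \<noteq> {0}"
    proof
      assume triv: "A1 = {0}"
      \<comment> \<open>Since \<open>Y^3 = 1\<close>, the image of \<open>Y + 1\<close> lies in
        \<open>A1\<close>. If that is trivial, \<open>y\<close> centralises \<open>N\<close> and
        \<open>x\<close> and fixes \<open>u\<close>, so it fixes all of \<open>X\<close>.\<close>
      have central: "Y n = n" if n: "n \<in> N" for n
      proof -
        have "Y (Y (Y n + n)) = Y (Y n) + n"
          using comm[OF n YN[OF YN[OF n]]] by (simp add: Yadd Y3)
        moreover have "Y (Y n + n) + (Y n + n) = Y (Y n) + n"
          using invol[OF YN[OF n]] by (simp add: Yadd add.assoc) (simp add: add.assoc[symmetric])
        ultimately have "Y n + n \<in> A1" using NS(2)[OF YN[OF n] n] by (simp add: A1_def)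
        then have "Y n + n = 0" using triv by simp
        then show ?thesis using minus[OF n] by (metis eq_neg_iff_add_eq_0)
      qed
      have "y = 0"
      proof (rule faithful[OF yP(1)])
        fix w assume "w \<in> X"
        then obtain i n where n: "n \<in> N" "w = act (- nmul i x + n) u" using covu by (auto simp: cov_def)
        have k: "- nmul i x + n \<in> P" using PD(2)[OF xP(2) NP[OF n(1)]] .
        have "y + n = n + y" using central[OF n(1)] by (simp add: Y diff_eq_eq)
        then have "y + (- nmul i x + n) = (- nmul i x + n) + y" by (rule commute_add[OF yx])
        then show "act y w = w"
          using act_add[OF yP(1) k uX] act_add[OF k yP(1) uX] yu n(2) by simp
      qed
      then show False using y0 by simp
    qed
    \<comment> \<open>\<open>\<tau> ^^ (3 * q)\<close> has 2-power order, so it fixes a nonzero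
      element of \<open>A1\<close>.\<close>
    moreover have "((\<tau> ^^ (3 * q)) ^^ (2 ^ (2 * a))) n = n" for n
      using c unfolding funpow_mult K2[symmetric] K3q tau_pow by simp
    moreover have "(\<tau> ^^ (3 * q)) 0 = 0" by (simp add: tau_pow)
    ultimately obtain n2 where n2: "n2 \<in> A1" "n2 \<noteq> 0" "(\<tau> ^^ (3 * q)) n2 = n2"
      using involution_fixed_by_two_element[OF finite_subset[OF A1N finN] A1, of "\<tau> ^^ (3 * q)" "2 * a"]
        invol A1N tauA1 by blast
    define A where "A = {n \<in> A1. (\<tau> ^^ (3 * q)) n = n}"
    have AN: "A \<subseteq> N" using A1N by (auto simp: A_def)
    have finA: "finite A" using AN finN finite_subset by blast
    have A: "add_subgroup A"
    proof -
      note A1D = add_subgroupD[OF A1]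
      have "- n \<in> A" if "n \<in> A" for n using that minus[of n] AN by auto
      then show ?thesis using A1D(1,2) by (simp add: add_subgroup_def A_def tau_add) (simp add: tau_pow)
    qed
    have tauA: "\<tau> n \<in> A" if "n \<in> A" for n
      using that tauA1[of n 1] by (simp add: A_def) (metis funpow_swap1)
    \<comment> \<open>On \<open>A\<close> the map \<open>\<tau>\<close> has period
      \<open>3 * q\<close>, and \<open>K * q\<close> is \<open>q\<close> modulo
      \<open>3 * q\<close>. Thus \<open>Y = \<tau> ^^ q\<close> there, and the equation defining
      \<open>A1\<close> becomes the recurrence.\<close>
    have Yq: "Y n = (\<tau> ^^ q) n" "Y (Y n) = (\<tau> ^^ (2 * q)) n" if n: "n \<in> A" for n
    proof -
      have per: "(\<tau> ^^ (3 * q)) n = n" using n by (simp add: A_def)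
      have "(K * q) mod (3 * q) = q" using K3 by (simp add: mod_mult_mult2)
      then show "Y n = (\<tau> ^^ q) n" using funpow_mod_eq[OF per, of "K * q"] unfolding Y_def by argo
      have "(2 * K) mod 3 = 2" using K3 by presburger
      then have "(2 * K * q) mod (3 * q) = 2 * q" by (simp only: mod_mult_mult2)
      then show "Y (Y n) = (\<tau> ^^ (2 * q)) n"
        using funpow_mod_eq[OF per, of "2 * K * q"]
        unfolding Y_def by (simp only: mult_2 funpow_add distrib_right comp_apply)
    qed
    define B where "B = {n \<in> A. act n u = u}"
    have B: "add_subgroup B"
    proof -
      note AD = add_subgroupD[OF A]
      have "m + n \<in> B" if "m \<in> B" "n \<in> B" for m n
        using that AD(2) act_add[of m n u] NP AN uX by (auto simp: B_def)
      moreover have "- n \<in> B" if "n \<in> B" for n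
        using that AD(3) minus[of n] AN by (auto simp: B_def)
      ultimately show ?thesis using AD(1) act_zero[OF uX] by (simp add: add_subgroup_def B_def)
    qed
    have BA: "B \<subset> A"
    proof
      show "B \<subseteq> A" by (auto simp: B_def)
      show "B \<noteq> A"
      proof
        \<comment> \<open>Then every conjugate of \<open>n2\<close> under \<open>x\<close> fixes
          \<open>u\<close>, which forces \<open>n2 = 0\<close>.\<close>
        assume eq: "B = A"
        have "n2 \<in> A" using n2 by (simp add: A_def)
        have "(\<tau> ^^ i) n2 \<in> A" for i using \<open>n2 \<in> A\<close> tauA by (induction i) auto
        then have "act ((\<tau> ^^ i) n2) u = u" for i unfolding eq[symmetric] by (simp add: B_def)
        then show False using fixI[OF covu, of n2] n2(1,2) A1N by blast
      qed
    qed
    \<comment> \<open>On \<open>B\<close> the map \<open>\<tau> ^^ q\<close> is conjugation by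
      \<open>y\<close>, which fixes \<open>u\<close>.\<close>
    have Bq: "(\<tau> ^^ q) n \<in> B" if n: "n \<in> B" for n
    proof -
      have nA: "n \<in> A" "n \<in> P" using n AN NP by (auto simp: B_def)
      have "(\<tau> ^^ i) n \<in> A" for i using nA tauA by (induction i) auto
      moreover have "act (y + n - y) u = u"
      proof -
        have "act (y + (n + - y)) u = act y (act n (act (- y) u))"
          using act_add[OF yP(1) PD(2)[OF nA(2) yP(2)] uX] act_add[OF nA(2) yP(2) uX] by simp
        then show ?thesis using act_fixed_minus[OF yP(1) uX yu] yu n
          by (simp add: B_def group_add_norm del: add_uminus_conv_diff)
      qed
      ultimately show ?thesis using Yq(1)[OF nA(1)] by (simp add: B_def Y)
    qed
    have rel: "(\<tau> ^^ (2 * q)) n = (\<tau> ^^ q) n + n" if n: "n \<in> A" for n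
      using n Yq[OF n] by (simp add: A_def A1_def)
    have "m + n = n + m" "\<tau> (m + n) = \<tau> m + \<tau> n" "n + n = 0" if "m \<in> A" "n \<in> A" for m n
      using comm[of m n] tau_add[of 1 m n] invol[of n] AN that by auto
    then obtain n where n: "n \<in> A" "\<And>i. (\<tau> ^^ i) n \<notin> B"
      using avoid_proper_subgroup[OF finA A _ _ tauA _ q_def rel B BA Bq] by blast
    have "(\<tau> ^^ i) n \<in> A" for i using n(1) tauA by (induction i) auto
    then have "act ((\<tau> ^^ i) n) u \<noteq> u" for i using n(2)[of i] by (simp add: B_def)
    moreover have "n \<noteq> 0" using n(2)[of 0] add_subgroupD(1)[OF B] by auto
    ultimately show False using fixD[OF covu, of n] n(1) AN by blast
  qed
qed

end

section \<open>Arc-transitive actions of out-valence four\<close>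

locale arc_transitive_action = set_action H V act
  for H :: "'g::group_add set" and V :: "'v set" and act :: "'g \<Rightarrow> 'v \<Rightarrow> 'v" +
  fixes E :: "('v \<times> 'v) set"
  assumes finV: "finite V" and V_ne: "V \<noteq> {}" and E_sub: "E \<subseteq> V \<times> V"
    and faithful: "g \<in> H \<Longrightarrow> (\<And>v. v \<in> V \<Longrightarrow> act g v = v) \<Longrightarrow> g = 0"
    and E_inv: "g \<in> H \<Longrightarrow> (u, v) \<in> E \<Longrightarrow> (act g u, act g v) \<in> E"
    and arc_trans: "(u, v) \<in> E \<Longrightarrow> (x, y) \<in> E \<Longrightarrow> \<exists>g\<in>H. act g u = x \<and> act g v = y"
    and connected: "u \<in> V \<Longrightarrow> v \<in> V \<Longrightarrow> (u, v) \<in> (E \<union> E\<inverse>)\<^sup>*"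
    and valence: "v \<in> V \<Longrightarrow> card (E `` {v}) = 4"
begin

lemmas HD = add_subgroupD[OF sub]

lemma out_V: "w \<in> E `` {v} \<Longrightarrow> w \<in> V" using E_sub by auto

lemma out_act: "g \<in> H \<Longrightarrow> w \<in> E `` {v} \<Longrightarrow> act g w \<in> E `` {act g v}" using E_inv by auto

lemma out_ne: "v \<in> V \<Longrightarrow> E `` {v} \<noteq> {}" using valence by fastforce

lemma finite_out: "finite (E `` {v})" using finV out_V finite_subset by (metis subsetI)

lemma finite_out_filter: "finite {w \<in> E `` {v}. Q w}"
  by (rule finite_subset[OF _ finite_out[of v]]) auto

lemma vertex_transitive: "u \<in> V \<Longrightarrow> v \<in> V \<Longrightarrow> \<exists>g\<in>H. act g u = v"
  using out_ne arc_trans by blast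

lemma act_inj: "g \<in> H \<Longrightarrow> u \<in> V \<Longrightarrow> v \<in> V \<Longrightarrow> act g u = act g v \<longleftrightarrow> u = v"
  using act_minus by metis

lemma reachable_act: "(u, v) \<in> E\<^sup>* \<Longrightarrow> g \<in> H \<Longrightarrow> (act g u, act g v) \<in> E\<^sup>*"
  by (induction rule: rtrancl_induct) (auto intro: rtrancl_into_rtrancl E_inv)

text \<open>In a finite vertex-transitive digraph all sets of reachable vertices have the same size.\<close>

lemma reachable: 
  assumes "u \<in> V" "v \<in> V"
  shows "(u, v) \<in> E\<^sup>*"
proof -
  have R_sub: "E\<^sup>* `` {w} \<subseteq> V" if "w \<in> V" for w
  proof
    fix x assume "x \<in> E\<^sup>* `` {w}"
    then have "(w, x) \<in> E\<^sup>*" by simp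
    then show "x \<in> V" using that E_sub by (induction rule: rtrancl_induct) auto
  qed
  have R_card: "card (E\<^sup>* `` {w}) \<le> card (E\<^sup>* `` {x})" if w: "w \<in> V" and x: "x \<in> V" for w x
  proof -
    obtain g where g: "g \<in> H" "act g w = x" using vertex_transitive[OF w x] by blast
    have "inj_on (act g) (E\<^sup>* `` {w})" using act_inj[OF g(1)] R_sub[OF w] by (meson inj_onI subsetD)
    moreover have "act g ` (E\<^sup>* `` {w}) \<subseteq> E\<^sup>* `` {x}" using reachable_act g by auto
    ultimately show ?thesis using R_sub[OF x] finV by (intro card_inj_on_le[of "act g"]) (auto intro: finite_subset)
  qed
  have "(x, w) \<in> E\<^sup>*" if "(w, x) \<in> E" for w x
  proof -
    have wx: "w \<in> V" "x \<in> V" using that E_sub by auto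
    have "E\<^sup>* `` {x} \<subseteq> E\<^sup>* `` {w}" using that by (auto intro: converse_rtrancl_into_rtrancl)
    then have "E\<^sup>* `` {x} = E\<^sup>* `` {w}"
      using R_card[OF wx] R_sub[OF wx(1)] finV by (intro card_seteq) (auto intro: finite_subset)
    then show ?thesis by blast
  qed
  then have "(E \<union> E\<inverse>)\<^sup>* \<subseteq> (E\<^sup>*)\<^sup>*" by (intro rtrancl_mono) auto
  then show ?thesis using connected[OF assms] by auto
qed

section \<open>The local action at a vertex\<close>

text \<open>Being fixed passes to out-neighbours, hence along directed paths, and these reach every
  vertex.\<close>

lemma fixed_if_locally_fixed:
  assumes g: "g \<in> H" and v: "v \<in> V" "act g v = v"
    and local: "\<And>u w. u \<in> V \<Longrightarrow> act g u = u \<Longrightarrow> w \<in> E `` {u} \<Longrightarrow> act g w = w"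
  shows "g = 0"
proof (rule faithful[OF g])
  fix w assume "w \<in> V"
  have "(v, w) \<in> E\<^sup>*" using reachable[OF v(1) \<open>w \<in> V\<close>] .
  then have "act g w = w \<and> w \<in> V"
    using v local E_sub by (induction rule: rtrancl_induct) auto
  then show "act g w = w" by simp
qed

lemma act_nmul: "g \<in> H \<Longrightarrow> v \<in> V \<Longrightarrow> act (nmul n g) v = (act g ^^ n) v"
  by (induction n) (auto simp: act_zero act_add nmul_closed[OF sub])

text \<open>\<open>g\<close> permutes these out-neighbours in cycles of length \<open>p\<close>:
  this is \<open>prime_power_period\<close> with \<open>b = 1\<close> and
  \<open>c = 0\<close>.\<close>

lemma moved_out_neighbours:
  assumes "prime p" "g \<in> H" "nmul p g = 0" "u \<in> V" "act g u = u"
  shows "p dvd card {w \<in> E `` {u}. act g w \<noteq> w}"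
proof -
  have "p ^ Suc 0 dvd card {w \<in> E `` {u}. act g w \<noteq> w}"
  proof (rule prime_power_period[where f = "act g" and b = 1])
    show "act g w \<in> {w \<in> E `` {u}. act g w \<noteq> w}" if "w \<in> {w \<in> E `` {u}. act g w \<noteq> w}" for w
      using that out_act[OF assms(2), of w u] assms(5) out_V act_inj[OF assms(2)] act_closed[OF assms(2)] by auto
    show "(act g ^^ p ^ 1) w = w" if "w \<in> {w \<in> E `` {u}. act g w \<noteq> w}" for w
    proof -
      have "w \<in> V" using that out_V by auto
      then show ?thesis using act_nmul[OF assms(2), of w p] assms(3) act_zero by simp
    qed
  qed (use assms(1) finite_out_filter in auto)
  then show ?thesis by simp
qed

text \<open>\<open>g\<close> acts on the four out-neighbours of \<open>v\<close> as a 3-cycle with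
  one fixed point \<open>w0\<close>. A conjugate of \<open>n\<close> fixes \<open>v\<close> and
  moves \<open>w0\<close>; conjugating that element by powers of \<open>g\<close> takes
  \<open>w0\<close> to every point of the 3-cycle.\<close>

lemma normal_locally_transitive:
  assumes N: "normal_in N H" and n: "n \<in> N" "n \<noteq> 0" "u \<in> V" "act n u = u"
    and g: "g \<in> H" "nmul 3 g = 0" and v: "v \<in> V" "act g v = v" and w1: "w1 \<in> E `` {v}" "act g w1 \<noteq> w1"
    and w: "w \<in> E `` {v}" and w': "w' \<in> E `` {v}"
  shows "\<exists>m\<in>N. act m v = v \<and> act m w = w'"
proof -
  note ND = normal_inD[OF N]
  note NS = add_subgroupD[OF ND(1)]
  have NH: "m \<in> H" if "m \<in> N" for m using ND(2) that by blast
  \<comment> \<open>The nonzero \<open>n\<close> fixes \<open>u\<close> but not every vertex, so it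
    fixes some \<open>u'\<close> and moves an out-neighbour \<open>x\<close> of it. Arc-transitivity
    carries this arc to any arc leaving \<open>v\<close>.\<close>
  obtain u' x where x: "u' \<in> V" "act n u' = u'" "x \<in> E `` {u'}" "act n x \<noteq> x"
    using fixed_if_locally_fixed[OF NH[OF n(1)] n(3,4)] n(2) by blast
  have conj_act: "act (h + m - h) (act h a) = act h (act m a)" if "h \<in> H" "m \<in> N" "a \<in> V" for h m a
  proof -
    have "act (h + m - h) (act h a) = act (h + m - h + h) a"
      using that HD NH act_add[of "h + m - h" h a] by simp
    then show ?thesis using that NH act_add[of h m a] by simp
  qed
  have moved: "\<exists>m\<in>N. act m v = v \<and> act m y \<noteq> y" if y: "y \<in> E `` {v}" for y
  proof -
    obtain h where h: "h \<in> H" "act h u' = v" "act h x = y" using arc_trans[of u' x v y] x(3) y by auto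
    have "act (h + n - h) v = v" using conj_act[OF h(1) n(1) x(1)] h x(2) by simp
    moreover have "act (h + n - h) y \<noteq> y"
      using conj_act[OF h(1) n(1) out_V[OF x(3)]] h x(4) act_inj[OF h(1)] out_V[OF x(3)] act_closed[OF NH[OF n(1)]]
      by auto
    ultimately show ?thesis using ND(3)[OF h(1) n(1)] by blast
  qed
  define X where "X = {w \<in> E `` {v}. act g w \<noteq> w}"
  have finX: "finite X" "X \<subseteq> E `` {v}" unfolding X_def by (rule finite_out_filter) auto
  have "3 dvd card X" unfolding X_def by (rule moved_out_neighbours) (use g v in auto)
  moreover have "card X \<noteq> 0" using finX w1 by (auto simp: X_def)
  moreover have "card X \<le> 4" using card_mono[OF finite_out finX(2)] valence[OF v(1)] by simp
  ultimately have X3: "card X = 3" by auto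
  then have "card (E `` {v} - X) = 1" using finX valence[OF v(1)] by (simp add: card_Diff_subset)
  then obtain w0 where w0: "E `` {v} - X = {w0}" by (rule card_1_singletonE)
  then have w0': "w0 \<in> E `` {v}" "act g w0 = w0" by (auto simp: X_def)
  obtain m where m: "m \<in> N" "act m v = v" "act m w0 \<noteq> w0" using moved[OF w0'(1)] by blast
  define a where "a = act m w0"
  have aX: "a \<in> X" using out_act[OF NH[OF m(1)] w0'(1)] m w0 by (auto simp: a_def)
  have gX: "act g b \<in> X" if "b \<in> X" for b
    using that out_act[OF g(1), of b v] v out_V act_inj[OF g(1)] act_closed[OF g(1)] by (auto simp: X_def)
  have aV: "a \<in> V" using aX out_V by (auto simp: X_def)
  have g3: "act g (act g (act g b)) = b" if "b \<in> V" for b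
    using act_nmul[OF g(1) that, of 3] g(2) act_zero[OF that] by (simp add: numeral_3_eq_3)
  have "X = {a, act g a, act g (act g a)}"
  proof (rule card_seteq[symmetric])
    have "act g a \<noteq> a" "act g (act g a) \<noteq> act g a" using aX gX[OF aX] by (auto simp: X_def)
    moreover have "act g (act g a) \<noteq> a" using g3[OF aV] \<open>act g a \<noteq> a\<close> by metis
    ultimately show "card X \<le> card {a, act g a, act g (act g a)}" using X3 by auto
  qed (use finX aX gX in auto)
  then have out: "E `` {v} = {w0, a, act g a, act g (act g a)}" using w0 finX by auto
  have reach0: "\<exists>k\<in>N. act k v = v \<and> act k w0 = y" if "y \<in> E `` {v}" for y
  proof -
    have conj: "\<exists>k\<in>N. act k v = v \<and> act k w0 = act g b" if b: "\<exists>k\<in>N. act k v = v \<and> act k w0 = b" for b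
    proof -
      obtain k where k: "k \<in> N" "act k v = v" "act k w0 = b" using b by blast
      have "act (g + k - g) v = v" "act (g + k - g) w0 = act g b"
        using conj_act[OF g(1) k(1) v(1)] conj_act[OF g(1) k(1) out_V[OF w0'(1)]] k v w0' by auto
      then show ?thesis using ND(3)[OF g(1) k(1)] by blast
    qed
    have "\<exists>k\<in>N. act k v = v \<and> act k w0 = a" using m a_def by blast
    moreover have "\<exists>k\<in>N. act k v = v \<and> act k w0 = w0"
      using NS(1) act_zero v(1) out_V[OF w0'(1)] by blast
    ultimately show ?thesis using that conj unfolding out by blast
  qed
  obtain k where k: "k \<in> N" "act k v = v" "act k w0 = w" using reach0[OF w] by blast
  obtain k' where k': "k' \<in> N" "act k' v = v" "act k' w0 = w'" using reach0[OF w'] by blast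
  have "- k \<in> N" using NS(3)[OF k(1)] .
  then have "act (k' + - k) v = v" "act (k' + - k) w = w'"
    using act_add[OF NH[OF k'(1)] NH, of "- k"] k k' v(1) out_V[OF w] out_V[OF w0'(1)]
      act_minus[OF NH[OF k(1)], of v] act_minus[OF NH[OF k(1)], of w0] by simp_all
  then show ?thesis using NS(2)[OF k'(1) \<open>- k \<in> N\<close>] by blast
qed

theorem semiregular_element_exists:
  "\<exists>p. \<exists>g\<in>H. prime p \<and> g \<noteq> 0 \<and> nmul p g = 0 \<and> (\<forall>v\<in>V. act g v \<noteq> v)"
proof (rule ccontr)
  assume contra: "\<not> ?thesis"
  then have fp: "\<exists>v\<in>V. act g v = v" if "prime p" "g \<in> H" "g \<noteq> 0" "nmul p g = 0" for p g
    using that by blast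
  have three: "prime (3::nat)" by simp
  have small: "p = 2 \<or> p = 3" if p: "prime p" "p dvd card H" for p
  proof (rule ccontr)
    assume "\<not> ?thesis"
    then have "p > 3" using prime_ge_2_nat[OF p(1)] by auto
    moreover have "p \<noteq> 4"
    proof
      assume "p = 4"
      then have "(2::nat) dvd p" by simp
      then show False using primes_dvd_imp_eq[OF two_is_prime_nat p(1)] \<open>p = 4\<close> by simp
    qed
    ultimately have p5: "p > 4" by simp
    obtain g where g: "g \<in> H" "g \<noteq> 0" "nmul p g = 0" using cauchy_add[OF finP sub p] by blast
    obtain v where v: "v \<in> V" "act g v = v" using fp[OF p(1) g] by blast
    have "act g w = w" if u: "u \<in> V" "act g u = u" and w: "w \<in> E `` {u}" for u w
    proof (rule ccontr)
      let ?X = "{w \<in> E `` {u}. act g w \<noteq> w}"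
      assume "act g w \<noteq> w"
      then have "card ?X \<noteq> 0" using w finite_out_filter[of u] by auto
      then have "p \<le> card ?X" using moved_out_neighbours[OF p(1) g(1,3) u] by (intro dvd_imp_le) auto
      moreover have "card ?X \<le> 4" using valence[OF u(1)] card_mono[OF finite_out, of ?X u] by auto
      ultimately show False using p5 by simp
    qed
    then show False using fixed_if_locally_fixed[OF g(1) v] g(2) by blast
  qed
  obtain a b where ab: "card H = 2 ^ a * 3 ^ b"
    using two_prime_factors[OF card_subgroup_pos[OF finP sub] small] by blast
  have "H \<noteq> {0}"
  proof
    assume triv: "H = {0}"
    obtain v where v: "v \<in> V" using V_ne by blast
    have "w = v" if "w \<in> V" for w using vertex_transitive[OF v that] triv act_zero[OF v] by auto
    then have "E `` {v} \<subseteq> {v}" using out_V by blast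
    then have "card (E `` {v}) \<le> 1" using card_mono[of "{v}" "E `` {v}"] by simp
    then show False using valence[OF v] by simp
  qed
  obtain g v0 w1 where g: "g \<in> H" "nmul 3 g = 0" and v0: "v0 \<in> V" "act g v0 = v0"
    and w1: "w1 \<in> E `` {v0}" "act g w1 \<noteq> w1"
  proof (rule ccontr)
    assume no: "\<not> thesis"
    have "\<not> 3 dvd card H"
    proof
      assume "3 dvd card H"
      then obtain g where g: "g \<in> H" "g \<noteq> 0" "nmul 3 g = 0" using cauchy_add[OF finP sub three] by blast
      obtain v where v: "v \<in> V" "act g v = v" using fp[OF three g] by blast
      then show False using fixed_if_locally_fixed[OF g(1) v] g that no by blast
    qed
    then have "card H = 2 ^ a" using ab by (cases b) auto
    then obtain z where z: "z \<in> H" "z \<noteq> 0" "nmul 2 z = 0" "\<And>g. g \<in> H \<Longrightarrow> g + z = z + g"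
      using prime_power_central_element[OF sub finP two_is_prime_nat _ \<open>H \<noteq> {0}\<close>] by blast
    obtain v where v: "v \<in> V" "act z v = v" using fp[OF two_is_prime_nat z(1-3)] by blast
    have "z = 0"
    proof (rule faithful[OF z(1)])
      fix u assume "u \<in> V"
      then obtain h where h: "h \<in> H" "act h v = u" using vertex_transitive[OF v(1)] by blast
      then show "act z u = u" using act_add[OF z(1) h(1) v(1)] act_add[OF h(1) z(1) v(1)] z(4)[OF h(1)] v(2) by simp
    qed
    then show False using z(2) by simp
  qed
  obtain p N where p: "p = 2 \<or> p = 3" and N: "normal_in N H" "N \<noteq> {0}"
    and comm: "\<And>x y. x \<in> N \<Longrightarrow> y \<in> N \<Longrightarrow> x + y = y + x" and exp: "\<And>x. x \<in> N \<Longrightarrow> nmul p x = 0"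
    using normal_elementary_abelian_exists[OF finP sub \<open>H \<noteq> {0}\<close> three ab] by blast
  note ND = normal_inD[OF N(1)]
  note NS = add_subgroupD[OF ND(1)]
  have finN: "finite N" using ND(2) finP finite_subset by blast
  have NH: "m \<in> H" if "m \<in> N" for m using ND(2) that by blast
  obtain n where n: "n \<in> N" "n \<noteq> 0" using N(2) NS(1) by blast
  have "prime p" using p three by auto
  then obtain u where u: "u \<in> V" "act n u = u" using fp[OF _ NH[OF n(1)] n(2) exp[OF n(1)]] by blast
  have local: "\<exists>m\<in>N. act m v0 = v0 \<and> act m w = w'" if "w \<in> E `` {v0}" "w' \<in> E `` {v0}" for w w'
    by (rule normal_locally_transitive[OF N(1) n u g v0 w1 that])
  \<comment> \<open>For \<open>p = 3\<close> the stabiliser \<open>N0\<close> of \<open>v0\<close>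
    in \<open>N\<close> would be transitive on four points, hence of even order, against exponent
    3.\<close>
  have p2: "p = 2"
  proof (rule ccontr)
    assume "p \<noteq> 2"
    then have p3: "p = 3" using p by simp
    define N0 where "N0 = {m \<in> N. act m v0 = v0}"
    interpret A: set_action N V act
      using act_closed act_zero act_add NH ND(1) finN by unfold_locales auto
    have N0: "add_subgroup N0" using A.stab_subgroup[OF v0(1)] by (simp add: N0_def A.stab_def)
    have finN0: "finite N0" using finN by (simp add: N0_def)
    have N0H: "m \<in> H" if "m \<in> N0" for m using that NH by (simp add: N0_def)
    interpret B: set_action N0 "E `` {v0}" act
    proof
      show "act m w \<in> E `` {v0}" if "m \<in> N0" "w \<in> E `` {v0}" for m w
        using out_act[OF N0H[OF that(1)] that(2)] that(1) by (simp add: N0_def)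
      show "act 0 w = w" if "w \<in> E `` {v0}" for w using act_zero[OF out_V[OF that]] .
      show "act (m + k) w = act m (act k w)" if "m \<in> N0" "k \<in> N0" "w \<in> E `` {v0}" for m k w
        using act_add[OF N0H[OF that(1)] N0H[OF that(2)] out_V[OF that(3)]] .
    qed (fact N0 finN0)+
    have "B.orb w1 = E `` {v0}"
    proof
      show "B.orb w1 \<subseteq> E `` {v0}" using B.act_closed w1(1) by (auto simp: B.orb_def)
      show "E `` {v0} \<subseteq> B.orb w1"
      proof
        fix w assume "w \<in> E `` {v0}"
        then obtain m where "m \<in> N" "act m v0 = v0" "act m w1 = w" using local[OF w1(1)] by blast
        then show "w \<in> B.orb w1" unfolding B.orb_def by (auto simp: N0_def)
      qed
    qed
    then have "card N0 = 4 * card (B.stab w1)" using B.orbit_stabilizer[OF w1(1)] valence[OF v0(1)] by simp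
    then have "2 dvd card N0" by simp
    then obtain x where x: "x \<in> N0" "x \<noteq> 0" "nmul 2 x = 0"
      using cauchy_add[OF finN0 N0 two_is_prime_nat] by blast
    moreover have "nmul 3 x = 0" using exp[of x] x(1) p3 by (simp add: N0_def)
    ultimately show False using nmul_gcd[of 2 x 3] by (simp add: gcd_non_0_nat)
  qed
  have invol: "m + m = 0" if "m \<in> N" for m using exp[OF that] p2 by (simp add: numeral_2_eq_2)
  obtain x where x: "x \<in> H" "act x v0 = w1" using vertex_transitive[OF v0(1) out_V[OF w1(1)]] by blast
  have xH: "nmul i x \<in> H" for i using nmul_closed[OF sub x(1)] .
  \<comment> \<open>Induction along a directed path. Each out-neighbour of \<open>v0\<close> is
    \<open>act (l + x) v0\<close> with \<open>l\<close> in \<open>N\<close>; by normality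
    \<open>m + l\<close> moves to the right of \<open>x\<close>, which raises the multiple of
    \<open>x\<close> by 1.\<close>
  have pos: "\<exists>i. \<exists>m\<in>N. v = act (nmul i x + m) v0" if v: "v \<in> V" for v
    using reachable[OF v0(1) v]
  proof (induction rule: rtrancl_induct)
    case base
    show ?case using NS(1) act_zero[OF v0(1)] by (intro exI[of _ 0] bexI[of _ 0]) simp_all
  next
    case (step u w)
    then obtain i m where m: "m \<in> N" "u = act (nmul i x + m) v0" by blast
    let ?k = "nmul i x + m"
    have k: "?k \<in> H" "- ?k \<in> H" using HD xH NH[OF m(1)] by auto
    have wV: "w \<in> V" using step.hyps(2) E_sub by auto
    have "act (- ?k) w \<in> E `` {v0}"
      using out_act[OF k(2), of w u] step.hyps(2) m(2) act_minus[OF k(1) v0(1)] by simp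
    then obtain l where l: "l \<in> N" "act l w1 = act (- ?k) w" using local[OF w1(1)] by blast
    have "w = act ?k (act (- ?k) w)" using act_minus[OF k(2) wV] by simp
    also have "\<dots> = act (?k + (l + x)) v0"
      using l(2) x act_add[OF k(1) HD(2)[OF NH[OF l(1)] x(1)] v0(1)] act_add[OF NH[OF l(1)] x(1) v0(1)] by simp
    also have "?k + (l + x) = nmul i x + x + (- x + (m + l) - - x)"
      by (simp add: group_add_norm del: add_uminus_conv_diff)
    also have "nmul i x + x = nmul (Suc i) x" using nmul_commute[of i x 1] by simp
    finally show ?case using ND(3)[OF HD(3)[OF x(1)] NS(2)[OF m(1) l(1)]] by blast
  qed
  \<comment> \<open>The form with \<open>- nmul j x\<close> results from
    \<open>j = i * (card H - 1)\<close>, which is \<open>- i\<close> modulo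
    \<open>card H\<close>.\<close>
  have cover: "\<exists>j. \<exists>m\<in>N. v = act (- nmul j x + m) v0" if v: "v \<in> V" for v
  proof -
    obtain i m where m: "m \<in> N" "v = act (nmul i x + m) v0" using pos[OF v] by blast
    have "card H > 0" using card_subgroup_pos[OF finP sub] .
    then have "i * (card H - 1) + i = i * card H" by (cases "card H") auto
    then have "nmul (i * (card H - 1)) x + nmul i x = nmul i (nmul (card H) x)"
      by (metis nmul_add nmul_mult)
    then have "nmul (i * (card H - 1)) x + nmul i x = 0" using nmul_card[OF finP sub x(1)] by simp
    then have "nmul i x = - nmul (i * (card H - 1)) x" by (metis minus_unique)
    then show ?thesis using m by metis
  qed
  show False
    using semiregular_element_of_cyclic_extension[OF faithful N comm invol x(1) v0(1) cover ab] contra by blast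
qed

end

section \<open>Digraph automorphisms\<close>

text \<open>Permutations under composition become an instance of \<open>group_add\<close>, so that
  automorphism groups are additive subgroups in the sense of \<open>add_subgroup\<close>.\<close>

typedef 'a bijection = "{f :: 'a \<Rightarrow> 'a. bij f}"
  morphisms apply_bijection Bijection
  by (rule exI[of _ id]) simp

setup_lifting type_definition_bijection

instantiation bijection :: (type) group_add
begin

lift_definition zero_bijection :: "'a bijection" is id by simp
lift_definition plus_bijection :: "'a bijection \<Rightarrow> 'a bijection \<Rightarrow> 'a bijection" is "\<lambda>f g. f \<circ> g"
  by (rule bij_comp)
lift_definition uminus_bijection :: "'a bijection \<Rightarrow> 'a bijection" is "inv_into UNIV"
  by (rule bij_imp_bij_inv)
lift_definition minus_bijection :: "'a bijection \<Rightarrow> 'a bijection \<Rightarrow> 'a bijection" is "\<lambda>f g. f \<circ> inv_into UNIV g"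
  by (intro bij_comp bij_imp_bij_inv)

instance
  by standard (transfer; simp add: o_assoc bij_is_inj)+

end

lemma apply_bijection_simps [simp]:
  "apply_bijection 0 v = v" "apply_bijection (g + h) v = apply_bijection g (apply_bijection h v)"
  by (transfer; simp)+

lemma apply_bijection_uminus [simp]:
  "apply_bijection (- g) (apply_bijection g v) = v" "apply_bijection g (apply_bijection (- g) v) = v"
  by (simp_all flip: apply_bijection_simps(2))

text \<open>Automorphisms are extended by the identity outside the vertex set, because
  \<open>bijection\<close> contains total permutations only; \<open>restrict\<close> leads back to
  \<open>digraph_automorphisms\<close>.\<close>

definition automorphism_bijections :: "'a pair_pre_digraph \<Rightarrow> 'a bijection set" where
  "automorphism_bijections G = {h. (\<forall>v. v \<notin> pverts G \<longrightarrow> apply_bijection h v = v) \<and>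
     (\<forall>u\<in>pverts G. \<forall>v\<in>pverts G. (apply_bijection h u, apply_bijection h v) \<in> parcs G \<longleftrightarrow> (u, v) \<in> parcs G)}"

lemma fixes_outside_closed:
  assumes "\<And>v. v \<notin> V \<Longrightarrow> apply_bijection h v = v" "v \<in> V"
  shows "apply_bijection h v \<in> V"
  using assms by (metis apply_bijection_uminus(1))

lemma automorphism_bijections_closed:
  "h \<in> automorphism_bijections G \<Longrightarrow> v \<in> pverts G \<Longrightarrow> apply_bijection h v \<in> pverts G"
  by (rule fixes_outside_closed) (auto simp: automorphism_bijections_def)

lemma automorphism_bijections_subgroup: "add_subgroup (automorphism_bijections G)"
proof -
  have "- h \<in> automorphism_bijections G" if h: "h \<in> automorphism_bijections G" for h
  proof -
    have out: "apply_bijection (- h) v = v" if "v \<notin> pverts G" for v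
      using h that apply_bijection_uminus(1)[of h v] by (simp add: automorphism_bijections_def)
    have "(apply_bijection (- h) u, apply_bijection (- h) v) \<in> parcs G \<longleftrightarrow> (u, v) \<in> parcs G"
      if uv: "u \<in> pverts G" "v \<in> pverts G" for u v
    proof -
      have "apply_bijection (- h) u \<in> pverts G" "apply_bijection (- h) v \<in> pverts G"
        using fixes_outside_closed[OF out] uv by blast+
      then have "(apply_bijection h (apply_bijection (- h) u), apply_bijection h (apply_bijection (- h) v)) \<in> parcs G
          \<longleftrightarrow> (apply_bijection (- h) u, apply_bijection (- h) v) \<in> parcs G"
        using h unfolding automorphism_bijections_def by blast
      then show ?thesis by simp
    qed
    then show ?thesis using out by (simp add: automorphism_bijections_def)
  qed
  moreover have "g + h \<in> automorphism_bijections G"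
    if "g \<in> automorphism_bijections G" "h \<in> automorphism_bijections G" for g h
    using that automorphism_bijections_closed[OF that(2)] by (simp add: automorphism_bijections_def)
  ultimately show ?thesis by (simp add: add_subgroup_def) (simp add: automorphism_bijections_def)
qed

lemma automorphism_bijections_eqI:
  assumes "g \<in> automorphism_bijections G" "h \<in> automorphism_bijections G"
    "\<And>v. v \<in> pverts G \<Longrightarrow> apply_bijection g v = apply_bijection h v"
  shows "g = h"
proof -
  have "apply_bijection g v = apply_bijection h v" for v
    using assms by (cases "v \<in> pverts G") (auto simp: automorphism_bijections_def)
  then show ?thesis by (metis apply_bijection_inject ext)
qed

lemma automorphism_bijections_finite:
  assumes "finite (pverts G)"
  shows "finite (automorphism_bijections G)"
proof (rule inj_on_finite)
  let ?r = "\<lambda>h. restrict (apply_bijection h) (pverts G)"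
  show "inj_on ?r (automorphism_bijections G)"
    by (rule inj_onI, rule automorphism_bijections_eqI) (auto dest: fun_cong simp: restrict_def split: if_splits)
  show "?r ` automorphism_bijections G \<subseteq> pverts G \<rightarrow>\<^sub>E pverts G"
    using automorphism_bijections_closed by auto
  show "finite (pverts G \<rightarrow>\<^sub>E pverts G)" using assms by (intro finite_PiE) auto
qed

lemma restrict_bijection_Bij:
  assumes "\<And>v. v \<in> V \<Longrightarrow> apply_bijection h v \<in> V" "\<And>v. v \<in> V \<Longrightarrow> apply_bijection (- h) v \<in> V"
  shows "restrict (apply_bijection h) V \<in> Bij V"
proof -
  have "bij_betw (restrict (apply_bijection h) V) V V"
    by (rule bij_betw_byWitness[where f' = "apply_bijection (- h)"]) (use assms in auto)
  then show ?thesis by (simp add: Bij_def)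
qed

lemma restrict_automorphism:
  assumes "h \<in> automorphism_bijections G"
  shows "restrict (apply_bijection h) (pverts G) \<in> digraph_automorphisms G"
proof -
  have minus: "- h \<in> automorphism_bijections G"
    using assms automorphism_bijections_subgroup add_subgroupD(3) by blast
  have "restrict (apply_bijection h) (pverts G) \<in> Bij (pverts G)"
    by (rule restrict_bijection_Bij[OF automorphism_bijections_closed[OF assms] automorphism_bijections_closed[OF minus]])
  then show ?thesis using assms by (simp add: digraph_automorphisms_def automorphism_bijections_def BijGroup_def)
qed

lemma automorphism_extends:
  assumes "p \<in> digraph_automorphisms G"
  obtains h where "h \<in> automorphism_bijections G" "\<And>v. v \<in> pverts G \<Longrightarrow> apply_bijection h v = p v"
proof -
  let ?f = "\<lambda>v. if v \<in> pverts G then p v else v"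
  have "bij_betw p (pverts G) (pverts G)"
    using assms by (simp add: digraph_automorphisms_def BijGroup_def Bij_def)
  then have "bij_betw ?f (pverts G \<union> - pverts G) (pverts G \<union> - pverts G)"
    by (intro bij_betw_combine) (auto simp: bij_betw_def inj_on_def)
  then have "bij ?f" by simp
  then have "apply_bijection (Bijection ?f) = ?f" by (intro Bijection_inverse) simp
  then show thesis
    using assms by (intro that[of "Bijection ?f"]) (auto simp: automorphism_bijections_def digraph_automorphisms_def)
qed

lemma restrict_plus:
  assumes "g \<in> automorphism_bijections G" "h \<in> automorphism_bijections G"
  shows "restrict (apply_bijection g) (pverts G) \<otimes>\<^bsub>BijGroup (pverts G)\<^esub> restrict (apply_bijection h) (pverts G)
    = restrict (apply_bijection (g + h)) (pverts G)"
  using restrict_automorphism[OF assms(1)] restrict_automorphism[OF assms(2)] automorphism_bijections_closed[OF assms(2)]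
  by (auto simp: digraph_automorphisms_def BijGroup_def compose_def restrict_def fun_eq_iff)

text \<open>The generated group consists of the restrictions of multiples of \<open>g\<close>. If
  \<open>r\<close> does not divide \<open>i\<close>, some multiple of \<open>nmul i g\<close> is
  \<open>g\<close> by Bezout, so a fixed point of \<open>nmul i g\<close> would be one of
  \<open>g\<close>.\<close>

lemma semiregular_restrict:
  assumes g: "g \<in> automorphism_bijections G" and r: "prime r" "nmul r g = 0"
    and free: "\<And>v. v \<in> pverts G \<Longrightarrow> apply_bijection g v \<noteq> v"
  shows "semiregular (pverts G) (restrict (apply_bijection g) (pverts G))"
proof -
  let ?V = "pverts G" and ?\<rho> = "\<lambda>h. restrict (apply_bijection h) (pverts G)"
  interpret B: group "BijGroup ?V" by (rule group_BijGroup)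
  have mem: "nmul i g \<in> automorphism_bijections G" for i
    by (rule nmul_closed[OF automorphism_bijections_subgroup g])
  have carrier: "?\<rho> h \<in> carrier (BijGroup ?V)" if "h \<in> automorphism_bijections G" for h
    using restrict_automorphism[OF that] by (simp add: digraph_automorphisms_def)
  have rho_zero: "?\<rho> 0 = \<one>\<^bsub>BijGroup ?V\<^esub>" by (auto simp: BijGroup_def restrict_def fun_eq_iff)
  have "\<exists>i. h = ?\<rho> (nmul i g)" if "h \<in> generate (BijGroup ?V) {?\<rho> g}" for h
    using that
  proof (induction rule: generate.induct)
    case one
    show ?case by (rule exI[of _ 0]) (simp only: nmul_simps rho_zero)
  next
    case (incl h)
    then show ?case by (intro exI[of _ 1]) simp
  next
    case (inv h)
    \<comment> \<open>The inverse of \<open>g\<close> is its multiple by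
      \<open>r - 1\<close>.\<close>
    have "Suc (r - 1) = r" using r(1) prime_gt_0_nat by simp
    then have "nmul (r - 1) g + g = 0" using r(2) nmul_commute[of "r - 1" g 1] by (metis nmul_simps add_0_right One_nat_def)
    then have "?\<rho> (nmul (r - 1) g) \<otimes>\<^bsub>BijGroup ?V\<^esub> ?\<rho> g = \<one>\<^bsub>BijGroup ?V\<^esub>"
      using restrict_plus[OF mem g, of "r - 1"] rho_zero by simp
    then have "inv\<^bsub>BijGroup ?V\<^esub> ?\<rho> g = ?\<rho> (nmul (r - 1) g)"
      by (rule B.inv_equality) (use carrier mem g in auto)
    then show ?case using inv by auto
  next
    case (eng h1 h2)
    then obtain i j where "h1 = ?\<rho> (nmul i g)" "h2 = ?\<rho> (nmul j g)" by blast
    then have "h1 \<otimes>\<^bsub>BijGroup ?V\<^esub> h2 = ?\<rho> (nmul (i + j) g)"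
      using restrict_plus[OF mem mem] by (simp add: nmul_add)
    then show ?case by blast
  qed
  moreover have "apply_bijection (nmul i g) v \<noteq> v" if i: "?\<rho> (nmul i g) \<noteq> \<one>\<^bsub>BijGroup ?V\<^esub>" and v: "v \<in> ?V" for i v
  proof
    assume fixed: "apply_bijection (nmul i g) v = v"
    have "\<not> r dvd i"
    proof
      assume "r dvd i"
      then obtain k where "i = k * r" by (metis dvd_def mult.commute)
      then show False using i rho_zero r(2) by (simp add: nmul_mult)
    qed
    then have "gcd i r = 1"
      using prime_imp_coprime[OF r(1), of i] by (simp add: coprime_iff_gcd_eq_1 gcd.commute)
    moreover have "i \<noteq> 0" using \<open>\<not> r dvd i\<close> by (metis dvd_0_right)
    ultimately obtain x y where "i * x = r * y + 1" using bezout_nat[of i r] by metis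
    then have "nmul (x * i) g = nmul (y * r) g + g"
      using nmul_add[of "y * r" 1 g] by (simp add: mult.commute)
    then have "nmul x (nmul i g) = g" using r(2) by (simp add: nmul_mult)
    moreover have "apply_bijection (nmul x (nmul i g)) v = v" using fixed by (induction x) auto
    ultimately show False using free[OF v] by simp
  qed
  ultimately show ?thesis
    using carrier[OF g] by (fastforce simp: semiregular_def)
qed

theorem theorem2p6:
  fixes G :: "'a pair_pre_digraph"
  assumes "pair_fin_digraph G"
    and "Digraph_Component.connected (with_proj G)"
    and "asym (parcs G)"
    and "arc_transitive G"
    and "\<forall>v \<in> pverts G. out_degree (with_proj G) v = 4"
  shows "\<exists>p \<in> digraph_automorphisms G.
           p \<noteq> \<one>\<^bsub>BijGroup (pverts G)\<^esub> \<and> semiregular (pverts G) p"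
proof -
  interpret pair_fin_digraph G by fact
  have E_sub: "parcs G \<subseteq> pverts G \<times> pverts G" using in_arcsD1 in_arcsD2 by auto
  have sc: "strongly_connected (with_proj (mk_symmetric (with_proj G)))"
    using assms(2) unfolding Digraph_Component.connected_def .
  interpret A: arc_transitive_action "automorphism_bijections G" "pverts G" apply_bijection "parcs G"
  proof
    show "add_subgroup (automorphism_bijections G)" by (rule automorphism_bijections_subgroup)
    show "finite (automorphism_bijections G)"
      by (rule automorphism_bijections_finite) (rule pair_finite_verts)
    \<comment> \<open>Strong connectedness in the library includes that there is a vertex.\<close>
    show "pverts G \<noteq> {}" using sc by (simp add: strongly_connected_def)
    show "g = 0" if "g \<in> automorphism_bijections G" "\<And>v. v \<in> pverts G \<Longrightarrow> apply_bijection g v = v" for g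
      using that add_subgroupD(1)[OF automorphism_bijections_subgroup] by (intro automorphism_bijections_eqI) auto
    show "(apply_bijection g u, apply_bijection g v) \<in> parcs G"
      if "g \<in> automorphism_bijections G" "(u, v) \<in> parcs G" for g u v
      using that E_sub by (auto simp: automorphism_bijections_def)
    show "\<exists>g\<in>automorphism_bijections G. apply_bijection g u = x \<and> apply_bijection g v = y"
      if uv: "(u, v) \<in> parcs G" and xy: "(x, y) \<in> parcs G" for u v x y
    proof -
      obtain p where p: "p \<in> digraph_automorphisms G" "p u = x" "p v = y"
        using assms(4) uv xy unfolding arc_transitive_def by fast
      obtain h where "h \<in> automorphism_bijections G" "\<And>v. v \<in> pverts G \<Longrightarrow> apply_bijection h v = p v"
        using automorphism_extends[OF p(1)] by blast
      then show ?thesis using p E_sub uv by auto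
    qed
    show "(u, v) \<in> (parcs G \<union> (parcs G)\<inverse>)\<^sup>*" if "u \<in> pverts G" "v \<in> pverts G" for u v
    proof -
      have "(u, v) \<in> rtrancl_on (pverts G) (parcs (mk_symmetric (with_proj G)))"
        using sc that by (simp add: strongly_connected_def Digraph.reachable_def)
      moreover have "parcs (mk_symmetric (with_proj G)) \<subseteq> parcs G \<union> (parcs G)\<inverse>"
        by (auto simp: parcs_mk_symmetric)
      ultimately show ?thesis
        by (induction rule: rtrancl_on_induct) (auto intro: rtrancl_into_rtrancl)
    qed
    show "card (parcs G `` {v}) = 4" if "v \<in> pverts G" for v
    proof -
      have "out_arcs (with_proj G) v = Pair v ` (parcs G `` {v})" by (auto simp: out_arcs_def)
      then have "out_degree (with_proj G) v = card (parcs G `` {v})"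
        by (simp add: out_degree_def card_image inj_on_def)
      then show ?thesis using assms(5) that by simp
    qed
  qed (use E_sub pair_finite_verts automorphism_bijections_closed in auto)
  obtain r g where g: "g \<in> automorphism_bijections G" "prime r" "nmul r g = 0"
    "\<And>v. v \<in> pverts G \<Longrightarrow> apply_bijection g v \<noteq> v"
    using A.semiregular_element_exists by blast
  let ?p = "restrict (apply_bijection g) (pverts G)"
  obtain v where v: "v \<in> pverts G" using A.V_ne by blast
  have "?p v \<noteq> \<one>\<^bsub>BijGroup (pverts G)\<^esub> v" using g(4)[OF v] v by (simp add: BijGroup_def)
  then show ?thesis
    using restrict_automorphism[OF g(1)] semiregular_restrict[OF g] by metis
qed

end
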